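(* Let $\alpha>-1/2$ and let $\sigma>0$. The following estimates hold uniformly in $x,y\in\mathbb{R}$. (A) Assume that $xy\ge0$. (A1) If $|x|+|y|\le1$, then $$K_D^{\alpha,\sigma}(x,y)\simeq\chi_{\{\sigma>\alpha+1\}}+\chi_{\{\sigma=\alpha+1\}}\log\frac{1}{|x|+|y|}+(|x|+|y|)^{-2\alpha-1}\begin{cases}|x-y|^{2\sigma-1}, & \sigma<1/2,\\ 1+\log\frac{|x|+|y|}{|x-y|}, & \sigma=1/2,\\ (|x|+|y|)^{2\sigma-1}, & \sigma>1/2.\end{cases}$$ (A2) If $|x|+|y|>1$, then $$K_D^{\alpha,\sigma}(x,y)\simeq\simeq(|x|+|y|)^{-2\alpha-1}\exp\big(-c|x-y||x+y|\big)\begin{cases}|x-y|^{2\sigma-1}, & \sigma<1/2,\\ 1+\log^+\frac{1}{|x-y||x+y|}, & \sigma=1/2,\\ (|x|+|y|)^{1-2\sigma}, & \sigma>1/2.\end{cases}$$ (B) Assume that $xy<0$. (B1) If $|x|+|y|\le1$, then $$K_D^{\alpha,\sigma}(x,y)\simeq\chi_{\{\sigma>\alpha+1\}}+\chi_{\{\sigma=\alpha+1\}}\log\frac{1}{|x|+|y|}+(|x|+|y|)^{-2\alpha-1}(|x|+|y|)^{2\sigma-1}.$$ (B2) If $|x|+|y|>1$, then $$K_D^{\alpha,\sigma}(x,y)\simeq\simeq(|x|+|y|)^{-2\alpha-1}\exp\big(-c|x-y||x+y|\big)(|x|+|y|)^{1-2\sigma}(|x|+|y|)^{-4}.$$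
   Context: For $\alpha>-1$, let $I_\nu$ denote the modified Bessel function of the first kind of order $\nu$ and let $$\Phi_\alpha(u)=|u|^{-\alpha}\big[I_\alpha(|u|)+\operatorname{sgn}(u)I_{\alpha+1}(|u|)\big],\qquad u\in\mathbb{R},$$ with $\Phi_\alpha(0)=2^{-\alpha}/\Gamma(\alpha+1)$ (the limiting value). The Dunkl–Laguerre heat kernel is $$G_t^{\alpha,D}(x,y)=\frac12(\sinh 2t)^{-\alpha-1}\exp\Big(-\frac12\coth(2t)(x^2+y^2)\Big)\Phi_\alpha\Big(\frac{xy}{\sinh 2t}\Big),\qquad x,y\in\mathbb{R},\ t>0,$$ and for $\sigma>0$ the potential kernel is $$K_D^{\alpha,\sigma}(x,y)=\frac1{\Gamma(\sigma)}\int_0^\infty G_t^{\alpha,D}(x,y)\,t^{\sigma-1}\,dt,\qquad x,y\in\mathbb{R}$$ (for $\alpha>-1/2$ the heat kernel is strictly positive, so $K_D^{\alpha,\sigma}$ is well defined with values in $[0,\infty]$). Notation: $\chi_{\{\cdot\}}$ equals $1$ if the condition holds and $0$ otherwise; $\log^+s=\max(\log s,0)$. $X\simeq Y$ means $C^{-1}Y\le X\le CY$ with a constant $C>0$ depending only on $\alpha,\sigma$. $X\simeq\simeq Y\exp(-cZ)$ means that there are positive constants $C,c_1,c_2$, depending only on $\alpha,\sigma$, such that $C^{-1}Y\exp(-c_1Z)\le X\le CY\exp(-c_2Z)$. All expressions are understood as valued in $[0,\infty]$ with natural limiting interpretations where needed (for instance $0^\beta=\infty$ for $\beta<0$, $\log\frac10=\infty$,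 and products of powers of $|x|+|y|$ are combined into a single power). *)

theory Defs
  imports "HOL-Analysis.Analysis"
begin

text \<open>
  The power series of the modified Bessel function of the first kind, meant for \<open>x > 0\<close>;
  \<open>rGamma\<close> is the reciprocal Gamma function.
\<close>
definition bessel_I :: "real \<Rightarrow> real \<Rightarrow> real" where
  "bessel_I \<nu> x = (\<Sum>k. (x / 2) powr (2 * real k + \<nu>) * rGamma (\<nu> + real k + 1) / fact k)"

definition Phi :: "real \<Rightarrow> real \<Rightarrow> real" where
  "Phi \<alpha> u =
    (if u = 0 then 2 powr (-\<alpha>) / Gamma (\<alpha> + 1)
     else \<bar>u\<bar> powr (-\<alpha>) * (bessel_I \<alpha> \<bar>u\<bar> + sgn u * bessel_I (\<alpha> + 1) \<bar>u\<bar>))"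

definition dunkl_heat_kernel :: "real \<Rightarrow> real \<Rightarrow> real \<Rightarrow> real \<Rightarrow> real" where
  "dunkl_heat_kernel \<alpha> t x y =
    1 / 2 * sinh (2 * t) powr (-\<alpha> - 1)
      * exp (- (1 / 2) * (cosh (2 * t) / sinh (2 * t)) * (x\<^sup>2 + y\<^sup>2))
      * Phi \<alpha> (x * y / sinh (2 * t))"

text \<open>
  For \<open>\<alpha> > -1/2\<close> the integrand is positive, so the truncation of negative values by \<open>ennreal\<close>
  has no effect.
\<close>
definition dunkl_potential_kernel :: "real \<Rightarrow> real \<Rightarrow> real \<Rightarrow> real \<Rightarrow> ennreal" where
  "dunkl_potential_kernel \<alpha> \<sigma> x y =
    ennreal (1 / Gamma \<sigma>)
      * (\<integral>\<^sup>+ t \<in> {0<..}. ennreal (dunkl_heat_kernel \<alpha> t x y * t powr (\<sigma> - 1)) \<partial>lborel)"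

text \<open>
  Powers of \<open>s \<ge> 0\<close> with values in \<open>[0, \<infinity>]\<close>: \<open>0\<^sup>\<beta> = \<infinity>\<close> for \<open>\<beta> < 0\<close> and \<open>0\<^sup>0 = 1\<close>,
  whereas \<open>powr\<close> is \<open>0\<close> at base \<open>0\<close>.
\<close>
definition epow :: "real \<Rightarrow> real \<Rightarrow> ennreal" where
  "epow s \<beta> = (if s = 0 then (if \<beta> < 0 then \<infinity> else if \<beta> = 0 then 1 else 0) else ennreal (s powr \<beta>))"

definition elog :: "ennreal \<Rightarrow> ereal" where
  "elog s = (if s = 0 then -\<infinity> else if s = \<infinity> then \<infinity> else ereal (ln (enn2real s)))"

definition elog_plus :: "ennreal \<Rightarrow> ennreal" where
  "elog_plus s = e2ennreal (max (elog s) 0)"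

definition two_sided_bound ::
    "(real \<times> real) set \<Rightarrow> (real \<Rightarrow> real \<Rightarrow> ennreal) \<Rightarrow> (real \<Rightarrow> real \<Rightarrow> ennreal) \<Rightarrow> bool" where
  "two_sided_bound S X Y \<longleftrightarrow>
    (\<exists>C>0. \<forall>(x, y)\<in>S. ennreal (1 / C) * Y x y \<le> X x y \<and> X x y \<le> ennreal C * Y x y)"

definition two_sided_exp_bound ::
    "(real \<times> real) set \<Rightarrow> (real \<Rightarrow> real \<Rightarrow> ennreal) \<Rightarrow> (real \<Rightarrow> real \<Rightarrow> ennreal)
      \<Rightarrow> (real \<Rightarrow> real \<Rightarrow> real) \<Rightarrow> bool" where
  "two_sided_exp_bound S X Y Z \<longleftrightarrow>
    (\<exists>C>0. \<exists>c\<^sub>1>0. \<exists>c\<^sub>2>0. \<forall>(x, y)\<in>S.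
       ennreal (1 / C) * Y x y * ennreal (exp (- c\<^sub>1 * Z x y)) \<le> X x y \<and>
       X x y \<le> ennreal C * Y x y * ennreal (exp (- c\<^sub>2 * Z x y)))"

text \<open>
  The right-hand sides, without the exponential factor for \<open>|x| + |y| > 1\<close>. In the first and third
  the powers of \<open>|x| + |y|\<close> are combined: this matters for \<open>x = y = 0\<close>, where \<open>\<infinity> * 0 = 0\<close> in
  \<open>ennreal\<close> would otherwise give a wrong value. The logarithms there are nonnegative
  on the region concerned, so \<open>e2ennreal\<close> does not truncate; the only exception is the undetermined
  \<open>log (0/0)\<close> at \<open>x = y = 0\<close>, \<open>\<sigma> = 1/2\<close>, which is multiplied by \<open>0\<^bsup>-2\<alpha>-1\<^esup> = \<infinity>\<close> after adding \<open>1\<close>.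
\<close>
definition bound_A1 :: "real \<Rightarrow> real \<Rightarrow> real \<Rightarrow> real \<Rightarrow> ennreal" where
  "bound_A1 \<alpha> \<sigma> x y =
    of_bool (\<sigma> > \<alpha> + 1)
    + of_bool (\<sigma> = \<alpha> + 1) * e2ennreal (elog (1 / ennreal (\<bar>x\<bar> + \<bar>y\<bar>)))
    + (if \<sigma> < 1/2 then epow (\<bar>x\<bar> + \<bar>y\<bar>) (-2*\<alpha> - 1) * epow \<bar>x - y\<bar> (2*\<sigma> - 1)
       else if \<sigma> = 1/2 then
         epow (\<bar>x\<bar> + \<bar>y\<bar>) (-2*\<alpha> - 1)
           * (1 + e2ennreal (elog (ennreal (\<bar>x\<bar> + \<bar>y\<bar>) / ennreal \<bar>x - y\<bar>)))
       else epow (\<bar>x\<bar> + \<bar>y\<bar>) ((-2*\<alpha> - 1) + (2*\<sigma> - 1)))"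

definition bound_A2 :: "real \<Rightarrow> real \<Rightarrow> real \<Rightarrow> real \<Rightarrow> ennreal" where
  "bound_A2 \<alpha> \<sigma> x y =
    epow (\<bar>x\<bar> + \<bar>y\<bar>) (-2*\<alpha> - 1)
    * (if \<sigma> < 1/2 then epow \<bar>x - y\<bar> (2*\<sigma> - 1)
       else if \<sigma> = 1/2 then 1 + elog_plus (1 / ennreal (\<bar>x - y\<bar> * \<bar>x + y\<bar>))
       else epow (\<bar>x\<bar> + \<bar>y\<bar>) (1 - 2*\<sigma>))"

definition bound_B1 :: "real \<Rightarrow> real \<Rightarrow> real \<Rightarrow> real \<Rightarrow> ennreal" where
  "bound_B1 \<alpha> \<sigma> x y =
    of_bool (\<sigma> > \<alpha> + 1)
    + of_bool (\<sigma> = \<alpha> + 1) * e2ennreal (elog (1 / ennreal (\<bar>x\<bar> + \<bar>y\<bar>)))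
    + epow (\<bar>x\<bar> + \<bar>y\<bar>) ((-2*\<alpha> - 1) + (2*\<sigma> - 1))"

definition bound_B2 :: "real \<Rightarrow> real \<Rightarrow> real \<Rightarrow> real \<Rightarrow> ennreal" where
  "bound_B2 \<alpha> \<sigma> x y =
    epow (\<bar>x\<bar> + \<bar>y\<bar>) (-2*\<alpha> - 1) * epow (\<bar>x\<bar> + \<bar>y\<bar>) (1 - 2*\<sigma>) * epow (\<bar>x\<bar> + \<bar>y\<bar>) (-4)"

end

theory Submission
  imports Defs
begin

text \<open>
  Put \<open>a = \<bar>\<bar>x\<bar> - \<bar>y\<bar>\<bar>\<close> and \<open>b = \<bar>x\<bar> + \<bar>y\<bar>\<close>; then \<open>\<bar>x - y\<bar> * \<bar>x + y\<bar> = a * b\<close> whatever the signs. With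
  \<open>u = x y / sinh (2 t)\<close> the half-angle formulas turn the Gaussian factor of the heat kernel into
  \<open>exp (- (tanh t * b\<^sup>2 + a\<^sup>2 / tanh t) / 4) * exp (- \<bar>u\<bar>)\<close> (\<open>gaussian_exponent\<close>), so what matters is
  the size of \<open>exp (- \<bar>u\<bar>) * \<Phi> u\<close>. Up to a constant, \<open>\<Phi> u\<close> is the integral of \<open>exp (u s)\<close> over
  \<open>-1 < s < 1\<close> against \<open>(1 - s) powr (\<alpha> - 1/2) * (1 + s) powr (\<alpha> + 1/2)\<close>. For large \<open>\<bar>u\<bar>\<close> only the
  endpoint \<open>s = sgn u\<close> counts, and the weight vanishes there to one order more when \<open>u < 0\<close>. Hence
  the size is \<open>(1 + \<bar>u\<bar>) powr (- \<alpha> - 1/2)\<close> for \<open>u \<ge> 0\<close> and \<open>(1 + \<bar>u\<bar>) powr (- \<alpha> - 3/2)\<close> for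
  \<open>u < 0\<close> (\<open>Phi_bounds\<close>).

  Consequently, for \<open>t \<le> 2\<close>, the integrand of the potential kernel is comparable, up to the constant
  \<open>c\<close> in the exponent, to the profile
  \<open>t powr (\<sigma>' - 3/2) * (t + b\<^sup>2) powr (- \<alpha>' - 1/2) * exp (- c (t b\<^sup>2 + a\<^sup>2 / t))\<close>, where
  \<open>(\<alpha>', \<sigma>')\<close> is \<open>(\<alpha>, \<sigma>)\<close> if \<open>x y \<ge> 0\<close> and \<open>(\<alpha> + 1, \<sigma> + 1)\<close> if \<open>x y < 0\<close>
  (\<open>heat_kernel_small_time\<close>). Times \<open>t \<ge> 2\<close> contribute at most a multiple of \<open>exp (- d b\<^sup>2)\<close>, which the
  other times dominate. So the estimates for \<open>x y < 0\<close> are those for \<open>x y \<ge> 0\<close> with both parameters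
  raised by one; since \<open>\<sigma> + 1 > 1/2\<close>, only the third of the three cases survives.

  It remains to find the order of the integral of the profile over \<open>0 < t \<le> 2\<close>. If \<open>b \<le> 1\<close>, the
  factor \<open>exp (- c t b\<^sup>2)\<close> is bounded below and one splits at \<open>t = b\<^sup>2\<close>. Above, the profile is of
  order \<open>t powr (\<sigma> - \<alpha> - 2)\<close>, which yields the terms for \<open>\<sigma> \<ge> \<alpha> + 1\<close>; below, \<open>t + b\<^sup>2\<close> is of order \<open>b\<^sup>2\<close> and
  the integral of \<open>t powr (\<sigma> - 3/2)\<close>, cut off at \<open>t = a\<^sup>2\<close>, yields the case distinction at
  \<open>\<sigma> = 1/2\<close>. If \<open>b > 1\<close>, then \<open>t + b\<^sup>2\<close> is of order \<open>b\<^sup>2\<close> throughout, the exponential cuts the integral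
  off at \<open>a\<^sup>2\<close> and at \<open>1 / b\<^sup>2\<close>, and \<open>t b\<^sup>2 + a\<^sup>2 / t \<ge> 2 a b\<close> produces \<open>exp (- c a b)\<close>.
  Where a bound is infinite (\<open>a = 0\<close> and \<open>\<sigma> \<le> 1/2\<close>, or \<open>b = 0\<close> and \<open>\<sigma> \<le> \<alpha> + 1\<close>), the integral diverges
  at \<open>t = 0\<close> as well.
\<close>

section \<open>Integrals of powers over intervals\<close>

abbreviation integral_over :: "real set \<Rightarrow> (real \<Rightarrow> real) \<Rightarrow> ennreal" where
  "integral_over A f \<equiv> (\<integral>\<^sup>+ t \<in> A. ennreal (f t) \<partial>lborel)"

lemma integral_over_mono:
  assumes "A \<subseteq> B" and "\<And>t. t \<in> A \<Longrightarrow> f t \<le> g t"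
  shows "integral_over A f \<le> integral_over B g"
  by (rule nn_integral_mono)
     (use assms in \<open>auto split: split_indicator intro!: ennreal_leI\<close>)

lemma integral_over_cmult:
  assumes "k \<ge> 0" and [measurable]: "f \<in> borel_measurable borel" "A \<in> sets borel"
  shows "integral_over A (\<lambda>t. k * f t) = ennreal k * integral_over A f"
  using assms(1) by (subst nn_integral_cmult [symmetric]) (auto simp: ennreal_mult' mult_ac)

lemma integral_over_subadditive:
  assumes "A \<subseteq> B \<union> C"
    and [measurable]: "f \<in> borel_measurable borel" "B \<in> sets borel" "C \<in> sets borel"
  shows "integral_over A f \<le> integral_over B f + integral_over C f"
proof -
  have "integral_over A f \<le> (\<integral>\<^sup>+ t. ennreal (f t) * indicator B t + ennreal (f t) * indicator C t \<partial>lborel)"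
    by (rule nn_integral_mono) (use assms(1) in \<open>auto split: split_indicator\<close>)
  also have "\<dots> = integral_over B f + integral_over C f"
    by (rule nn_integral_add) auto
  finally show ?thesis .
qed

lemma integral_over_upper:
  assumes "A \<subseteq> B" and "k \<ge> 0" and "\<And>t. t \<in> A \<Longrightarrow> f t \<le> k * g t"
    and "integral_over B g \<le> ennreal r"
    and [measurable]: "g \<in> borel_measurable borel" "B \<in> sets borel"
  shows "integral_over A f \<le> ennreal (k * r)"
proof -
  have "integral_over A f \<le> integral_over B (\<lambda>t. k * g t)"
    by (rule integral_over_mono) (use assms in auto)
  also have "\<dots> = ennreal k * integral_over B g"
    by (rule integral_over_cmult) (use assms in auto)
  also have "\<dots> \<le> ennreal k * ennreal r"
    using assms by (intro mult_left_mono) auto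
  finally show ?thesis using assms by (simp add: ennreal_mult')
qed

lemma integral_over_lower:
  assumes "U \<subseteq> A" and "k \<ge> 0" and "\<And>t. t \<in> U \<Longrightarrow> k * g t \<le> f t"
    and "ennreal r \<le> integral_over U g"
    and [measurable]: "g \<in> borel_measurable borel" "U \<in> sets borel"
  shows "ennreal (k * r) \<le> integral_over A f"
proof -
  have "ennreal (k * r) = ennreal k * ennreal r"
    using assms by (simp add: ennreal_mult')
  also have "\<dots> \<le> ennreal k * integral_over U g"
    using assms by (intro mult_left_mono) auto
  also have "\<dots> = integral_over U (\<lambda>t. k * g t)"
    by (rule integral_over_cmult [symmetric]) (use assms in auto)
  also have "\<dots> \<le> integral_over A f"
    by (rule integral_over_mono) (use assms in auto)
  finally show ?thesis .
qed

lemma integral_over_union_upper: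
  assumes "A \<subseteq> B \<union> C" and "integral_over B f \<le> ennreal p" and "integral_over C f \<le> ennreal q"
    and "p \<ge> 0" "q \<ge> 0" and "f \<in> borel_measurable borel" "B \<in> sets borel" "C \<in> sets borel"
  shows "integral_over A f \<le> ennreal (p + q)"
  using integral_over_subadditive[OF assms(1,6,7,8)] add_mono[OF assms(2,3)] assms(4,5)
  by (simp add: ennreal_plus)

lemma integral_over_add_upper:
  assumes "integral_over A f \<le> ennreal p" "integral_over A g \<le> ennreal r" "p \<ge> 0" "r \<ge> 0"
    and "\<And>t. t \<in> A \<Longrightarrow> h t \<le> f t + g t" "\<And>t. f t \<ge> 0" "\<And>t. g t \<ge> 0"
    and [measurable]: "f \<in> borel_measurable borel" "g \<in> borel_measurable borel" "A \<in> sets borel"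
  shows "integral_over A h \<le> ennreal (p + r)"
proof -
  have "integral_over A h \<le> (\<integral>\<^sup>+ t. ennreal (f t) * indicator A t + ennreal (g t) * indicator A t \<partial>lborel)"
    by (rule nn_integral_mono)
       (use assms(5-7) in \<open>auto split: split_indicator simp flip: ennreal_plus intro!: ennreal_leI\<close>)
  also have "\<dots> = integral_over A f + integral_over A g"
    by (rule nn_integral_add) auto
  also have "\<dots> \<le> ennreal p + ennreal r" by (intro add_mono assms)
  finally show ?thesis using assms by simp
qed

lemma powr_dyadic_lower:
  fixes s :: real
  obtains k :: real where "k > 0" and "\<And>h t. 0 < h \<Longrightarrow> h \<le> t \<Longrightarrow> t \<le> 2 * h \<Longrightarrow> k * h powr s \<le> t powr s"
proof (cases "s \<ge> 0")
  case True
  show ?thesis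
    by (rule that[of 1]) (use True in \<open>auto intro: powr_mono2\<close>)
next
  case False
  show ?thesis
  proof (rule that[of "2 powr s"])
    fix h t :: real assume "0 < h" "h \<le> t" "t \<le> 2 * h"
    then have "(2 * h) powr s \<le> t powr s"
      using False by (intro powr_mono2') auto
    then show "2 powr s * h powr s \<le> t powr s"
      using \<open>0 < h\<close> by (simp add: powr_mult)
  qed auto
qed

text \<open>
  Raise \<open>c x / N \<le> exp (c x / N)\<close> to the power \<open>N\<close>. Trading exponential damping for an arbitrarily
  high power reduces every damped integral below to integrals of pure powers.
\<close>

lemma exp_le_powr:
  fixes c N :: real
  assumes "c > 0" and "N > 0"
  obtains K where "K > 0" and "\<And>x. x > 0 \<Longrightarrow> exp (- c * x) \<le> K * x powr (-N)"
proof (rule that[of "(c / N) powr (-N)"])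
  fix x :: real assume "x > 0"
  have "c * x / N \<le> exp (c * x / N)"
    using exp_ge_add_one_self[of "c * x / N"] by linarith
  then have "(c * x / N) powr N \<le> exp (c * x / N) powr N"
    using assms \<open>x > 0\<close> by (intro powr_mono2) auto
  also have "\<dots> = exp (c * x)"
    using assms by (simp add: exp_powr_real)
  finally have "exp (- (c * x)) \<le> inverse ((c * x / N) powr N)"
    using assms \<open>x > 0\<close> by (simp add: exp_minus le_imp_inverse_le)
  also have "\<dots> = (c / N * x) powr (-N)"
    by (simp add: powr_minus)
  also have "\<dots> = (c / N) powr (-N) * x powr (-N)"
    by (rule powr_mult)
  finally show "exp (- c * x) \<le> (c / N) powr (-N) * x powr (-N)" by simp
qed (use assms in auto)

lemma integral_power_near_0:
  assumes "s > -1" and "h > 0"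
  shows "integral_over {0<..h} (\<lambda>t. t powr s) \<le> ennreal (h powr (s + 1) / (s + 1))"
proof -
  have "integral_over {0<..h} (\<lambda>t. t powr s) \<le> integral_over {0..h} (\<lambda>t. t powr s)"
    by (rule integral_over_mono) auto
  also have "\<dots> = ennreal (h powr (s + 1) / (s + 1))"
    by (rule nn_integral_has_integral_lebesgue') (use assms has_integral_powr_from_0 in auto)
  finally show ?thesis .
qed

lemma integral_power_near_infinity:
  assumes "s < -1" and "h > 0"
  shows "integral_over {h..} (\<lambda>t. t powr s) \<le> ennreal (h powr (s + 1) / (- s - 1))"
proof -
  have "integral_over {h..} (\<lambda>t. t powr s) = ennreal (- (h powr (s + 1)) / (s + 1))"
    by (rule nn_integral_has_integral_lebesgue') (use assms has_integral_powr_to_inf in auto)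
  also have "- (h powr (s + 1)) / (s + 1) = h powr (s + 1) / (- s - 1)"
    by (metis diff_minus_eq_add minus_diff_eq minus_divide_divide minus_minus uminus_add_conv_diff)
  finally show ?thesis by simp
qed

lemma integral_inverse:
  assumes "0 < u" and "u \<le> v"
  shows "integral_over {u..v} (\<lambda>t. t powr (-1)) = ennreal (ln (v / u))"
proof -
  have "integral_over {u..v} (\<lambda>t. t powr (-1)) = ennreal (ln v - ln u)"
  proof (rule nn_integral_FTC_Icc)
    show "(ln has_real_derivative x powr (-1)) (at x)" if "x \<in> {u..v}" for x
      using that assms by (auto simp: powr_minus_divide intro!: derivative_eq_intros)
  qed (use assms in auto)
  then show ?thesis using assms by (simp add: ln_div)
qed

text \<open>
  A single dyadic interval carries a fixed share of what the half-line integrals give; this is where the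
  lower bounds by pure powers come from.
\<close>

lemma integral_power_dyadic_lower:
  fixes s :: real
  obtains k where "k > 0"
    and "\<And>h. h > 0 \<Longrightarrow> ennreal (k * h powr (s + 1)) \<le> integral_over {h..2*h} (\<lambda>t. t powr s)"
proof -
  obtain k :: real where k: "k > 0" "\<And>h t. 0 < h \<Longrightarrow> h \<le> t \<Longrightarrow> t \<le> 2 * h \<Longrightarrow> k * h powr s \<le> t powr s"
    using powr_dyadic_lower[of s] by metis
  show ?thesis
  proof (rule that[OF k(1)])
    fix h :: real assume h: "h > 0"
    have "ennreal (k * h powr (s + 1)) = ennreal (k * h powr s) * ennreal h"
      using h k by (simp add: powr_add flip: ennreal_mult'')
    also have "\<dots> = integral_over {h..2*h} (\<lambda>t. k * h powr s)"
      using h by (subst nn_integral_cmult_indicator) auto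
    also have "\<dots> \<le> integral_over {h..2*h} (\<lambda>t. t powr s)"
      by (rule integral_over_mono) (use k h in auto)
    finally show "ennreal (k * h powr (s + 1)) \<le> integral_over {h..2*h} (\<lambda>t. t powr s)" .
  qed
qed

text \<open>
  The factor \<open>exp (- c h / t)\<close> is smaller than any power of \<open>t / h\<close>, so the integral converges at \<open>0\<close> for
  every exponent; its order in \<open>h\<close> is dictated by scaling.
\<close>

lemma integral_power_damped_near_0:
  fixes s c :: real
  assumes "c > 0"
  obtains K where "K > 0" and "\<And>h. h > 0 \<Longrightarrow>
    integral_over {0<..h} (\<lambda>t. t powr s * exp (- c * (h / t))) \<le> ennreal (K * h powr (s + 1))"
proof -
  \<comment> \<open>large enough for \<open>s + N > -1\<close>\<close>
  define N where "N = \<bar>s\<bar> + 1"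
  obtain K where K: "K > 0" "\<And>x. x > 0 \<Longrightarrow> exp (- c * x) \<le> K * x powr (-N)"
    using exp_le_powr[OF assms, of N] unfolding N_def by (metis abs_ge_zero add_nonneg_pos zero_less_one)
  have sN: "s + N > -1" unfolding N_def by linarith
  show ?thesis
  proof (rule that[of "K / (s + N + 1)"])
    fix h :: real assume h: "h > 0"
    have "integral_over {0<..h} (\<lambda>t. t powr s * exp (- c * (h / t)))
        \<le> integral_over {0<..h} (\<lambda>t. (K * h powr (-N)) * t powr (s + N))"
    proof (rule integral_over_mono)
      fix t assume t: "t \<in> {0<..h}"
      have "t powr s * exp (- c * (h / t)) \<le> t powr s * (K * (h / t) powr (-N))"
        using t h by (intro mult_left_mono K(2)) auto
      also have "\<dots> = (K * h powr (-N)) * t powr (s + N)"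
        using t h by (simp add: powr_divide powr_minus powr_add field_simps)
      finally show "t powr s * exp (- c * (h / t)) \<le> (K * h powr (-N)) * t powr (s + N)" .
    qed auto
    also have "\<dots> = ennreal (K * h powr (-N)) * integral_over {0<..h} (\<lambda>t. t powr (s + N))"
      using K by (intro integral_over_cmult) auto
    also have "\<dots> \<le> ennreal (K * h powr (-N)) * ennreal (h powr (s + N + 1) / (s + N + 1))"
      by (intro mult_left_mono integral_power_near_0 sN h) auto
    also have "\<dots> = ennreal (K / (s + N + 1) * h powr (s + 1))"
      using K h sN by (simp add: powr_minus powr_add field_simps flip: ennreal_mult'')
    finally show "integral_over {0<..h} (\<lambda>t. t powr s * exp (- c * (h / t)))
        \<le> ennreal (K / (s + N + 1) * h powr (s + 1))" .
  qed (use K sN in auto)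
qed

text \<open>
  The mirror image at infinity: \<open>exp (- c t / h)\<close> makes every power integrable there.
\<close>

lemma integral_power_damped_near_infinity:
  fixes s c :: real
  assumes "c > 0"
  obtains K where "K > 0" and "\<And>h. h > 0 \<Longrightarrow>
    integral_over {h..} (\<lambda>t. t powr s * exp (- c * (t / h))) \<le> ennreal (K * h powr (s + 1))"
proof -
  \<comment> \<open>large enough for \<open>s - N < -1\<close>\<close>
  define N where "N = \<bar>s\<bar> + 2"
  obtain K where K: "K > 0" "\<And>x. x > 0 \<Longrightarrow> exp (- c * x) \<le> K * x powr (-N)"
    using exp_le_powr[OF assms, of N] unfolding N_def by (metis abs_ge_zero add_nonneg_pos zero_less_numeral)
  have sN: "s - N < -1" unfolding N_def by linarith
  show ?thesis
  proof (rule that[of "K / (- (s - N) - 1)"])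
    fix h :: real assume h: "h > 0"
    have "integral_over {h..} (\<lambda>t. t powr s * exp (- c * (t / h)))
        \<le> integral_over {h..} (\<lambda>t. (K * h powr N) * t powr (s - N))"
    proof (rule integral_over_mono)
      fix t assume t: "t \<in> {h..}"
      have "t powr s * exp (- c * (t / h)) \<le> t powr s * (K * (t / h) powr (-N))"
        using t h by (intro mult_left_mono K(2)) auto
      also have "\<dots> = (K * h powr N) * t powr (s - N)"
        using t h by (simp add: powr_divide powr_minus powr_diff field_simps)
      finally show "t powr s * exp (- c * (t / h)) \<le> (K * h powr N) * t powr (s - N)" .
    qed auto
    also have "\<dots> = ennreal (K * h powr N) * integral_over {h..} (\<lambda>t. t powr (s - N))"
      using K by (intro integral_over_cmult) auto
    also have "\<dots> \<le> ennreal (K * h powr N) * ennreal (h powr (s - N + 1) / (- (s - N) - 1))"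
      by (intro mult_left_mono integral_power_near_infinity sN h) auto
    also have "\<dots> = ennreal (K / (- (s - N) - 1) * (h powr N * h powr (s - N + 1)))"
      using K h sN by (simp flip: ennreal_mult'')
    also have "h powr N * h powr (s - N + 1) = h powr (s + 1)"
      by (simp flip: powr_add)
    finally show "integral_over {h..} (\<lambda>t. t powr s * exp (- c * (t / h)))
        \<le> ennreal (K / (- (s - N) - 1) * h powr (s + 1))" .
  qed (use K sN in auto)
qed

text \<open>
  Near \<open>0\<close> the power dominates a multiple of \<open>1 / t\<close>, whose integral over \<open>[h exp (- n), h]\<close> is
  \<open>n\<close>.
\<close>

lemma integral_power_diverges:
  assumes "s \<le> -1" and "h > 0"
  shows "integral_over {0<..h} (\<lambda>t. t powr s) = \<infinity>"
proof -
  define k where "k = h powr (s + 1)"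
  have k: "k > 0" using assms by (simp add: k_def)
  have bound: "ennreal (k * real n) \<le> integral_over {0<..h} (\<lambda>t. t powr s)" for n
  proof -
    have "ennreal (k * real n) = ennreal k * integral_over {h * exp (- real n)..h} (\<lambda>t. t powr (-1))"
    proof -
      have ratio: "h / (h * exp (- real n)) = exp (real n)"
        using assms by (simp add: exp_minus field_simps)
      moreover have "h * exp (- real n) \<le> h"
        using assms by (simp add: mult_left_le)
      ultimately have "integral_over {h * exp (- real n)..h} (\<lambda>t. t powr (-1)) = ennreal (real n)"
        using assms by (subst integral_inverse) (auto simp only: ratio ln_exp, auto)
      then show ?thesis
        using k by (simp only: ennreal_mult')
    qed
    also have "\<dots> = integral_over {h * exp (- real n)..h} (\<lambda>t. k * t powr (-1))"
      using k by (intro integral_over_cmult [symmetric]) auto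
    also have "\<dots> \<le> integral_over {0<..h} (\<lambda>t. t powr s)"
    proof (rule integral_over_mono)
      have pos: "0 < h * exp (- real n)" using assms by simp
      show "{h * exp (- real n)..h} \<subseteq> {0<..h}"
        using assms by (auto intro: less_le_trans[OF pos])
      fix t assume "t \<in> {h * exp (- real n)..h}"
      then have t: "0 < t" "t \<le> h"
        using assms by (auto intro: less_le_trans[OF pos])
      have "k * t powr (-1) \<le> t powr (s + 1) * t powr (-1)"
        unfolding k_def using assms t by (intro mult_right_mono powr_mono2') auto
      also have "\<dots> = t powr s"
        by (simp only: powr_add [symmetric]) simp
      finally show "k * t powr (-1) \<le> t powr s" .
    qed
    finally show ?thesis .
  qed
  show ?thesis
  proof (rule ccontr)
    assume "integral_over {0<..h} (\<lambda>t. t powr s) \<noteq> \<infinity>"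
    then obtain r where r: "r \<ge> 0" "integral_over {0<..h} (\<lambda>t. t powr s) = ennreal r"
      by (metis ennreal_cases infinity_ennreal_def)
    obtain n where "r / k < real n" using reals_Archimedean2 by blast
    then have "r < k * real n" using k by (simp add: field_simps)
    moreover have "k * real n \<le> r"
      using bound[of n] r by (simp add: ennreal_le_iff)
    ultimately show False by simp
  qed
qed

lemma integral_over_infinite:
  assumes "k > 0" and "s \<le> -1" and "h > 0" and "\<And>t. t \<in> {0<..h} \<Longrightarrow> k * t powr s \<le> f t"
  shows "integral_over {0<..h} f = \<infinity>"
proof -
  have "\<infinity> = ennreal k * integral_over {0<..h} (\<lambda>t. t powr s)"
    using assms integral_power_diverges[of s h] by (simp add: ennreal_mult_eq_top_iff ennreal_eq_0_iff)
  also have "\<dots> = integral_over {0<..h} (\<lambda>t. k * t powr s)"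
    using assms by (intro integral_over_cmult [symmetric]) auto
  also have "\<dots> \<le> integral_over {0<..h} f"
    using assms by (intro integral_over_mono) auto
  finally show ?thesis by (simp add: top_unique)
qed

lemma square_powr: "((b::real)\<^sup>2) powr s = \<bar>b\<bar> powr (2 * s)"
proof -
  have "b\<^sup>2 = \<bar>b\<bar> * \<bar>b\<bar>" by (simp add: power2_eq_square)
  then have "(b\<^sup>2) powr s = (\<bar>b\<bar> * \<bar>b\<bar>) powr s" by simp
  also have "\<dots> = \<bar>b\<bar> powr (2 * s)"
    unfolding powr_mult powr_add [symmetric] by simp
  finally show ?thesis .
qed

lemma pos_of_square_le: "0 < b \<Longrightarrow> b\<^sup>2 \<le> t \<Longrightarrow> 0 < (t::real)"
  by (meson less_le_trans zero_less_power)

section \<open>Contributions of small and of moderate times\<close>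

text \<open>
  The order of the integral of \<open>t powr (\<sigma> - 3/2) * exp (- c a\<^sup>2 / t)\<close> over \<open>0 < t < b\<^sup>2\<close>.
\<close>

definition near_diag :: "real \<Rightarrow> real \<Rightarrow> real \<Rightarrow> real" where
  "near_diag \<sigma> a b =
    (if \<sigma> < 1/2 then a powr (2 * \<sigma> - 1) else if \<sigma> = 1/2 then 1 + ln (b / a) else b powr (2 * \<sigma> - 1))"

text \<open>
  The order of the integral of \<open>t powr (\<sigma> - 3/2) * exp (- c (t b\<^sup>2 + a\<^sup>2 / t))\<close> over \<open>0 < t < 2\<close>, apart
  from its exponential decay in \<open>a b\<close>.
\<close>

definition far_diag :: "real \<Rightarrow> real \<Rightarrow> real \<Rightarrow> real" where
  "far_diag \<sigma> a b =
    (if \<sigma> < 1/2 then a powr (2 * \<sigma> - 1) else if \<sigma> = 1/2 then 1 + max 0 (ln (1 / (a * b)))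
     else b powr (1 - 2 * \<sigma>))"

lemma near_diag_ge:
  assumes "0 \<le> a" "a \<le> b" "0 < b" "\<sigma> > 1/2 \<or> a > 0"
  shows "b powr (2 * \<sigma> - 1) \<le> near_diag \<sigma> a b"
proof (cases "\<sigma> = 1/2")
  case True
  show ?thesis using assms unfolding near_diag_def True by simp
next
  case False
  then show ?thesis using assms by (auto simp: near_diag_def intro!: powr_mono2')
qed

lemma near_diag_nonneg:
  assumes "0 \<le> a" "a \<le> b" "0 < b" "\<sigma> > 1/2 \<or> a > 0"
  shows "near_diag \<sigma> a b \<ge> 0"
  using near_diag_ge[OF assms] by (meson order_trans powr_ge_zero)

lemma far_diag_nonneg: "far_diag \<sigma> a b \<ge> 0"
  by (auto simp: far_diag_def)

text \<open>
  The damping suppresses \<open>t < a\<^sup>2\<close> and matters little for \<open>t > a\<^sup>2\<close>. So the integral is essentially that of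
  the power over \<open>[a\<^sup>2, b\<^sup>2]\<close>, which is decided by the left end for \<open>\<sigma> < 1/2\<close>, by the right end for
  \<open>\<sigma> > 1/2\<close>, and by all scales equally, hence logarithmically, for \<open>\<sigma> = 1/2\<close>.
\<close>

lemma integral_singular_upper:
  fixes c \<sigma> :: real
  assumes c: "c > 0"
  obtains C where "C > 0" and "\<And>a b. 0 \<le> a \<Longrightarrow> a \<le> b \<Longrightarrow> 0 < b \<Longrightarrow> \<sigma> > 1/2 \<or> a > 0 \<Longrightarrow>
    integral_over {0<..b\<^sup>2} (\<lambda>t. t powr (\<sigma> - 3/2) * exp (- c * (a\<^sup>2 / t)))
      \<le> ennreal (C * near_diag \<sigma> a b)"
proof -
  obtain K where K: "K > 0" "\<And>h. h > 0 \<Longrightarrow> integral_over {0<..h}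
      (\<lambda>t. t powr (\<sigma> - 3/2) * exp (- c * (h / t))) \<le> ennreal (K * h powr (\<sigma> - 3/2 + 1))"
    using integral_power_damped_near_0[OF c] by blast
  have e1: "\<sigma> - 3/2 + 1 = \<sigma> - 1/2" by simp
  have expo: "exp (- c * (a\<^sup>2 / t)) \<le> 1" if "t > 0" for a t :: real
    using c that by simp
  consider (lt) "\<sigma> < 1/2" | (eq) "\<sigma> = 1/2" | (gt) "\<sigma> > 1/2" by linarith
  then show ?thesis
  proof cases
    case lt
    show ?thesis
    proof (rule that[of "K + 1 / (1/2 - \<sigma>)"])
      fix a b :: real assume ab: "0 \<le> a" "a \<le> b" "0 < b" "\<sigma> > 1/2 \<or> a > 0"
      then have a: "a > 0" using lt by auto
      have 1: "integral_over {0<..a\<^sup>2} (\<lambda>t. t powr (\<sigma> - 3/2) * exp (- c * (a\<^sup>2 / t)))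
          \<le> ennreal (K * a powr (2 * \<sigma> - 1))"
        using K(2)[of "a\<^sup>2"] a by (simp add: square_powr e1 algebra_simps)
      have 2: "integral_over {a\<^sup>2..} (\<lambda>t. t powr (\<sigma> - 3/2) * exp (- c * (a\<^sup>2 / t)))
          \<le> ennreal (1 * ((a\<^sup>2) powr (\<sigma> - 3/2 + 1) / (- (\<sigma> - 3/2) - 1)))"
        by (rule integral_over_upper[OF subset_refl _ _ integral_power_near_infinity])
           (use a lt expo in \<open>auto intro!: mult_left_le simp: pos_of_square_le[OF a]\<close>)
      have "integral_over {0<..b\<^sup>2} (\<lambda>t. t powr (\<sigma> - 3/2) * exp (- c * (a\<^sup>2 / t)))
         \<le> ennreal (K * a powr (2 * \<sigma> - 1) + 1 * ((a\<^sup>2) powr (\<sigma> - 3/2 + 1) / (- (\<sigma> - 3/2) - 1)))"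
        by (rule integral_over_union_upper[OF _ 1 2]) (use K lt in auto)
      also have "K * a powr (2 * \<sigma> - 1) + 1 * ((a\<^sup>2) powr (\<sigma> - 3/2 + 1) / (- (\<sigma> - 3/2) - 1))
          = (K + 1 / (1/2 - \<sigma>)) * near_diag \<sigma> a b"
        using lt a by (simp add: near_diag_def square_powr e1 algebra_simps)
      finally show "integral_over {0<..b\<^sup>2} (\<lambda>t. t powr (\<sigma> - 3/2) * exp (- c * (a\<^sup>2 / t)))
        \<le> ennreal ((K + 1 / (1/2 - \<sigma>)) * near_diag \<sigma> a b)" .
    qed (use K lt in \<open>auto intro!: add_pos_pos\<close>)
  next
    case eq
    have e2: "\<sigma> - 3/2 = -1" using eq by simp
    show ?thesis
    proof (rule that[of "K + 2"])
      fix a b :: real assume ab: "0 \<le> a" "a \<le> b" "0 < b" "\<sigma> > 1/2 \<or> a > 0"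
      then have a: "a > 0" using eq by auto
      have 1: "integral_over {0<..a\<^sup>2} (\<lambda>t. t powr (\<sigma> - 3/2) * exp (- c * (a\<^sup>2 / t))) \<le> ennreal K"
        using K(2)[of "a\<^sup>2"] a by (simp add: square_powr e2)
      have 2: "integral_over {a\<^sup>2..b\<^sup>2} (\<lambda>t. t powr (\<sigma> - 3/2) * exp (- c * (a\<^sup>2 / t)))
          \<le> ennreal (1 * ln (b\<^sup>2 / a\<^sup>2))"
      proof (rule integral_over_upper[OF subset_refl])
        show "integral_over {a\<^sup>2..b\<^sup>2} (\<lambda>t. t powr (\<sigma> - 3/2)) \<le> ennreal (ln (b\<^sup>2 / a\<^sup>2))"
          unfolding e2 using a ab by (subst integral_inverse) (auto intro!: power_mono)
        show "t powr (\<sigma> - 3/2) * exp (- c * (a\<^sup>2 / t)) \<le> 1 * t powr (\<sigma> - 3/2)"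
          if "t \<in> {a\<^sup>2..b\<^sup>2}" for t
          unfolding mult_1 using that pos_of_square_le[OF a, of t] by (intro mult_left_le expo) auto
      qed auto
      have "integral_over {0<..b\<^sup>2} (\<lambda>t. t powr (\<sigma> - 3/2) * exp (- c * (a\<^sup>2 / t)))
         \<le> ennreal (K + 1 * ln (b\<^sup>2 / a\<^sup>2))"
        by (rule integral_over_union_upper[OF _ 1 2]) (use K a ab in \<open>auto intro!: power_mono\<close>)
      also have "\<dots> \<le> ennreal ((K + 2) * near_diag \<sigma> a b)"
      proof (rule ennreal_leI)
        have "ln (b\<^sup>2 / a\<^sup>2) = 2 * ln (b / a)"
          using a ab by (simp add: ln_realpow flip: power_divide)
        moreover have "ln (b / a) \<ge> 0" using a ab by simp
        ultimately show "K + 1 * ln (b\<^sup>2 / a\<^sup>2) \<le> (K + 2) * near_diag \<sigma> a b"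
          using K eq by (simp add: near_diag_def algebra_simps)
      qed
      finally show "integral_over {0<..b\<^sup>2} (\<lambda>t. t powr (\<sigma> - 3/2) * exp (- c * (a\<^sup>2 / t)))
        \<le> ennreal ((K + 2) * near_diag \<sigma> a b)" .
    qed (use K in auto)
  next
    case gt
    show ?thesis
    proof (rule that[of "1 / (\<sigma> - 1/2)"])
      fix a b :: real assume ab: "0 \<le> a" "a \<le> b" "0 < b" "\<sigma> > 1/2 \<or> a > 0"
      have "integral_over {0<..b\<^sup>2} (\<lambda>t. t powr (\<sigma> - 3/2) * exp (- c * (a\<^sup>2 / t)))
          \<le> ennreal (1 * ((b\<^sup>2) powr (\<sigma> - 3/2 + 1) / (\<sigma> - 3/2 + 1)))"
        by (rule integral_over_upper[OF subset_refl _ _ integral_power_near_0])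
           (use ab gt expo in \<open>auto intro!: mult_left_le\<close>)
      then show "integral_over {0<..b\<^sup>2} (\<lambda>t. t powr (\<sigma> - 3/2) * exp (- c * (a\<^sup>2 / t)))
        \<le> ennreal (1 / (\<sigma> - 1/2) * near_diag \<sigma> a b)"
        using gt ab by (simp add: near_diag_def square_powr e1 algebra_simps)
    qed (use gt in auto)
  qed
qed

text \<open>
  The interval that carries the mass is \<open>[a\<^sup>2, 2 a\<^sup>2]\<close>, \<open>[a\<^sup>2, 2 b\<^sup>2]\<close> or \<open>[b\<^sup>2, 2 b\<^sup>2]\<close>. Going up to
  \<open>2 b\<^sup>2\<close> keeps the bound away from zero when \<open>a = b\<close>.
\<close>

lemma integral_singular_lower:
  fixes c \<sigma> :: real
  assumes c: "c > 0"
  obtains C where "C > 0" and "\<And>a b. 0 \<le> a \<Longrightarrow> a \<le> b \<Longrightarrow> 0 < b \<Longrightarrow> \<sigma> > 1/2 \<or> a > 0 \<Longrightarrow>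
    ennreal (C * near_diag \<sigma> a b)
      \<le> integral_over {0<..2 * b\<^sup>2} (\<lambda>t. t powr (\<sigma> - 3/2) * exp (- c * (a\<^sup>2 / t)))"
proof -
  obtain k where k: "k > 0" "\<And>h. h > 0 \<Longrightarrow>
      ennreal (k * h powr (\<sigma> - 3/2 + 1)) \<le> integral_over {h..2*h} (\<lambda>t. t powr (\<sigma> - 3/2))"
    using integral_power_dyadic_lower by blast
  have e1: "\<sigma> - 3/2 + 1 = \<sigma> - 1/2" by simp
  have expo: "exp (- c) * t powr (\<sigma> - 3/2) \<le> t powr (\<sigma> - 3/2) * exp (- c * (a\<^sup>2 / t))"
    if "t \<ge> a\<^sup>2" "t > 0" for a t :: real
  proof -
    have "a\<^sup>2 / t \<le> 1" using that by simp
    then have "c * (a\<^sup>2 / t) \<le> c * 1" using c by (intro mult_left_mono) auto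
    then have "exp (- c) \<le> exp (- c * (a\<^sup>2 / t))" by simp
    then show ?thesis
      by (subst mult.commute) (intro mult_left_mono, auto)
  qed
  define L where "L a b = integral_over {0<..2 * b\<^sup>2} (\<lambda>t. t powr (\<sigma> - 3/2) * exp (- c * (a\<^sup>2 / t)))" for a b
  have interval: "ennreal (exp (- c) * r) \<le> L a b"
    if "0 < l" "a\<^sup>2 \<le> l" "u \<le> 2 * b\<^sup>2" "ennreal r \<le> integral_over {l..u} (\<lambda>t. t powr (\<sigma> - 3/2))" for a b l u r
    unfolding L_def
  proof (rule integral_over_lower[OF _ _ _ that(4)])
    show "exp (- c) * t powr (\<sigma> - 3/2) \<le> t powr (\<sigma> - 3/2) * exp (- c * (a\<^sup>2 / t))" if "t \<in> {l..u}" for t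
      using that \<open>0 < l\<close> \<open>a\<^sup>2 \<le> l\<close> by (intro expo) auto
  qed (use that in auto)
  consider (lt) "\<sigma> < 1/2" | (eq) "\<sigma> = 1/2" | (gt) "\<sigma> > 1/2" by linarith
  then show ?thesis
  proof cases
    case lt
    show ?thesis
    proof (rule that[of "exp (-c) * k"], fold L_def)
      fix a b :: real assume ab: "0 \<le> a" "a \<le> b" "0 < b" "\<sigma> > 1/2 \<or> a > 0"
      then have a: "a > 0" using lt by auto
      have "2 * a\<^sup>2 \<le> 2 * b\<^sup>2" using ab power_mono[of a b 2] by simp
      from interval[OF _ order_refl this k(2)] a show "ennreal (exp (-c) * k * near_diag \<sigma> a b) \<le> L a b"
        using lt by (simp add: near_diag_def square_powr e1 algebra_simps)
    qed (use k in auto)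
  next
    case eq
    have e2: "\<sigma> - 3/2 = -1" using eq by simp
    show ?thesis
    proof (rule that[of "exp (-c) * ln 2"], fold L_def)
      fix a b :: real assume ab: "0 \<le> a" "a \<le> b" "0 < b" "\<sigma> > 1/2 \<or> a > 0"
      then have a: "a > 0" using eq by auto
      have le: "a\<^sup>2 \<le> 2 * b\<^sup>2" using power_mono[of a b 2] ab zero_le_power2[of b] by linarith
      have "ln (2 * b\<^sup>2 / a\<^sup>2) = ln 2 + 2 * ln (b / a)"
        using a ab by (simp add: ln_realpow ln_mult ln_div)
      moreover have "ln 2 * ln (b / a) \<le> 2 * ln (b / a)"
        using a ab ln_2_less_1 by (intro mult_right_mono) auto
      ultimately have "ln 2 * near_diag \<sigma> a b \<le> ln (2 * b\<^sup>2 / a\<^sup>2)"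
        using eq by (simp add: near_diag_def algebra_simps)
      then have "ennreal (ln 2 * near_diag \<sigma> a b) \<le> integral_over {a\<^sup>2..2 * b\<^sup>2} (\<lambda>t. t powr (\<sigma> - 3/2))"
        unfolding e2 using a by (subst integral_inverse[OF _ le]) (auto intro: ennreal_leI)
      from interval[OF _ order_refl order_refl this] a show "ennreal (exp (-c) * ln 2 * near_diag \<sigma> a b) \<le> L a b"
        by (simp add: mult.assoc)
    qed auto
  next
    case gt
    show ?thesis
    proof (rule that[of "exp (-c) * k"], fold L_def)
      fix a b :: real assume ab: "0 \<le> a" "a \<le> b" "0 < b" "\<sigma> > 1/2 \<or> a > 0"
      have "a\<^sup>2 \<le> b\<^sup>2" using ab by (intro power_mono) auto
      from interval[OF _ this order_refl k(2)] ab show "ennreal (exp (-c) * k * near_diag \<sigma> a b) \<le> L a b"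
        using gt by (simp add: near_diag_def square_powr e1 algebra_simps)
    qed (use k in auto)
  qed
qed

text \<open>
  With \<open>s = \<sigma> - \<alpha> - 1\<close> this is the source of the terms for \<open>\<sigma> > \<alpha> + 1\<close> and \<open>\<sigma> = \<alpha> + 1\<close>; the
  remaining power of \<open>b\<close> comes from the lower end of the interval.
\<close>

lemma integral_tail_upper:
  fixes s :: real
  obtains C where "C > 0" and "\<And>b. 0 < b \<Longrightarrow> b \<le> 1 \<Longrightarrow>
    integral_over {b\<^sup>2..2} (\<lambda>t. t powr (s - 1))
      \<le> ennreal (C * (of_bool (s > 0) + of_bool (s = 0) * ln (1 / b) + b powr (2 * s)))"
proof -
  consider (gt) "s > 0" | (eq) "s = 0" | (lt) "s < 0" by linarith
  then show ?thesis
  proof cases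
    case gt
    show ?thesis
    proof (rule that[of "2 powr s / s"])
      fix b :: real assume b: "0 < b" "b \<le> 1"
      have "integral_over {b\<^sup>2..2} (\<lambda>t. t powr (s - 1)) \<le> integral_over {0<..2} (\<lambda>t. t powr (s - 1))"
        by (rule integral_over_mono) (use b in \<open>auto simp: pos_of_square_le[of b]\<close>)
      also have "\<dots> \<le> ennreal (2 powr (s - 1 + 1) / (s - 1 + 1))"
        by (rule integral_power_near_0) (use gt in auto)
      also have "\<dots> \<le> ennreal (2 powr s / s * (of_bool (s > 0) + of_bool (s = 0) * ln (1 / b) + b powr (2 * s)))"
        using gt by (intro ennreal_leI) (auto simp: field_simps)
      finally show "integral_over {b\<^sup>2..2} (\<lambda>t. t powr (s - 1)) \<le> \<dots>" .
    qed (use gt in auto)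
  next
    case eq
    show ?thesis
    proof (rule that[of 2])
      fix b :: real assume b: "0 < b" "b \<le> 1"
      have le: "b\<^sup>2 \<le> 2" using b by (simp add: power_le_one order_trans[of _ 1])
      have "integral_over {b\<^sup>2..2} (\<lambda>t. t powr (s - 1)) = ennreal (ln (2 / b\<^sup>2))"
        using integral_inverse[of "b\<^sup>2" 2] b le by (simp add: eq)
      also have "ln (2 / b\<^sup>2) = ln 2 + 2 * ln (1 / b)"
        using b by (simp add: ln_div ln_realpow)
      also have "ennreal \<dots> \<le> ennreal (2 * (of_bool (s > 0) + of_bool (s = 0) * ln (1 / b) + b powr (2 * s)))"
        using eq b ln_2_less_1 by (intro ennreal_leI) auto
      finally show "integral_over {b\<^sup>2..2} (\<lambda>t. t powr (s - 1)) \<le> \<dots>" .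
    qed auto
  next
    case lt
    show ?thesis
    proof (rule that[of "1 / (- s)"])
      fix b :: real assume b: "0 < b" "b \<le> 1"
      have "integral_over {b\<^sup>2..2} (\<lambda>t. t powr (s - 1)) \<le> integral_over {b\<^sup>2..} (\<lambda>t. t powr (s - 1))"
        by (rule integral_over_mono) auto
      also have "\<dots> \<le> ennreal ((b\<^sup>2) powr (s - 1 + 1) / (- (s - 1) - 1))"
        by (rule integral_power_near_infinity) (use lt b in auto)
      also have "\<dots> = ennreal (1 / (- s) * (of_bool (s > 0) + of_bool (s = 0) * ln (1 / b) + b powr (2 * s)))"
        using lt b by (simp add: square_powr)
      finally show "integral_over {b\<^sup>2..2} (\<lambda>t. t powr (s - 1)) \<le> \<dots>" .
    qed (use lt in auto)
  qed
qed

lemma integral_tail_lower: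
  fixes s :: real
  obtains C where "C > 0" and "\<And>b. 0 < b \<Longrightarrow> b \<le> 1 \<Longrightarrow>
    ennreal (C * (of_bool (s > 0) + of_bool (s = 0) * ln (1 / b)))
      \<le> integral_over {b\<^sup>2..2} (\<lambda>t. t powr (s - 1))"
proof -
  obtain k where k: "k > 0" "\<And>h. h > 0 \<Longrightarrow>
      ennreal (k * h powr (s - 1 + 1)) \<le> integral_over {h..2*h} (\<lambda>t. t powr (s - 1))"
    using integral_power_dyadic_lower by blast
  consider (gt) "s > 0" | (eq) "s = 0" | (lt) "s < 0" by linarith
  then show ?thesis
  proof cases
    case gt
    show ?thesis
    proof (rule that[OF k(1)])
      fix b :: real assume b: "0 < b" "b \<le> 1"
      have "ennreal (k * (of_bool (s > 0) + of_bool (s = 0) * ln (1 / b)))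
          \<le> integral_over {1..2} (\<lambda>t. t powr (s - 1))"
        using k(2)[of 1] gt by simp
      also have "\<dots> \<le> integral_over {b\<^sup>2..2} (\<lambda>t. t powr (s - 1))"
        by (rule integral_over_mono) (use b in \<open>auto intro: order_trans[OF power_le_one]\<close>)
      finally show "ennreal (k * (of_bool (s > 0) + of_bool (s = 0) * ln (1 / b))) \<le> \<dots>" .
    qed
  next
    case eq
    show ?thesis
    proof (rule that[of 1])
      fix b :: real assume b: "0 < b" "b \<le> 1"
      have le: "b\<^sup>2 \<le> 2" using b by (simp add: power_le_one order_trans[of _ 1])
      have "integral_over {b\<^sup>2..2} (\<lambda>t. t powr (s - 1)) = ennreal (ln (2 / b\<^sup>2))"
        using integral_inverse[of "b\<^sup>2" 2] b le by (simp add: eq)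
      also have "ln (2 / b\<^sup>2) = ln 2 + 2 * ln (1 / b)"
        using b by (simp add: ln_div ln_realpow)
      finally have I: "integral_over {b\<^sup>2..2} (\<lambda>t. t powr (s - 1)) = ennreal (ln 2 + 2 * ln (1 / b))" .
      have "ln 2 > (0::real)" "ln (1 / b) \<ge> 0" using b by auto
      then show "ennreal (1 * (of_bool (s > 0) + of_bool (s = 0) * ln (1 / b)))
         \<le> integral_over {b\<^sup>2..2} (\<lambda>t. t powr (s - 1))"
        unfolding I using eq by (intro ennreal_leI) auto
    qed auto
  next
    case lt
    then show ?thesis by (intro that[of 1]) auto
  qed
qed

section \<open>The Gaussian factor away from the origin\<close>

text \<open>
  The difference of the two sides is \<open>(t b - a)\<^sup>2 / t\<close>.
\<close>

lemma two_mult_le_gaussian_exponent: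
  fixes a b t :: real
  assumes "t > 0"
  shows "2 * (a * b) \<le> t * b\<^sup>2 + a\<^sup>2 / t"
proof -
  have "0 \<le> (t * b - a)\<^sup>2 / t" using assms by simp
  also have "\<dots> = t * b\<^sup>2 + a\<^sup>2 / t - 2 * (a * b)"
    using assms by (simp add: power2_eq_square field_simps)
  finally show ?thesis by simp
qed

text \<open>
  The exponential cuts the power off below \<open>a\<^sup>2\<close> and above \<open>1 / b\<^sup>2\<close>. For \<open>\<sigma> < 1/2\<close> the first cut
  suffices and for \<open>\<sigma> > 1/2\<close> the second. For \<open>\<sigma> = 1/2\<close> both are needed, and the scales from \<open>a\<^sup>2\<close> to
  \<open>1 / b\<^sup>2\<close>, present only if \<open>a b \<le> 1\<close>, give the logarithm.
\<close>

lemma integral_two_sided_damped_upper: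
  fixes c \<sigma> :: real
  assumes c: "c > 0"
  obtains C where "C > 0" and "\<And>a b. 0 \<le> a \<Longrightarrow> 0 < b \<Longrightarrow> \<sigma> > 1/2 \<or> a > 0 \<Longrightarrow>
    integral_over {0<..2} (\<lambda>t. t powr (\<sigma> - 3/2) * exp (- c * (t * b\<^sup>2 + a\<^sup>2 / t)))
      \<le> ennreal (C * far_diag \<sigma> a b)"
proof -
  define s where "s = \<sigma> - 3/2"
  have s1: "s + 1 = \<sigma> - 1/2" by (simp add: s_def)
  define G where "G a b t = t powr s * exp (- c * (t * b\<^sup>2 + a\<^sup>2 / t))" for a b t
  have G_meas [measurable]: "G a b \<in> borel_measurable borel" for a b
    unfolding G_def by measurable
  obtain K where K: "K > 0" "\<And>h. h > 0 \<Longrightarrow> integral_over {0<..h}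
      (\<lambda>t. t powr s * exp (- c * (h / t))) \<le> ennreal (K * h powr (s + 1))"
    using integral_power_damped_near_0[OF c] by blast
  obtain L where L: "L > 0" "\<And>h. h > 0 \<Longrightarrow> integral_over {h..}
      (\<lambda>t. t powr s * exp (- c * (t / h))) \<le> ennreal (L * h powr (s + 1))"
    using integral_power_damped_near_infinity[OF c] by blast
  have G1: "G a b t \<le> t powr s * exp (- c * (a\<^sup>2 / t))" if "t > 0" for a b t
    unfolding G_def using that c by (intro mult_left_mono) (auto simp: distrib_left)
  have G2: "G a b t \<le> t powr s * exp (- c * (t * b\<^sup>2))" if "t > 0" for a b t
    unfolding G_def using that c by (intro mult_left_mono) (auto simp: distrib_left)
  have G3: "G a b t \<le> t powr s" if "t > 0" for a b t
    using G1[OF that, of a b] that c by (elim order_trans) (auto intro!: mult_left_le)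
  have sq: "a\<^sup>2 powr (s + 1) = a powr (2 * \<sigma> - 1)" if "a > 0" for a :: real
    using that unfolding s1 square_powr by (simp add: right_diff_distrib)
  have sq': "(1 / b\<^sup>2) powr (s + 1) = b powr (1 - 2 * \<sigma>)" if "b > 0" for b :: real
    using that unfolding powr_divide s1 square_powr by (simp add: right_diff_distrib powr_diff)
  have short: "integral_over {0<..a\<^sup>2} (G a b) \<le> ennreal (K * a powr (2 * \<sigma> - 1))" if "a > 0" for a b
  proof -
    have "integral_over {0<..a\<^sup>2} (G a b) \<le> integral_over {0<..a\<^sup>2} (\<lambda>t. t powr s * exp (- c * (a\<^sup>2 / t)))"
      by (rule integral_over_mono) (use G1 in auto)
    then show ?thesis using K(2)[of "a\<^sup>2"] that by (simp add: sq)
  qed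
  have long: "integral_over {1 / b\<^sup>2..} (G a b) \<le> ennreal (L * b powr (1 - 2 * \<sigma>))" if "b > 0" for a b
  proof -
    have "integral_over {1 / b\<^sup>2..} (G a b)
        \<le> integral_over {1 / b\<^sup>2..} (\<lambda>t. t powr s * exp (- c * (t / (1 / b\<^sup>2))))"
    proof (rule integral_over_mono)
      fix t assume "t \<in> {1 / b\<^sup>2..}"
      then have "t > 0" using that by (simp add: less_le_trans[of 0 "1 / b\<^sup>2"])
      then show "G a b t \<le> t powr s * exp (- c * (t / (1 / b\<^sup>2)))" using G2[of t a b] by simp
    qed auto
    also have "\<dots> \<le> ennreal (L * b powr (1 - 2 * \<sigma>))"
      using L(2)[of "1 / b\<^sup>2"] that unfolding sq'[OF that] by simp
    finally show ?thesis .
  qed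
  consider (lt) "\<sigma> < 1/2" | (eq) "\<sigma> = 1/2" | (gt) "\<sigma> > 1/2" by linarith
  then show ?thesis
  proof cases
    case lt
    show ?thesis
    proof (rule that[of "K + 1 / (1/2 - \<sigma>)"], fold s_def, fold G_def)
      fix a b :: real assume ab: "0 \<le> a" "0 < b" "\<sigma> > 1/2 \<or> a > 0"
      then have a: "a > 0" using lt by auto
      have "integral_over {a\<^sup>2..} (G a b) \<le> integral_over {a\<^sup>2..} (\<lambda>t. t powr s)"
        by (rule integral_over_mono) (use G3 a in \<open>auto simp: pos_of_square_le[OF a]\<close>)
      also have "\<dots> \<le> ennreal ((a\<^sup>2) powr (s + 1) / (- s - 1))"
        by (rule integral_power_near_infinity) (use a lt in \<open>auto simp: s_def\<close>)
      also have "\<dots> = ennreal (a powr (2 * \<sigma> - 1) / (1/2 - \<sigma>))"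
        unfolding sq[OF a] by (simp add: s_def)
      finally have 2: "integral_over {a\<^sup>2..} (G a b) \<le> \<dots>" .
      have "integral_over {0<..2} (G a b) \<le> ennreal (K * a powr (2 * \<sigma> - 1) + a powr (2 * \<sigma> - 1) / (1/2 - \<sigma>))"
        by (rule integral_over_union_upper[OF _ short[OF a] 2]) (use K lt in auto)
      also have "\<dots> = ennreal ((K + 1 / (1/2 - \<sigma>)) * far_diag \<sigma> a b)"
        using lt by (simp add: far_diag_def algebra_simps)
      finally show "integral_over {0<..2} (G a b) \<le> \<dots>" .
    qed (use K lt in \<open>auto intro!: add_pos_pos\<close>)
  next
    case eq
    have s: "s = -1" using eq by (simp add: s_def)
    show ?thesis
    proof (rule that[of "K + L + 2"], fold s_def, fold G_def)
      fix a b :: real assume ab: "0 \<le> a" "0 < b" "\<sigma> > 1/2 \<or> a > 0"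
      then have a: "a > 0" using eq by auto
      have 1: "integral_over {0<..a\<^sup>2} (G a b) \<le> ennreal K"
        using short[OF a, of b] eq a by simp
      have 2: "integral_over {1 / b\<^sup>2..} (G a b) \<le> ennreal L"
        using long[of b a] ab eq by simp
      have "integral_over {0<..2} (G a b) \<le> ennreal ((K + L) + 2 * max 0 (ln (1 / (a * b))))"
      proof (cases "a\<^sup>2 \<le> 1 / b\<^sup>2")
        case True
        have "(a * b)\<^sup>2 \<le> 1" using True ab by (simp add: field_simps)
        then have "a * b \<le> 1" using a ab by (simp add: power_le_one_iff)
        then have ln: "ln (1 / (a * b)) \<ge> 0" using a ab by simp
        have "integral_over {a\<^sup>2..1 / b\<^sup>2} (G a b) \<le> integral_over {a\<^sup>2..1 / b\<^sup>2} (\<lambda>t. t powr (-1))"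
        proof (rule integral_over_mono)
          fix t assume "t \<in> {a\<^sup>2..1 / b\<^sup>2}"
          then have "t > 0" using pos_of_square_le[OF a, of t] by simp
          then show "G a b t \<le> t powr (-1)" using G3[of t a b] unfolding s by blast
        qed auto
        also have "\<dots> = ennreal (ln (1 / b\<^sup>2 / a\<^sup>2))"
          using a True by (intro integral_inverse) auto
        also have "1 / b\<^sup>2 / a\<^sup>2 = (1 / (a * b))\<^sup>2" by (simp add: power_divide power_mult_distrib mult.commute)
        also have "ln \<dots> = 2 * ln (1 / (a * b))" using a ab by (subst ln_realpow) auto
        finally have 3: "integral_over {a\<^sup>2..1 / b\<^sup>2} (G a b) \<le> ennreal (2 * ln (1 / (a * b)))" .
        have 4: "integral_over {a\<^sup>2..} (G a b) \<le> ennreal (2 * ln (1 / (a * b)) + L)"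
          by (rule integral_over_union_upper[OF _ 3 2]) (use L ln in auto)
        have "integral_over {0<..2} (G a b) \<le> ennreal (K + (2 * ln (1 / (a * b)) + L))"
          by (rule integral_over_union_upper[OF _ 1 4]) (use K L ln in auto)
        then show ?thesis using ln by (simp add: algebra_simps max_def)
      next
        case False
        have "integral_over {0<..2} (G a b) \<le> ennreal (K + L)"
          by (rule integral_over_union_upper[OF _ 1 2]) (use K L False in auto)
        also have "\<dots> \<le> ennreal ((K + L) + 2 * max 0 (ln (1 / (a * b))))"
          by (intro ennreal_leI) auto
        finally show ?thesis .
      qed
      also have "\<dots> \<le> ennreal ((K + L + 2) * far_diag \<sigma> a b)"
      proof (rule ennreal_leI)
        define M where "M = max 0 (ln (1 / (a * b)))"
        have "0 \<le> (K + L) * M" using K L unfolding M_def by (intro mult_nonneg_nonneg) auto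
        moreover have "far_diag \<sigma> a b = 1 + M" using eq by (simp add: far_diag_def M_def)
        ultimately show "(K + L) + 2 * max 0 (ln (1 / (a * b))) \<le> (K + L + 2) * far_diag \<sigma> a b"
          unfolding M_def [symmetric] by (simp add: algebra_simps)
      qed
      finally show "integral_over {0<..2} (G a b) \<le> ennreal ((K + L + 2) * far_diag \<sigma> a b)" .
    qed (use K L in auto)
  next
    case gt
    show ?thesis
    proof (rule that[of "1 / (\<sigma> - 1/2) + L"], fold s_def, fold G_def)
      fix a b :: real assume ab: "0 \<le> a" "0 < b" "\<sigma> > 1/2 \<or> a > 0"
      have "integral_over {0<..1 / b\<^sup>2} (G a b) \<le> integral_over {0<..1 / b\<^sup>2} (\<lambda>t. t powr s)"
        by (rule integral_over_mono) (use G3 in auto)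
      also have "\<dots> \<le> ennreal ((1 / b\<^sup>2) powr (s + 1) / (s + 1))"
        by (rule integral_power_near_0) (use ab gt in \<open>auto simp: s_def\<close>)
      also have "\<dots> = ennreal (b powr (1 - 2 * \<sigma>) / (\<sigma> - 1/2))"
        unfolding sq'[OF ab(2), unfolded s1] s1 ..
      finally have 1: "integral_over {0<..1 / b\<^sup>2} (G a b) \<le> \<dots>" .
      have "integral_over {0<..2} (G a b) \<le> ennreal (b powr (1 - 2 * \<sigma>) / (\<sigma> - 1/2) + L * b powr (1 - 2 * \<sigma>))"
        by (rule integral_over_union_upper[OF _ 1 long[OF ab(2)]]) (use L gt in auto)
      also have "\<dots> = ennreal ((1 / (\<sigma> - 1/2) + L) * far_diag \<sigma> a b)"
        using gt by (simp add: far_diag_def algebra_simps)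
      finally show "integral_over {0<..2} (G a b) \<le> \<dots>" .
    qed (use L gt in \<open>auto intro!: add_pos_pos\<close>)
  qed
qed

text \<open>
  One half of the exponent is spent on \<open>exp (- c a b)\<close>, the other half on convergence.
\<close>

lemma integral_gaussian_upper:
  fixes c \<sigma> :: real
  assumes c: "c > 0"
  obtains C where "C > 0" and "\<And>a b. 0 \<le> a \<Longrightarrow> 0 < b \<Longrightarrow> \<sigma> > 1/2 \<or> a > 0 \<Longrightarrow>
    integral_over {0<..2} (\<lambda>t. t powr (\<sigma> - 3/2) * exp (- c * (t * b\<^sup>2 + a\<^sup>2 / t)))
      \<le> ennreal (C * far_diag \<sigma> a b * exp (- c * (a * b)))"
proof -
  have "c / 2 > 0" using c by simp
  then obtain C where C: "C > 0" "\<And>a b. 0 \<le> a \<Longrightarrow> 0 < b \<Longrightarrow> \<sigma> > 1/2 \<or> a > 0 \<Longrightarrow>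
    integral_over {0<..2} (\<lambda>t. t powr (\<sigma> - 3/2) * exp (- (c / 2) * (t * b\<^sup>2 + a\<^sup>2 / t)))
      \<le> ennreal (C * far_diag \<sigma> a b)"
    using integral_two_sided_damped_upper by blast
  show ?thesis
  proof (rule that[OF C(1)])
    fix a b :: real assume ab: "0 \<le> a" "0 < b" "\<sigma> > 1/2 \<or> a > 0"
    have "integral_over {0<..2} (\<lambda>t. t powr (\<sigma> - 3/2) * exp (- c * (t * b\<^sup>2 + a\<^sup>2 / t)))
       \<le> ennreal (exp (- c * (a * b)) * (C * far_diag \<sigma> a b))"
    proof (rule integral_over_upper[OF subset_refl _ _ C(2)[OF ab]])
      fix t :: real assume "t \<in> {0<..2}"
      define E where "E = t * b\<^sup>2 + a\<^sup>2 / t"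
      have "c / 2 * (2 * (a * b)) \<le> c / 2 * E"
        using c \<open>t \<in> {0<..2}\<close> unfolding E_def
        by (intro mult_left_mono two_mult_le_gaussian_exponent) auto
      then have "- c * E \<le> - c * (a * b) + - (c / 2) * E"
        by (simp add: field_simps)
      then have "exp (- c * (t * b\<^sup>2 + a\<^sup>2 / t)) \<le> exp (- c * (a * b) + - (c / 2) * (t * b\<^sup>2 + a\<^sup>2 / t))"
        unfolding E_def by simp
      then show "t powr (\<sigma> - 3/2) * exp (- c * (t * b\<^sup>2 + a\<^sup>2 / t))
         \<le> exp (- c * (a * b)) * (t powr (\<sigma> - 3/2) * exp (- (c / 2) * (t * b\<^sup>2 + a\<^sup>2 / t)))"
        unfolding exp_add by (subst mult.left_commute) (intro mult_left_mono, auto)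
    qed auto
    then show "integral_over {0<..2} (\<lambda>t. t powr (\<sigma> - 3/2) * exp (- c * (t * b\<^sup>2 + a\<^sup>2 / t)))
       \<le> ennreal (C * far_diag \<sigma> a b * exp (- c * (a * b)))" by (simp only: mult.commute)
  qed
qed

text \<open>
  If \<open>a b \<ge> 1\<close>, the exponent is smallest near \<open>t = a / b\<close>, where it is of order \<open>a b\<close>; the power
  integral there exceeds \<open>far_diag\<close> by a factor \<open>(a b) powr \<bar>\<sigma> - 1/2\<bar>\<close>. If \<open>a b \<le> 1\<close>, the exponent is
  bounded between the scales \<open>a\<^sup>2\<close> and \<open>1 / b\<^sup>2\<close>, and one integrates near \<open>a\<^sup>2\<close> if \<open>\<sigma> < 1/2\<close>, near \<open>1 / b\<^sup>2\<close>
  if \<open>\<sigma> > 1/2\<close>, and over all scales in between if \<open>\<sigma> = 1/2\<close>.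
\<close>

lemma integral_gaussian_lower:
  fixes c \<sigma> :: real
  assumes c: "c > 0"
  obtains C where "C > 0" and "\<And>a b. 0 \<le> a \<Longrightarrow> a \<le> b \<Longrightarrow> 1 \<le> b \<Longrightarrow> \<sigma> > 1/2 \<or> a > 0 \<Longrightarrow>
    ennreal (C * far_diag \<sigma> a b * exp (- (3 * c) * (a * b)))
      \<le> integral_over {0<..2} (\<lambda>t. t powr (\<sigma> - 3/2) * exp (- c * (t * b\<^sup>2 + a\<^sup>2 / t)))"
proof -
  define s where "s = \<sigma> - 3/2"
  have s1: "s + 1 = \<sigma> - 1/2" by (simp add: s_def)
  obtain k where k: "k > 0" "\<And>h. h > 0 \<Longrightarrow>
      ennreal (k * h powr (s + 1)) \<le> integral_over {h..2*h} (\<lambda>t. t powr s)"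
    using integral_power_dyadic_lower by blast
  define k' where "k' = min k (ln 2)"
  have k': "k' > 0" "k' \<le> k" "k' \<le> ln 2" using k by (auto simp: k'_def)
  show ?thesis
  proof (rule that[of "exp (- (3 * c)) * k'"], fold s_def)
    fix a b :: real assume ab: "0 \<le> a" "a \<le> b" "1 \<le> b" "\<sigma> > 1/2 \<or> a > 0"
    have b: "b > 0" using ab by simp
    have inv_b: "1 / b\<^sup>2 \<le> 1" using ab by (simp add: one_le_power)
    have dyadic: "ennreal (k' * far_diag \<sigma> a b) \<le> integral_over {h..2*h} (\<lambda>t. t powr s)"
      if "h > 0" "far_diag \<sigma> a b \<le> h powr (s + 1)" for h
    proof -
      have "k' * far_diag \<sigma> a b \<le> k * h powr (s + 1)"
        using that k' k(1) by (intro mult_mono far_diag_nonneg) auto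
      then show ?thesis using k(2)[OF that(1)] by (meson ennreal_leI order_trans)
    qed
    obtain U where U: "U \<subseteq> {0<..2}" "U \<in> sets borel"
      "\<And>t. t \<in> U \<Longrightarrow> t * b\<^sup>2 + a\<^sup>2 / t \<le> 3 + 3 * (a * b)"
      "ennreal (k' * far_diag \<sigma> a b) \<le> integral_over U (\<lambda>t. t powr s)"
    proof (cases "a * b \<le> 1")
      case False
      then have a: "a > 0" using ab by (cases "a = 0") auto
      have h: "a / b > 0" using a b by simp
      show ?thesis
      proof (rule that[OF _ _ _ dyadic[OF h]])
        show "{a / b..2 * (a / b)} \<subseteq> {0<..2}"
        proof
          fix t assume "t \<in> {a / b..2 * (a / b)}"
          moreover have "a / b \<le> 1" using ab by simp
          ultimately show "t \<in> {0<..2}" using h by auto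
        qed
        fix t assume t: "t \<in> {a / b..2 * (a / b)}"
        then have "t > 0" using h by auto
        have "t * b\<^sup>2 \<le> 2 * (a / b) * b\<^sup>2" using t by (intro mult_right_mono) auto
        moreover have "2 * (a / b) * b\<^sup>2 = 2 * (a * b)" using b by (simp add: power2_eq_square)
        moreover have "a\<^sup>2 / t \<le> a\<^sup>2 / (a / b)"
          using t h \<open>t > 0\<close> a b by (intro divide_left_mono) auto
        moreover have "a\<^sup>2 / (a / b) = a * b" using a by (simp add: power2_eq_square)
        ultimately show "t * b\<^sup>2 + a\<^sup>2 / t \<le> 3 + 3 * (a * b)" by linarith
      next
        have ab1: "a * b \<ge> 1" using False by simp
        show "far_diag \<sigma> a b \<le> (a / b) powr (s + 1)"
        proof -
          consider (lt) "\<sigma> < 1/2" | (eq) "\<sigma> = 1/2" | (gt) "\<sigma> > 1/2" by linarith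
          then show ?thesis
          proof cases
            case lt
            have "a powr (2 * \<sigma> - 1) * 1 \<le> a powr (2 * \<sigma> - 1) * (a * b) powr (1/2 - \<sigma>)"
              using ab1 lt by (intro mult_left_mono ge_one_powr_ge_zero) auto
            also have "\<dots> = (a powr (2 * \<sigma> - 1) * a powr (1/2 - \<sigma>)) * b powr (1/2 - \<sigma>)"
              by (simp only: powr_mult mult.assoc)
            also have "\<dots> = a powr (\<sigma> - 1/2) * b powr (- (\<sigma> - 1/2))"
              by (simp only: powr_add [symmetric]) (simp add: algebra_simps)
            also have "\<dots> = (a / b) powr (s + 1)"
              unfolding s1 powr_divide powr_minus_divide by simp
            finally show ?thesis using lt by (simp add: far_diag_def)
          next
            case eq
            have "ln (1 / (a * b)) \<le> 0" using ab1 by (simp add: ln_div)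
            moreover have "(a / b) powr (s + 1) = 1" unfolding s1 eq using a b by simp
            ultimately show ?thesis using eq by (simp add: far_diag_def)
          next
            case gt
            have "b powr (1 - 2 * \<sigma>) * 1 \<le> b powr (1 - 2 * \<sigma>) * (a * b) powr (\<sigma> - 1/2)"
              using ab1 gt by (intro mult_left_mono ge_one_powr_ge_zero) auto
            also have "\<dots> = a powr (\<sigma> - 1/2) * (b powr (1 - 2 * \<sigma>) * b powr (\<sigma> - 1/2))"
              by (simp only: powr_mult mult_ac)
            also have "\<dots> = a powr (\<sigma> - 1/2) * b powr (- (\<sigma> - 1/2))"
              by (simp only: powr_add [symmetric]) (simp add: algebra_simps)
            also have "\<dots> = (a / b) powr (s + 1)"
              unfolding s1 powr_divide powr_minus_divide by simp
            finally show ?thesis using gt by (simp add: far_diag_def)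
          qed
        qed
      qed auto
    next
      case True
      have expo: "t * b\<^sup>2 + a\<^sup>2 / t \<le> 3 + 3 * (a * b)" if "t > 0" "a\<^sup>2 \<le> t" "t \<le> 2 * (1 / b\<^sup>2)" for t
      proof -
        have "t * b\<^sup>2 \<le> 2" using that b by (simp add: field_simps)
        moreover have "a\<^sup>2 / t \<le> 1" using that by simp
        moreover have "a * b \<ge> 0" using ab by simp
        ultimately show ?thesis by linarith
      qed
      have "(a * b)\<^sup>2 \<le> 1" using True ab by (simp add: power_le_one)
      then have a_le: "a\<^sup>2 \<le> 1 / b\<^sup>2" using b by (simp add: field_simps)
      note U_intro = that
      have interval: ?thesis if "0 < l" "a\<^sup>2 \<le> l" "r \<le> 2 * (1 / b\<^sup>2)"
        "ennreal (k' * far_diag \<sigma> a b) \<le> integral_over {l..r} (\<lambda>t. t powr s)" for l r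
      proof (rule U_intro[OF _ _ _ that(4)])
        show "{l..r} \<subseteq> {0<..2}"
          using that(1,3) inv_b by (intro subsetI) (simp only: greaterThanAtMost_iff atLeastAtMost_iff, linarith)
        show "t * b\<^sup>2 + a\<^sup>2 / t \<le> 3 + 3 * (a * b)" if "t \<in> {l..r}" for t
          using that \<open>0 < l\<close> \<open>a\<^sup>2 \<le> l\<close> \<open>r \<le> 2 * (1 / b\<^sup>2)\<close> unfolding atLeastAtMost_iff
          by (intro expo) linarith+
      qed auto
      consider (lt) "\<sigma> < 1/2" | (eq) "\<sigma> = 1/2" | (gt) "\<sigma> > 1/2" by linarith
      then show ?thesis
      proof cases
        case lt
        then have a: "a > 0" using ab by auto
        then have h: "a\<^sup>2 > 0" by simp
        have "far_diag \<sigma> a b \<le> a\<^sup>2 powr (s + 1)"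
          using lt a unfolding s1 square_powr by (simp add: far_diag_def right_diff_distrib)
        from interval[OF h order_refl _ dyadic[OF h this]] a_le show ?thesis by linarith
      next
        case eq
        then have a: "a > 0" using ab by auto
        then have h: "a\<^sup>2 > 0" by simp
        have s: "s = -1" using eq by (simp add: s_def)
        have ln: "ln (1 / (a * b)) \<ge> 0" using True a b by simp
        have "k' * far_diag \<sigma> a b \<le> ln 2 * (1 + ln (1 / (a * b)))"
          using ln eq k' by (simp add: far_diag_def)
        also have "\<dots> \<le> ln 2 + 2 * ln (1 / (a * b))"
          using ln ln_2_less_1 mult_right_mono[of "ln 2" 2 "ln (1 / (a * b))"] by (simp add: distrib_left)
        also have "\<dots> = ln (2 * (1 / (a * b))\<^sup>2)"
          using a b by (simp add: ln_mult ln_realpow)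
        also have "2 * (1 / (a * b))\<^sup>2 = 2 * (1 / b\<^sup>2) / a\<^sup>2"
          by (simp add: power_divide power_mult_distrib mult.commute)
        finally have "ennreal (k' * far_diag \<sigma> a b) \<le> ennreal (ln (2 * (1 / b\<^sup>2) / a\<^sup>2))"
          by (rule ennreal_leI)
        also have "\<dots> = integral_over {a\<^sup>2..2 * (1 / b\<^sup>2)} (\<lambda>t. t powr s)"
          unfolding s using a_le h by (intro integral_inverse [symmetric]) linarith+
        finally show ?thesis by (rule interval[OF h order_refl order_refl])
      next
        case gt
        have h: "1 / b\<^sup>2 > 0" using b by simp
        have "far_diag \<sigma> a b \<le> (1 / b\<^sup>2) powr (s + 1)"
          using gt b unfolding powr_divide s1 square_powr
          by (simp add: far_diag_def right_diff_distrib powr_diff)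
        from interval[OF h a_le order_refl dyadic[OF h this]] show ?thesis .
      qed
    qed
    have "ennreal (exp (- (3 * c)) * exp (- (3 * c) * (a * b)) * (k' * far_diag \<sigma> a b))
        \<le> integral_over {0<..2} (\<lambda>t. t powr s * exp (- c * (t * b\<^sup>2 + a\<^sup>2 / t)))"
    proof (rule integral_over_lower[OF U(1) _ _ U(4)])
      fix t assume t: "t \<in> U"
      have "c * (t * b\<^sup>2 + a\<^sup>2 / t) \<le> c * (3 + 3 * (a * b))"
        using c U(3)[OF t] by (intro mult_left_mono) auto
      then have "exp (- (3 * c) + - (3 * c) * (a * b)) \<le> exp (- c * (t * b\<^sup>2 + a\<^sup>2 / t))"
        by (simp add: algebra_simps)
      then show "exp (- (3 * c)) * exp (- (3 * c) * (a * b)) * t powr s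
          \<le> t powr s * exp (- c * (t * b\<^sup>2 + a\<^sup>2 / t))"
        unfolding exp_add by (subst mult.commute) (intro mult_left_mono, auto)
    qed (use U(2) in auto)
    then show "ennreal (exp (- (3 * c)) * k' * far_diag \<sigma> a b * exp (- (3 * c) * (a * b)))
        \<le> integral_over {0<..2} (\<lambda>t. t powr s * exp (- c * (t * b\<^sup>2 + a\<^sup>2 / t)))"
      by (simp only: mult_ac)
  qed (use k' in auto)
qed

section \<open>Size of the profile integral\<close>

text \<open>
  For \<open>t \<le> 2\<close>, \<open>a = \<bar>\<bar>x\<bar> - \<bar>y\<bar>\<bar>\<close> and \<open>b = \<bar>x\<bar> + \<bar>y\<bar>\<close>, the integrand of the potential kernel lies between
  multiples of two such profiles, with both parameters raised by one if \<open>x y < 0\<close>.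
\<close>

definition heat_profile :: "real \<Rightarrow> real \<Rightarrow> real \<Rightarrow> real \<Rightarrow> real \<Rightarrow> real \<Rightarrow> real" where
  "heat_profile \<alpha> \<sigma> c a b t =
    t powr (\<sigma> - 3/2) * (t + b\<^sup>2) powr (-\<alpha> - 1/2) * exp (- c * (t * b\<^sup>2 + a\<^sup>2 / t))"

lemma heat_profile_measurable [measurable]: "heat_profile \<alpha> \<sigma> c a b \<in> borel_measurable borel"
  unfolding heat_profile_def by measurable

abbreviation profile_integral :: "real \<Rightarrow> real \<Rightarrow> real \<Rightarrow> real \<Rightarrow> real \<Rightarrow> ennreal" where
  "profile_integral \<alpha> \<sigma> c a b \<equiv> integral_over {0<..2} (heat_profile \<alpha> \<sigma> c a b)"

definition near_size :: "real \<Rightarrow> real \<Rightarrow> real \<Rightarrow> real \<Rightarrow> real" where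
  "near_size \<alpha> \<sigma> a b = of_bool (\<sigma> > \<alpha> + 1) + of_bool (\<sigma> = \<alpha> + 1) * ln (1 / b)
     + b powr (-2 * \<alpha> - 1) * near_diag \<sigma> a b"

definition far_size :: "real \<Rightarrow> real \<Rightarrow> real \<Rightarrow> real \<Rightarrow> real" where
  "far_size \<alpha> \<sigma> a b = b powr (-2 * \<alpha> - 1) * far_diag \<sigma> a b"

text \<open>
  The power of \<open>b\<close> that comes from the range \<open>t > b\<^sup>2\<close> is absorbed by the contribution of \<open>t < b\<^sup>2\<close>.
\<close>

lemma powr_le_near_size:
  assumes "0 \<le> a" "a \<le> b" "0 < b" "b \<le> 1" "\<sigma> > 1/2 \<or> a > 0"
  shows "b powr (2 * (\<sigma> - \<alpha> - 1)) \<le> b powr (-2 * \<alpha> - 1) * near_diag \<sigma> a b"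
proof -
  have "b powr (2 * (\<sigma> - \<alpha> - 1)) = b powr (-2 * \<alpha> - 1) * b powr (2 * \<sigma> - 1)"
    by (simp only: powr_add [symmetric]) (simp add: algebra_simps)
  then show ?thesis
    using near_diag_ge[of a b \<sigma>] assms by (simp add: mult_left_mono)
qed

text \<open>
  For \<open>t < b\<^sup>2\<close> the factor \<open>t + b\<^sup>2\<close> is replaced by \<open>b\<^sup>2\<close>, for \<open>t > b\<^sup>2\<close> by \<open>t\<close>.
\<close>

lemma near_size_upper:
  fixes \<alpha> \<sigma> c :: real
  assumes \<alpha>: "\<alpha> > -1/2" and c: "c > 0"
  obtains C where "C > 0" and "\<And>a b. 0 \<le> a \<Longrightarrow> a \<le> b \<Longrightarrow> 0 < b \<Longrightarrow> b \<le> 1 \<Longrightarrow> \<sigma> > 1/2 \<or> a > 0 \<Longrightarrow>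
    profile_integral \<alpha> \<sigma> c a b \<le> ennreal (C * near_size \<alpha> \<sigma> a b)"
proof -
  obtain C1 where C1: "C1 > 0" "\<And>a b. 0 \<le> a \<Longrightarrow> a \<le> b \<Longrightarrow> 0 < b \<Longrightarrow> \<sigma> > 1/2 \<or> a > 0 \<Longrightarrow>
    integral_over {0<..b\<^sup>2} (\<lambda>t. t powr (\<sigma> - 3/2) * exp (- c * (a\<^sup>2 / t)))
      \<le> ennreal (C1 * near_diag \<sigma> a b)"
    using integral_singular_upper[OF c] by blast
  obtain C2 where C2: "C2 > 0" "\<And>b. 0 < b \<Longrightarrow> b \<le> 1 \<Longrightarrow>
    integral_over {b\<^sup>2..2} (\<lambda>t. t powr (\<sigma> - \<alpha> - 1 - 1))
      \<le> ennreal (C2 * (of_bool (\<sigma> - \<alpha> - 1 > 0) + of_bool (\<sigma> - \<alpha> - 1 = 0) * ln (1 / b)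
          + b powr (2 * (\<sigma> - \<alpha> - 1))))"
    using integral_tail_upper by blast
  show ?thesis
  proof (rule that[of "C1 + C2"])
    fix a b :: real assume ab: "0 \<le> a" "a \<le> b" "0 < b" "b \<le> 1" "\<sigma> > 1/2 \<or> a > 0"
    define X where "X = of_bool (\<sigma> > \<alpha> + 1) + of_bool (\<sigma> = \<alpha> + 1) * ln (1 / b)"
    define Y where "Y = b powr (-2 * \<alpha> - 1) * near_diag \<sigma> a b"
    have X: "X \<ge> 0" unfolding X_def using ab by auto
    have Y: "b powr (2 * (\<sigma> - \<alpha> - 1)) \<le> Y" "Y \<ge> 0"
      unfolding Y_def using powr_le_near_size[of a b \<sigma>] near_diag_nonneg[of a b \<sigma>] ab by auto
    have sq: "(b\<^sup>2) powr (-\<alpha> - 1/2) = b powr (-2 * \<alpha> - 1)"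
      using ab unfolding square_powr by (simp add: right_diff_distrib)
    have 1: "integral_over {0<..b\<^sup>2} (heat_profile \<alpha> \<sigma> c a b)
        \<le> ennreal (b powr (-2 * \<alpha> - 1) * (C1 * near_diag \<sigma> a b))"
    proof (rule integral_over_upper[OF subset_refl _ _ C1(2)])
      fix t assume t: "t \<in> {0<..b\<^sup>2}"
      have "(t + b\<^sup>2) powr (-\<alpha> - 1/2) \<le> (b\<^sup>2) powr (-\<alpha> - 1/2)"
        using t \<alpha> ab by (intro powr_mono2') auto
      moreover have "exp (- c * (t * b\<^sup>2 + a\<^sup>2 / t)) \<le> exp (- c * (a\<^sup>2 / t))"
        using t c by (simp add: distrib_left)
      ultimately have "(t + b\<^sup>2) powr (-\<alpha> - 1/2) * exp (- c * (t * b\<^sup>2 + a\<^sup>2 / t))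
         \<le> b powr (-2 * \<alpha> - 1) * exp (- c * (a\<^sup>2 / t))"
        unfolding sq by (intro mult_mono) auto
      then show "heat_profile \<alpha> \<sigma> c a b t \<le>
          b powr (-2 * \<alpha> - 1) * (t powr (\<sigma> - 3/2) * exp (- c * (a\<^sup>2 / t)))"
        unfolding heat_profile_def
        by (subst mult.left_commute, subst mult.assoc) (intro mult_left_mono, auto)
    qed (use ab in auto)
    have 2: "integral_over {b\<^sup>2..2} (heat_profile \<alpha> \<sigma> c a b) \<le> ennreal (1 * (C2 * (of_bool (\<sigma> - \<alpha> - 1 > 0)
        + of_bool (\<sigma> - \<alpha> - 1 = 0) * ln (1 / b) + b powr (2 * (\<sigma> - \<alpha> - 1)))))"
    proof (rule integral_over_upper[OF subset_refl _ _ C2(2)])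
      fix t assume t: "t \<in> {b\<^sup>2..2}"
      then have t0: "t > 0" using pos_of_square_le[of b t] ab by auto
      have "(t + b\<^sup>2) powr (-\<alpha> - 1/2) \<le> t powr (-\<alpha> - 1/2)"
        using t0 \<alpha> by (intro powr_mono2') auto
      moreover have "exp (- c * (t * b\<^sup>2 + a\<^sup>2 / t)) \<le> 1"
        using t0 c by simp
      ultimately have "t powr (\<sigma> - 3/2) * ((t + b\<^sup>2) powr (-\<alpha> - 1/2) * exp (- c * (t * b\<^sup>2 + a\<^sup>2 / t)))
         \<le> t powr (\<sigma> - 3/2) * (t powr (-\<alpha> - 1/2) * 1)"
        by (intro mult_left_mono mult_mono) auto
      also have "\<dots> = t powr (\<sigma> - \<alpha> - 1 - 1)"
        unfolding mult_1_right by (simp only: powr_add [symmetric]) (simp add: algebra_simps)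
      finally show "heat_profile \<alpha> \<sigma> c a b t \<le> 1 * t powr (\<sigma> - \<alpha> - 1 - 1)"
        unfolding heat_profile_def mult_1 mult.assoc .
    qed (use ab in auto)
    have "1 * (C2 * (of_bool (\<sigma> - \<alpha> - 1 > 0) + of_bool (\<sigma> - \<alpha> - 1 = 0) * ln (1 / b)
        + b powr (2 * (\<sigma> - \<alpha> - 1)))) \<le> C2 * (X + Y)"
      using C2(1) Y unfolding X_def by (auto intro!: mult_left_mono simp: algebra_simps)
    then have 2: "integral_over {b\<^sup>2..2} (heat_profile \<alpha> \<sigma> c a b) \<le> ennreal (C2 * (X + Y))"
      using 2 by (meson ennreal_leI order_trans)
    have 1: "integral_over {0<..b\<^sup>2} (heat_profile \<alpha> \<sigma> c a b) \<le> ennreal (C1 * Y)"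
      using 1 unfolding Y_def by (simp only: mult_ac)
    have "profile_integral \<alpha> \<sigma> c a b \<le> ennreal (C1 * Y + C2 * (X + Y))"
      by (rule integral_over_union_upper[OF _ 1 2]) (use C1 C2 X Y in auto)
    also have "\<dots> \<le> ennreal ((C1 + C2) * (X + Y))"
      using C1 X by (intro ennreal_leI) (simp add: algebra_simps)
    finally show "profile_integral \<alpha> \<sigma> c a b \<le> ennreal ((C1 + C2) * near_size \<alpha> \<sigma> a b)"
      unfolding near_size_def X_def Y_def .
  qed (use C1 C2 in auto)
qed

text \<open>
  Here \<open>exp (- c t b\<^sup>2)\<close> is bounded below since \<open>t \<le> 2\<close> and \<open>b \<le> 1\<close>. The ranges \<open>t \<le> 2 b\<^sup>2\<close> and \<open>t \<ge> b\<^sup>2\<close>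
  overlap, so only the larger of their contributions is used, at the price of a factor \<open>2\<close>.
\<close>

lemma near_size_lower:
  fixes \<alpha> \<sigma> c :: real
  assumes \<alpha>: "\<alpha> > -1/2" and c: "c > 0"
  obtains C where "C > 0" and "\<And>a b. 0 \<le> a \<Longrightarrow> a \<le> b \<Longrightarrow> 0 < b \<Longrightarrow> b \<le> 1 \<Longrightarrow> \<sigma> > 1/2 \<or> a > 0 \<Longrightarrow>
    ennreal (C * near_size \<alpha> \<sigma> a b) \<le> profile_integral \<alpha> \<sigma> c a b"
proof -
  obtain C1 where C1: "C1 > 0" "\<And>a b. 0 \<le> a \<Longrightarrow> a \<le> b \<Longrightarrow> 0 < b \<Longrightarrow> \<sigma> > 1/2 \<or> a > 0 \<Longrightarrow>
    ennreal (C1 * near_diag \<sigma> a b)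
      \<le> integral_over {0<..2 * b\<^sup>2} (\<lambda>t. t powr (\<sigma> - 3/2) * exp (- c * (a\<^sup>2 / t)))"
    using integral_singular_lower[OF c] by blast
  obtain C2 where C2: "C2 > 0" "\<And>b. 0 < b \<Longrightarrow> b \<le> 1 \<Longrightarrow>
    ennreal (C2 * (of_bool (\<sigma> - \<alpha> - 1 > 0) + of_bool (\<sigma> - \<alpha> - 1 = 0) * ln (1 / b)))
      \<le> integral_over {b\<^sup>2..2} (\<lambda>t. t powr (\<sigma> - \<alpha> - 1 - 1))"
    using integral_tail_lower by blast
  define D1 where "D1 = 3 powr (-\<alpha> - 1/2) * exp (- 2 * c) * C1"
  define D2 where "D2 = 2 powr (-\<alpha> - 1/2) * exp (- 3 * c) * C2"
  define D where "D = min D1 D2 / 2"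
  have D12: "D1 > 0" "D2 > 0" using C1 C2 by (auto simp: D1_def D2_def)
  then have D: "D > 0" "2 * D \<le> D1" "2 * D \<le> D2" by (auto simp: D_def)
  show ?thesis
  proof (rule that[OF D(1)])
    fix a b :: real assume ab: "0 \<le> a" "a \<le> b" "0 < b" "b \<le> 1" "\<sigma> > 1/2 \<or> a > 0"
    define X where "X = of_bool (\<sigma> > \<alpha> + 1) + of_bool (\<sigma> = \<alpha> + 1) * ln (1 / b)"
    define Y where "Y = b powr (-2 * \<alpha> - 1) * near_diag \<sigma> a b"
    have X: "X \<ge> 0" unfolding X_def using ab by auto
    have Y: "Y \<ge> 0"
      unfolding Y_def using near_diag_nonneg[of a b \<sigma>] ab by auto
    have b1: "b\<^sup>2 \<le> 1" using ab by (simp add: power_le_one)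
    have ab2: "a\<^sup>2 \<le> b\<^sup>2" using ab by (intro power_mono) auto
    have sq: "(3 * b\<^sup>2) powr (-\<alpha> - 1/2) = 3 powr (-\<alpha> - 1/2) * b powr (-2 * \<alpha> - 1)"
      using ab unfolding powr_mult square_powr by (simp add: right_diff_distrib)
    have "ennreal ((3 * b\<^sup>2) powr (-\<alpha> - 1/2) * exp (- 2 * c) * (C1 * near_diag \<sigma> a b))
        \<le> profile_integral \<alpha> \<sigma> c a b"
    proof (rule integral_over_lower[OF _ _ _ C1(2)])
      show "{0<..2 * b\<^sup>2} \<subseteq> {0<..2}" using b1 by auto
      fix t assume t: "t \<in> {0<..2 * b\<^sup>2}"
      have "(3 * b\<^sup>2) powr (-\<alpha> - 1/2) \<le> (t + b\<^sup>2) powr (-\<alpha> - 1/2)"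
        using t \<alpha> ab by (intro powr_mono2') auto
      moreover have "exp (- 2 * c) * exp (- c * (a\<^sup>2 / t)) \<le> exp (- c * (t * b\<^sup>2 + a\<^sup>2 / t))"
      proof -
        have "t * b\<^sup>2 \<le> 2 * 1" using t b1 by (intro mult_mono) auto
        then have "c * (t * b\<^sup>2) \<le> c * 2" using c by (intro mult_left_mono) auto
        then show ?thesis unfolding exp_add [symmetric] by (simp add: algebra_simps)
      qed
      ultimately have "(3 * b\<^sup>2) powr (-\<alpha> - 1/2) * (exp (- 2 * c) * exp (- c * (a\<^sup>2 / t)))
         \<le> (t + b\<^sup>2) powr (-\<alpha> - 1/2) * exp (- c * (t * b\<^sup>2 + a\<^sup>2 / t))"
        by (intro mult_mono) auto
      from mult_left_mono[OF this, of "t powr (\<sigma> - 3/2)"]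
      show "(3 * b\<^sup>2) powr (-\<alpha> - 1/2) * exp (- 2 * c) * (t powr (\<sigma> - 3/2) * exp (- c * (a\<^sup>2 / t)))
          \<le> heat_profile \<alpha> \<sigma> c a b t"
        unfolding heat_profile_def by (simp only: mult_ac powr_ge_zero)
    qed (use ab in auto)
    also have "(3 * b\<^sup>2) powr (-\<alpha> - 1/2) * exp (- 2 * c) * (C1 * near_diag \<sigma> a b) = D1 * Y"
      unfolding sq D1_def Y_def by (simp only: mult_ac)
    finally have 1: "ennreal (D1 * Y) \<le> profile_integral \<alpha> \<sigma> c a b" .
    have "ennreal (2 powr (-\<alpha> - 1/2) * exp (- 3 * c) * (C2 * (of_bool (\<sigma> - \<alpha> - 1 > 0)
        + of_bool (\<sigma> - \<alpha> - 1 = 0) * ln (1 / b))))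
        \<le> profile_integral \<alpha> \<sigma> c a b"
    proof (rule integral_over_lower[OF _ _ _ C2(2)])
      show "{b\<^sup>2..2} \<subseteq> {0<..2}" using pos_of_square_le[of b] ab by auto
      fix t assume t: "t \<in> {b\<^sup>2..2}"
      then have t0: "t > 0" using pos_of_square_le[of b t] ab by auto
      have "2 powr (-\<alpha> - 1/2) * t powr (-\<alpha> - 1/2) \<le> (t + b\<^sup>2) powr (-\<alpha> - 1/2)"
        unfolding powr_mult [symmetric] using t t0 \<alpha> ab by (intro powr_mono2') (auto intro: add_pos_nonneg)
      moreover have "exp (- 3 * c) \<le> exp (- c * (t * b\<^sup>2 + a\<^sup>2 / t))"
      proof -
        have "t * b\<^sup>2 \<le> 2 * 1" using t b1 by (intro mult_mono) auto
        moreover have "a\<^sup>2 / t \<le> 1" using t ab2 t0 by simp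
        ultimately have "c * (t * b\<^sup>2 + a\<^sup>2 / t) \<le> c * 3" using c by (intro mult_left_mono) auto
        then show ?thesis by (simp add: algebra_simps)
      qed
      ultimately have "2 powr (-\<alpha> - 1/2) * t powr (-\<alpha> - 1/2) * exp (- 3 * c)
         \<le> (t + b\<^sup>2) powr (-\<alpha> - 1/2) * exp (- c * (t * b\<^sup>2 + a\<^sup>2 / t))"
        by (intro mult_mono) auto
      from mult_left_mono[OF this, of "t powr (\<sigma> - 3/2)"]
      have "2 powr (-\<alpha> - 1/2) * exp (- 3 * c) * (t powr (\<sigma> - 3/2) * t powr (-\<alpha> - 1/2))
          \<le> heat_profile \<alpha> \<sigma> c a b t"
        unfolding heat_profile_def by (simp only: mult_ac powr_ge_zero)
      moreover have "t powr (\<sigma> - 3/2) * t powr (-\<alpha> - 1/2) = t powr (\<sigma> - \<alpha> - 1 - 1)"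
        by (simp only: powr_add [symmetric]) (simp add: algebra_simps)
      ultimately show "2 powr (-\<alpha> - 1/2) * exp (- 3 * c) * t powr (\<sigma> - \<alpha> - 1 - 1)
          \<le> heat_profile \<alpha> \<sigma> c a b t" by simp
    qed (use ab in auto)
    also have "2 powr (-\<alpha> - 1/2) * exp (- 3 * c) * (C2 * (of_bool (\<sigma> - \<alpha> - 1 > 0)
        + of_bool (\<sigma> - \<alpha> - 1 = 0) * ln (1 / b))) = D2 * X"
      unfolding D2_def X_def by (auto simp: algebra_simps)
    finally have 2: "ennreal (D2 * X) \<le> profile_integral \<alpha> \<sigma> c a b" .
    have "D * (X + Y) = (2 * D * Y + 2 * D * X) / 2"
      by (simp add: distrib_left)
    then have "D * (X + Y) \<le> D1 * Y \<or> D * (X + Y) \<le> D2 * X"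
      using mult_right_mono[OF D(2) Y] mult_right_mono[OF D(3) X] by (auto simp: field_simps)
    then have "ennreal (D * (X + Y)) \<le> profile_integral \<alpha> \<sigma> c a b"
      using order_trans[OF ennreal_leI 1] order_trans[OF ennreal_leI 2] by blast
    then show "ennreal (D * near_size \<alpha> \<sigma> a b) \<le> profile_integral \<alpha> \<sigma> c a b"
      unfolding near_size_def X_def Y_def .
  qed
qed

lemma far_size_upper:
  fixes \<alpha> \<sigma> c :: real
  assumes \<alpha>: "\<alpha> > -1/2" and c: "c > 0"
  obtains C where "C > 0" and "\<And>a b. 0 \<le> a \<Longrightarrow> 0 < b \<Longrightarrow> \<sigma> > 1/2 \<or> a > 0 \<Longrightarrow>
    profile_integral \<alpha> \<sigma> c a b \<le> ennreal (C * far_size \<alpha> \<sigma> a b * exp (- c * (a * b)))"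
proof -
  obtain C where C: "C > 0" "\<And>a b. 0 \<le> a \<Longrightarrow> 0 < b \<Longrightarrow> \<sigma> > 1/2 \<or> a > 0 \<Longrightarrow>
    integral_over {0<..2} (\<lambda>t. t powr (\<sigma> - 3/2) * exp (- c * (t * b\<^sup>2 + a\<^sup>2 / t)))
      \<le> ennreal (C * far_diag \<sigma> a b * exp (- c * (a * b)))"
    using integral_gaussian_upper[OF c] by blast
  show ?thesis
  proof (rule that[OF C(1)])
    fix a b :: real assume ab: "0 \<le> a" "0 < b" "\<sigma> > 1/2 \<or> a > 0"
    have "profile_integral \<alpha> \<sigma> c a b
        \<le> ennreal (b powr (-2 * \<alpha> - 1) * (C * far_diag \<sigma> a b * exp (- c * (a * b))))"
    proof (rule integral_over_upper[OF subset_refl _ _ C(2)[OF ab]])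
      fix t :: real assume t: "t \<in> {0<..2}"
      have "(t + b\<^sup>2) powr (-\<alpha> - 1/2) \<le> (b\<^sup>2) powr (-\<alpha> - 1/2)"
        using t \<alpha> ab by (intro powr_mono2') auto
      also have "\<dots> = b powr (-2 * \<alpha> - 1)"
        using ab unfolding square_powr by (simp add: right_diff_distrib)
      finally show "heat_profile \<alpha> \<sigma> c a b t
          \<le> b powr (-2 * \<alpha> - 1) * (t powr (\<sigma> - 3/2) * exp (- c * (t * b\<^sup>2 + a\<^sup>2 / t)))"
        unfolding heat_profile_def mult.assoc
        by (subst (2) mult.left_commute) (intro mult_left_mono mult_right_mono, auto)
    qed auto
    then show "profile_integral \<alpha> \<sigma> c a b
        \<le> ennreal (C * far_size \<alpha> \<sigma> a b * exp (- c * (a * b)))"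
      unfolding far_size_def by (simp only: mult_ac)
  qed
qed

lemma far_size_lower:
  fixes \<alpha> \<sigma> c :: real
  assumes \<alpha>: "\<alpha> > -1/2" and c: "c > 0"
  obtains C where "C > 0" and "\<And>a b. 0 \<le> a \<Longrightarrow> a \<le> b \<Longrightarrow> 1 \<le> b \<Longrightarrow> \<sigma> > 1/2 \<or> a > 0 \<Longrightarrow>
    ennreal (C * far_size \<alpha> \<sigma> a b * exp (- (3 * c) * (a * b)))
      \<le> profile_integral \<alpha> \<sigma> c a b"
proof -
  obtain C where C: "C > 0" "\<And>a b. 0 \<le> a \<Longrightarrow> a \<le> b \<Longrightarrow> 1 \<le> b \<Longrightarrow> \<sigma> > 1/2 \<or> a > 0 \<Longrightarrow>
    ennreal (C * far_diag \<sigma> a b * exp (- (3 * c) * (a * b)))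
      \<le> integral_over {0<..2} (\<lambda>t. t powr (\<sigma> - 3/2) * exp (- c * (t * b\<^sup>2 + a\<^sup>2 / t)))"
    using integral_gaussian_lower[OF c] by blast
  show ?thesis
  proof (rule that[of "3 powr (-\<alpha> - 1/2) * C"])
    fix a b :: real assume ab: "0 \<le> a" "a \<le> b" "1 \<le> b" "\<sigma> > 1/2 \<or> a > 0"
    have b2: "b\<^sup>2 \<ge> 1" using ab by (simp add: one_le_power)
    have "ennreal (3 powr (-\<alpha> - 1/2) * b powr (-2 * \<alpha> - 1) * (C * far_diag \<sigma> a b * exp (- (3 * c) * (a * b))))
        \<le> profile_integral \<alpha> \<sigma> c a b"
    proof (rule integral_over_lower[OF subset_refl _ _ C(2)[OF ab]])
      fix t :: real assume t: "t \<in> {0<..2}"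
      have "3 powr (-\<alpha> - 1/2) * b powr (-2 * \<alpha> - 1) = (3 * b\<^sup>2) powr (-\<alpha> - 1/2)"
        using ab unfolding powr_mult square_powr by (simp add: right_diff_distrib)
      also have "\<dots> \<le> (t + b\<^sup>2) powr (-\<alpha> - 1/2)"
      proof (rule powr_mono2')
        show "t + b\<^sup>2 \<le> 3 * b\<^sup>2" using t b2 unfolding greaterThanAtMost_iff by linarith
      qed (use t \<alpha> in \<open>auto intro: add_pos_nonneg\<close>)
      finally show "3 powr (-\<alpha> - 1/2) * b powr (-2 * \<alpha> - 1) * (t powr (\<sigma> - 3/2) * exp (- c * (t * b\<^sup>2 + a\<^sup>2 / t)))
          \<le> heat_profile \<alpha> \<sigma> c a b t"
        unfolding heat_profile_def
        by (subst mult.left_commute, subst mult.assoc) (intro mult_left_mono mult_right_mono, auto)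
    qed auto
    then show "ennreal (3 powr (-\<alpha> - 1/2) * C * far_size \<alpha> \<sigma> a b * exp (- (3 * c) * (a * b)))
        \<le> profile_integral \<alpha> \<sigma> c a b"
      unfolding far_size_def by (simp only: mult_ac)
  qed (use C in auto)
qed

text \<open>
  For the times \<open>t \<ge> 2\<close>: one half of the exponent beats the powers of \<open>b\<close> in \<open>far_size\<close>, and the other
  half beats \<open>exp (- (d / 2) a b)\<close> because \<open>a \<le> b\<close>.
\<close>

lemma exp_square_le_far_size:
  fixes \<alpha> \<sigma> d :: real
  assumes \<alpha>: "\<alpha> > -1/2" and d: "d > 0"
  obtains C where "C > 0" and "\<And>a b. 0 \<le> a \<Longrightarrow> a \<le> b \<Longrightarrow> 1 \<le> b \<Longrightarrow> \<sigma> > 1/2 \<or> a > 0 \<Longrightarrow>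
    exp (- d * b\<^sup>2) \<le> C * far_size \<alpha> \<sigma> a b * exp (- (d / 2) * (a * b))"
proof -
  \<comment> \<open>chosen so that \<open>b powr (- 2 N) \<le> far_size\<close> in all three cases, as \<open>a \<le> b\<close> and \<open>b \<ge> 1\<close>\<close>
  define N where "N = (2 * \<alpha> + 1 + \<bar>2 * \<sigma> - 1\<bar>) / 2"
  have N: "N > 0" using \<alpha> by (simp add: N_def)
  have d2: "d / 2 > 0" using d by simp
  obtain K where K: "K > 0" "\<And>x. x > 0 \<Longrightarrow> exp (- (d / 2) * x) \<le> K * x powr (-N)"
    using exp_le_powr[OF d2 N] by blast
  show ?thesis
  proof (rule that[OF K(1)])
    fix a b :: real assume ab: "0 \<le> a" "a \<le> b" "1 \<le> b" "\<sigma> > 1/2 \<or> a > 0"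
    have "b powr (- \<bar>2 * \<sigma> - 1\<bar>) \<le> far_diag \<sigma> a b"
    proof -
      consider (lt) "\<sigma> < 1/2" | (eq) "\<sigma> = 1/2" | (gt) "\<sigma> > 1/2" by linarith
      then show ?thesis
      proof cases
        case lt
        then have "b powr (2 * \<sigma> - 1) \<le> a powr (2 * \<sigma> - 1)" using ab by (intro powr_mono2') auto
        then show ?thesis using lt by (simp add: far_diag_def)
      next
        case eq
        have "b powr (- \<bar>2 * \<sigma> - 1\<bar>) = 1" unfolding eq using ab by simp
        then show ?thesis unfolding far_diag_def eq by simp
      qed (use ab in \<open>auto simp: far_diag_def\<close>)
    qed
    then have "b powr (-2 * \<alpha> - 1) * b powr (- \<bar>2 * \<sigma> - 1\<bar>) \<le> far_size \<alpha> \<sigma> a b"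
      unfolding far_size_def by (intro mult_left_mono) auto
    moreover have "b powr (-2 * \<alpha> - 1) * b powr (- \<bar>2 * \<sigma> - 1\<bar>) = (b\<^sup>2) powr (-N)"
    proof -
      have "-2 * \<alpha> - 1 + - \<bar>2 * \<sigma> - 1\<bar> = 2 * (-N)"
        unfolding N_def by (simp add: field_simps)
      then show ?thesis
        using ab unfolding square_powr powr_add [symmetric] by simp
    qed
    ultimately have "K * (b\<^sup>2) powr (-N) \<le> K * far_size \<alpha> \<sigma> a b"
      using K(1) by simp
    moreover have "exp (- (d / 2) * b\<^sup>2) \<le> K * (b\<^sup>2) powr (-N)"
      using ab by (intro K(2)) simp
    ultimately have 1: "exp (- (d / 2) * b\<^sup>2) \<le> K * far_size \<alpha> \<sigma> a b"
      by linarith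
    have "a * b \<le> b * b" using ab by (intro mult_right_mono) auto
    then have "d / 2 * (a * b) \<le> d / 2 * b\<^sup>2" using d by (simp add: power2_eq_square)
    then have 2: "exp (- (d / 2) * b\<^sup>2) \<le> exp (- (d / 2) * (a * b))" by simp
    have "exp (- d * b\<^sup>2) = exp (- (d / 2) * b\<^sup>2) * exp (- (d / 2) * b\<^sup>2)"
      unfolding exp_add [symmetric] by simp
    also have "\<dots> \<le> K * far_size \<alpha> \<sigma> a b * exp (- (d / 2) * (a * b))"
      using 1 2 by (intro mult_mono) (auto intro: order_trans[OF exp_ge_zero])
    finally show "exp (- d * b\<^sup>2) \<le> K * far_size \<alpha> \<sigma> a b * exp (- (d / 2) * (a * b))" .
  qed
qed

section \<open>Bounds with values in the extended half-line\<close>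

text \<open>
  In terms of \<open>a = \<bar>\<bar>x\<bar> - \<bar>y\<bar>\<bar>\<close> and \<open>b = \<bar>x\<bar> + \<bar>y\<bar>\<close> the bounds for \<open>x y < 0\<close> are instances of those for
  \<open>x y \<ge> 0\<close>.
\<close>

definition near_bound :: "real \<Rightarrow> real \<Rightarrow> real \<Rightarrow> real \<Rightarrow> ennreal" where
  "near_bound \<alpha> \<sigma> a b =
    of_bool (\<sigma> > \<alpha> + 1)
    + of_bool (\<sigma> = \<alpha> + 1) * e2ennreal (elog (1 / ennreal b))
    + (if \<sigma> < 1/2 then epow b (-2*\<alpha> - 1) * epow a (2*\<sigma> - 1)
       else if \<sigma> = 1/2 then epow b (-2*\<alpha> - 1) * (1 + e2ennreal (elog (ennreal b / ennreal a)))
       else epow b ((-2*\<alpha> - 1) + (2*\<sigma> - 1)))"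

definition far_bound :: "real \<Rightarrow> real \<Rightarrow> real \<Rightarrow> real \<Rightarrow> ennreal" where
  "far_bound \<alpha> \<sigma> a b =
    epow b (-2*\<alpha> - 1)
    * (if \<sigma> < 1/2 then epow a (2*\<sigma> - 1)
       else if \<sigma> = 1/2 then 1 + elog_plus (1 / ennreal (a * b))
       else epow b (1 - 2*\<sigma>))"

lemma epow_pos: "s > 0 \<Longrightarrow> epow s \<beta> = ennreal (s powr \<beta>)"
  by (simp add: epow_def)

lemma epow_0_neg: "\<beta> < 0 \<Longrightarrow> epow 0 \<beta> = \<infinity>"
  by (simp add: epow_def)

lemma elog_ennreal: "r > 0 \<Longrightarrow> elog (ennreal r) = ereal (ln r)"
  by (simp add: elog_def ennreal_eq_0_iff)

lemma elog_top: "elog top = \<infinity>"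
  by (simp add: elog_def)

lemma near_bound_eq_near_size:
  assumes "0 \<le> a" "a \<le> b" "0 < b" "b \<le> 1" "\<sigma> > 1/2 \<or> a > 0"
  shows "near_bound \<alpha> \<sigma> a b = ennreal (near_size \<alpha> \<sigma> a b)"
proof -
  have p: "of_bool (\<sigma> > \<alpha> + 1) = ennreal (of_bool (\<sigma> > \<alpha> + 1))"
    by simp
  have "elog (1 / ennreal b) = ereal (ln (1 / b))"
    using elog_ennreal[of "1 / b"] divide_ennreal[of 1 b] assms by simp
  then have q: "of_bool (\<sigma> = \<alpha> + 1) * e2ennreal (elog (1 / ennreal b)) = ennreal (of_bool (\<sigma> = \<alpha> + 1) * ln (1 / b))"
    using assms by (simp add: e2ennreal_ereal)
  have r: "(if \<sigma> < 1/2 then epow b (-2*\<alpha> - 1) * epow a (2*\<sigma> - 1)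
       else if \<sigma> = 1/2 then epow b (-2*\<alpha> - 1) * (1 + e2ennreal (elog (ennreal b / ennreal a)))
       else epow b ((-2*\<alpha> - 1) + (2*\<sigma> - 1))) = ennreal (b powr (-2 * \<alpha> - 1) * near_diag \<sigma> a b)"
  proof -
    consider (lt) "\<sigma> < 1/2" | (eq) "\<sigma> = 1/2" | (gt) "\<sigma> > 1/2" by linarith
    then show ?thesis
    proof cases
      case lt
      then show ?thesis using assms by (simp add: near_diag_def epow_pos ennreal_mult')
    next
      case eq
      then have a: "a > 0" using assms by simp
      have ln: "ln (b / a) \<ge> 0" using a assms by simp
      have "elog (ennreal b / ennreal a) = ereal (ln (b / a))"
        using elog_ennreal[of "b / a"] divide_ennreal[of b a] assms a by simp
      then have "1 + e2ennreal (elog (ennreal b / ennreal a)) = ennreal (near_diag \<sigma> a b)"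
        using eq ln by (simp add: near_diag_def e2ennreal_ereal)
      then show ?thesis unfolding eq using assms by (simp add: epow_pos ennreal_mult')
    next
      case gt
      then show ?thesis using assms by (simp add: near_diag_def epow_pos flip: powr_add)
    qed
  qed
  have "0 \<le> b powr (-2 * \<alpha> - 1) * near_diag \<sigma> a b"
    using near_diag_nonneg[of a b \<sigma>] assms by simp
  moreover have "0 \<le> of_bool (\<sigma> = \<alpha> + 1) * ln (1 / b)" using assms by auto
  moreover have "(0::real) \<le> of_bool (\<sigma> > \<alpha> + 1)" by simp
  ultimately show ?thesis
    unfolding near_bound_def near_size_def p q r by (simp only: ennreal_plus add_nonneg_nonneg)
qed

lemma far_bound_eq_far_size:
  assumes "0 \<le> a" "0 < b" "\<sigma> > 1/2 \<or> a > 0"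
  shows "far_bound \<alpha> \<sigma> a b = ennreal (far_size \<alpha> \<sigma> a b)"
proof -
  have r: "(if \<sigma> < 1/2 then epow a (2*\<sigma> - 1)
       else if \<sigma> = 1/2 then 1 + elog_plus (1 / ennreal (a * b))
       else epow b (1 - 2*\<sigma>)) = ennreal (far_diag \<sigma> a b)"
  proof -
    consider (lt) "\<sigma> < 1/2" | (eq) "\<sigma> = 1/2" | (gt) "\<sigma> > 1/2" by linarith
    then show ?thesis
    proof cases
      case lt
      then show ?thesis using assms by (simp add: far_diag_def epow_pos)
    next
      case eq
      then have a: "a > 0" using assms by simp
      have "elog (1 / ennreal (a * b)) = ereal (ln (1 / (a * b)))"
        using elog_ennreal[of "1 / (a * b)"] divide_ennreal[of 1 "a * b"] assms a by simp
      then have "elog_plus (1 / ennreal (a * b)) = ennreal (max (ln (1 / (a * b))) 0)"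
        unfolding elog_plus_def by (simp add: e2ennreal_ereal max_def zero_ereal_def)
      then show ?thesis using eq by (simp add: far_diag_def max.commute)
    next
      case gt
      then show ?thesis using assms by (simp add: far_diag_def epow_pos)
    qed
  qed
  show ?thesis
    unfolding far_bound_def far_size_def r using assms by (simp add: epow_pos ennreal_mult')
qed

text \<open>
  Together with \<open>heat_profile_integral_infinite\<close> this settles the degenerate points: both sides of the
  estimate are infinite there.
\<close>

lemma near_bound_infinite:
  assumes "\<alpha> > -1/2" and "b \<ge> 0" and "b = 0 \<and> \<sigma> \<le> \<alpha> + 1 \<or> \<sigma> \<le> 1/2" and "a = 0"
  shows "near_bound \<alpha> \<sigma> a b = \<infinity>"
proof -
  consider (eq) "\<sigma> = \<alpha> + 1" "b = 0" | (half) "\<sigma> \<le> 1/2" | (gt) "1/2 < \<sigma>" "\<sigma> < \<alpha> + 1" "b = 0"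
    using assms by linarith
  then show ?thesis
  proof cases
    case eq
    then show ?thesis by (simp add: near_bound_def elog_top)
  next
    case half
    have "epow b (-2 * \<alpha> - 1) \<noteq> 0" using assms by (simp add: epow_def ennreal_eq_0_iff)
    moreover have "elog (ennreal b / ennreal 0) = \<infinity>" if "b > 0"
      using that by (simp add: elog_def ennreal_divide_eq_top_iff ennreal_eq_0_iff)
    moreover have "epow b (-2 * \<alpha> - 1) = \<infinity>" if "b = 0" using that assms by (simp add: epow_0_neg)
    ultimately show ?thesis using half assms
      by (cases "\<sigma> = 1/2"; cases "b = 0") (auto simp: near_bound_def epow_0_neg ennreal_mult_eq_top_iff ennreal_top_mult)
  next
    case gt
    then show ?thesis by (simp add: near_bound_def epow_0_neg)
  qed
qed

lemma far_bound_infinite: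
  assumes "b > 0" and "\<sigma> \<le> 1/2" and "a = 0"
  shows "far_bound \<alpha> \<sigma> a b = \<infinity>"
  using assms by (auto simp: far_bound_def epow_0_neg epow_pos elog_plus_def elog_top max_def
      ennreal_mult_eq_top_iff ennreal_eq_0_iff)

text \<open>
  At \<open>a = 0\<close> the exponential no longer cuts off small \<open>t\<close>, and the profile behaves at \<open>0\<close> like
  \<open>t powr (\<sigma> - 3/2)\<close> if \<open>b > 0\<close> and like \<open>t powr (\<sigma> - \<alpha> - 2)\<close> if \<open>b = 0\<close>.
\<close>

lemma heat_profile_integral_infinite:
  assumes \<alpha>: "\<alpha> > -1/2" and c: "c > 0" and "b \<ge> 0" and "b = 0 \<and> \<sigma> \<le> \<alpha> + 1 \<or> \<sigma> \<le> 1/2" and "a = 0"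
  shows "profile_integral \<alpha> \<sigma> c a b = \<infinity>"
proof (cases "b = 0")
  case True
  show ?thesis
  proof (rule integral_over_infinite[of 1 "\<sigma> - \<alpha> - 2"])
    fix t :: real
    have "t powr (\<sigma> - \<alpha> - 2) = t powr (\<sigma> - 3/2) * t powr (-\<alpha> - 1/2)"
      unfolding powr_add [symmetric] by simp
    then show "1 * t powr (\<sigma> - \<alpha> - 2) \<le> heat_profile \<alpha> \<sigma> c a b t"
      using assms True by (simp add: heat_profile_def)
  qed (use assms True in auto)
next
  case False
  show ?thesis
  proof (rule integral_over_infinite[of "(2 + b\<^sup>2) powr (-\<alpha> - 1/2) * exp (- c * (2 * b\<^sup>2))" "\<sigma> - 3/2"])
    fix t :: real assume t: "t \<in> {0<..2}"
    have "(2 + b\<^sup>2) powr (-\<alpha> - 1/2) \<le> (t + b\<^sup>2) powr (-\<alpha> - 1/2)"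
      using t \<alpha> by (intro powr_mono2') (auto intro: add_pos_nonneg)
    moreover have "c * (t * b\<^sup>2) \<le> c * (2 * b\<^sup>2)"
      using t c by (intro mult_left_mono mult_right_mono) auto
    then have "exp (- c * (2 * b\<^sup>2)) \<le> exp (- c * (t * b\<^sup>2 + a\<^sup>2 / t))"
      using \<open>a = 0\<close> by simp
    ultimately have "(2 + b\<^sup>2) powr (-\<alpha> - 1/2) * exp (- c * (2 * b\<^sup>2))
        \<le> (t + b\<^sup>2) powr (-\<alpha> - 1/2) * exp (- c * (t * b\<^sup>2 + a\<^sup>2 / t))"
      by (intro mult_mono) auto
    from mult_left_mono[OF this, of "t powr (\<sigma> - 3/2)"]
    show "(2 + b\<^sup>2) powr (-\<alpha> - 1/2) * exp (- c * (2 * b\<^sup>2)) * t powr (\<sigma> - 3/2) \<le> heat_profile \<alpha> \<sigma> c a b t"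
      unfolding heat_profile_def by (simp only: mult_ac powr_ge_zero)
  qed (use assms False in \<open>auto simp: add_nonneg_eq_0_iff\<close>)
qed

text \<open>
  Besides the generic points and those where both sides are infinite there is the origin for
  \<open>\<sigma> > \<alpha> + 1\<close>: the profile is then a pure integrable power and the bound equals \<open>1\<close>.
\<close>

lemma near_bound_lower:
  fixes \<alpha> \<sigma> c :: real
  assumes \<alpha>: "\<alpha> > -1/2" and c: "c > 0"
  obtains C where "C > 0" and "\<And>a b. 0 \<le> a \<Longrightarrow> a \<le> b \<Longrightarrow> b \<le> 1 \<Longrightarrow>
    ennreal C * near_bound \<alpha> \<sigma> a b \<le> profile_integral \<alpha> \<sigma> c a b"
proof -
  obtain C where C: "C > 0" "\<And>a b. 0 \<le> a \<Longrightarrow> a \<le> b \<Longrightarrow> 0 < b \<Longrightarrow> b \<le> 1 \<Longrightarrow> \<sigma> > 1/2 \<or> a > 0 \<Longrightarrow>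
    ennreal (C * near_size \<alpha> \<sigma> a b) \<le> profile_integral \<alpha> \<sigma> c a b"
    using near_size_lower[OF \<alpha> c] by blast
  obtain k where k: "k > 0" "\<And>h. h > 0 \<Longrightarrow>
      ennreal (k * h powr (\<sigma> - \<alpha> - 2 + 1)) \<le> integral_over {h..2*h} (\<lambda>t. t powr (\<sigma> - \<alpha> - 2))"
    using integral_power_dyadic_lower by blast
  show ?thesis
  proof (rule that[of "min C k"])
    fix a b :: real assume ab: "0 \<le> a" "a \<le> b" "b \<le> 1"
    consider (sing) "a = 0" "b = 0 \<and> \<sigma> \<le> \<alpha> + 1 \<or> \<sigma> \<le> 1/2" | (origin) "a = 0" "b = 0" "\<sigma> > \<alpha> + 1"
      | (regular) "b > 0" "\<sigma> > 1/2 \<or> a > 0" using ab by linarith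
    then show "ennreal (min C k) * near_bound \<alpha> \<sigma> a b \<le> profile_integral \<alpha> \<sigma> c a b"
    proof cases
      case sing
      then show ?thesis using heat_profile_integral_infinite[OF \<alpha> c] ab by simp
    next
      case origin
      have *: "t powr (\<sigma> - \<alpha> - 2) = heat_profile \<alpha> \<sigma> c a b t" for t
      proof -
        have "t powr (\<sigma> - \<alpha> - 2) = t powr (\<sigma> - 3/2) * t powr (-\<alpha> - 1/2)"
          unfolding powr_add [symmetric] by simp
        then show ?thesis using origin by (simp add: heat_profile_def)
      qed
      have "near_bound \<alpha> \<sigma> a b = 1"
        using origin \<alpha> by (simp add: near_bound_def epow_def)
      then have "ennreal (min C k) * near_bound \<alpha> \<sigma> a b \<le> ennreal (k * 1 powr (\<sigma> - \<alpha> - 2 + 1))"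
        by (simp add: ennreal_leI)
      also have "\<dots> \<le> integral_over {1..2*1} (\<lambda>t. t powr (\<sigma> - \<alpha> - 2))"
        by (rule k(2)) simp
      also have "\<dots> \<le> profile_integral \<alpha> \<sigma> c a b"
        by (rule integral_over_mono) (auto simp: *)
      finally show ?thesis .
    next
      case regular
      have "near_size \<alpha> \<sigma> a b \<ge> 0"
        using near_diag_nonneg[of a b \<sigma>] regular ab unfolding near_size_def by auto
      then have "ennreal (min C k) * near_bound \<alpha> \<sigma> a b \<le> ennreal (C * near_size \<alpha> \<sigma> a b)"
        using near_bound_eq_near_size[of a b \<sigma> \<alpha>] regular ab C(1) k(1)
        by (simp add: mult_right_mono ennreal_leI flip: ennreal_mult)
      also have "\<dots> \<le> profile_integral \<alpha> \<sigma> c a b"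
        using C(2) regular ab by blast
      finally show ?thesis .
    qed
  qed (use C k in auto)
qed

text \<open>
  The summand \<open>1\<close> makes room for the large times. It is harmless since the bound is bounded below on
  \<open>b \<le> 1\<close>.
\<close>

lemma near_bound_upper:
  fixes \<alpha> \<sigma> c :: real
  assumes \<alpha>: "\<alpha> > -1/2" and c: "c > 0"
  obtains C where "C > 0" and "\<And>a b. 0 \<le> a \<Longrightarrow> a \<le> b \<Longrightarrow> b \<le> 1 \<Longrightarrow>
    profile_integral \<alpha> \<sigma> c a b + 1 \<le> ennreal C * near_bound \<alpha> \<sigma> a b"
proof -
  obtain C where C: "C > 0" "\<And>a b. 0 \<le> a \<Longrightarrow> a \<le> b \<Longrightarrow> 0 < b \<Longrightarrow> b \<le> 1 \<Longrightarrow> \<sigma> > 1/2 \<or> a > 0 \<Longrightarrow>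
    profile_integral \<alpha> \<sigma> c a b \<le> ennreal (C * near_size \<alpha> \<sigma> a b)"
    using near_size_upper[OF \<alpha> c] by blast
  define k where "k = (if \<sigma> > \<alpha> + 1 then 2 powr (\<sigma> - \<alpha> - 1) / (\<sigma> - \<alpha> - 1) else 0)"
  have k: "k \<ge> 0" by (simp add: k_def)
  show ?thesis
  proof (rule that[of "C + k + 1"])
    fix a b :: real assume ab: "0 \<le> a" "a \<le> b" "b \<le> 1"
    consider (sing) "a = 0" "b = 0 \<and> \<sigma> \<le> \<alpha> + 1 \<or> \<sigma> \<le> 1/2" | (origin) "a = 0" "b = 0" "\<sigma> > \<alpha> + 1"
      | (regular) "b > 0" "\<sigma> > 1/2 \<or> a > 0" using ab by linarith
    then show "profile_integral \<alpha> \<sigma> c a b + 1 \<le> ennreal (C + k + 1) * near_bound \<alpha> \<sigma> a b"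
    proof cases
      case sing
      then show ?thesis using near_bound_infinite[OF \<alpha>, of b \<sigma> a] ab C(1) k
        by (simp add: ennreal_mult_top)
    next
      case origin
      have *: "heat_profile \<alpha> \<sigma> c a b t = t powr (\<sigma> - \<alpha> - 2)" for t
      proof -
        have "t powr (\<sigma> - \<alpha> - 2) = t powr (\<sigma> - 3/2) * t powr (-\<alpha> - 1/2)"
          unfolding powr_add [symmetric] by simp
        then show ?thesis using origin by (simp add: heat_profile_def)
      qed
      have "profile_integral \<alpha> \<sigma> c a b \<le> ennreal (2 powr (\<sigma> - \<alpha> - 2 + 1) / (\<sigma> - \<alpha> - 2 + 1))"
        unfolding * by (rule integral_power_near_0) (use origin in auto)
      also have "2 powr (\<sigma> - \<alpha> - 2 + 1) / (\<sigma> - \<alpha> - 2 + 1) = k"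
        using origin by (simp add: k_def)
      finally have "profile_integral \<alpha> \<sigma> c a b + 1 \<le> ennreal k + 1"
        by (rule add_right_mono)
      also have "\<dots> = ennreal (k + 1)" using k by simp
      also have "\<dots> \<le> ennreal (C + k + 1)" using C by (intro ennreal_leI) simp
      also have "near_bound \<alpha> \<sigma> a b = 1"
        using origin \<alpha> by (simp add: near_bound_def epow_def)
      then have "ennreal (C + k + 1) = ennreal (C + k + 1) * near_bound \<alpha> \<sigma> a b" by simp
      finally show ?thesis .
    next
      case regular
      have s1: "near_size \<alpha> \<sigma> a b \<ge> 1"
      proof (cases "\<sigma> > \<alpha> + 1")
        case True
        then show ?thesis
          using near_diag_nonneg[of a b \<sigma>] regular ab unfolding near_size_def by simp
      next
        case False
        have "1 \<le> b powr (2 * (\<sigma> - \<alpha> - 1))"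
          using powr_mono2'[of "2 * (\<sigma> - \<alpha> - 1)" b 1] False regular ab by simp
        then have "1 \<le> b powr (-2 * \<alpha> - 1) * near_diag \<sigma> a b"
          using powr_le_near_size[of a b \<sigma> \<alpha>] regular ab by linarith
        moreover have "0 \<le> of_bool (\<sigma> = \<alpha> + 1) * ln (1 / b)" using regular ab by auto
        moreover have "(0::real) \<le> of_bool (\<sigma> > \<alpha> + 1)" by simp
        ultimately show ?thesis unfolding near_size_def by linarith
      qed
      have "profile_integral \<alpha> \<sigma> c a b + 1 \<le> ennreal (C * near_size \<alpha> \<sigma> a b) + 1"
        using C(2) regular ab by (intro add_right_mono) blast
      also have "\<dots> = ennreal (C * near_size \<alpha> \<sigma> a b + 1)"
        using C(1) s1 by simp
      also have "\<dots> \<le> ennreal ((C + k + 1) * near_size \<alpha> \<sigma> a b)"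
      proof (rule ennreal_leI)
        have "0 \<le> k * near_size \<alpha> \<sigma> a b" using k s1 by simp
        then show "C * near_size \<alpha> \<sigma> a b + 1 \<le> (C + k + 1) * near_size \<alpha> \<sigma> a b"
          using s1 by (simp add: distrib_right)
      qed
      also have "\<dots> = ennreal (C + k + 1) * near_bound \<alpha> \<sigma> a b"
        using near_bound_eq_near_size[of a b \<sigma> \<alpha>] regular ab C(1) k by (simp add: ennreal_mult')
      finally show ?thesis .
    qed
  qed (use C k in auto)
qed

lemma far_bound_lower:
  fixes \<alpha> \<sigma> c :: real
  assumes \<alpha>: "\<alpha> > -1/2" and c: "c > 0"
  obtains C where "C > 0" and "\<And>a b. 0 \<le> a \<Longrightarrow> a \<le> b \<Longrightarrow> 1 < b \<Longrightarrow>
    ennreal C * far_bound \<alpha> \<sigma> a b * ennreal (exp (- (3 * c) * (a * b)))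
      \<le> profile_integral \<alpha> \<sigma> c a b"
proof -
  obtain C where C: "C > 0" "\<And>a b. 0 \<le> a \<Longrightarrow> a \<le> b \<Longrightarrow> 1 \<le> b \<Longrightarrow> \<sigma> > 1/2 \<or> a > 0 \<Longrightarrow>
    ennreal (C * far_size \<alpha> \<sigma> a b * exp (- (3 * c) * (a * b)))
      \<le> profile_integral \<alpha> \<sigma> c a b"
    using far_size_lower[OF \<alpha> c] by blast
  show ?thesis
  proof (rule that[OF C(1)])
    fix a b :: real assume ab: "0 \<le> a" "a \<le> b" "1 < b"
    show "ennreal C * far_bound \<alpha> \<sigma> a b * ennreal (exp (- (3 * c) * (a * b)))
      \<le> profile_integral \<alpha> \<sigma> c a b"
    proof (cases "\<sigma> > 1/2 \<or> a > 0")
      case True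
      then show ?thesis using C(2)[of a b] far_bound_eq_far_size[of a b \<sigma> \<alpha>] ab C(1)
        by (simp add: ennreal_mult' ennreal_mult'')
    next
      case False
      then show ?thesis using heat_profile_integral_infinite[OF \<alpha> c, of b \<sigma> a] ab by simp
    qed
  qed
qed

lemma far_bound_upper:
  fixes \<alpha> \<sigma> c d :: real
  assumes \<alpha>: "\<alpha> > -1/2" and c: "c > 0" and d: "d > 0"
  obtains C where "C > 0" and "\<And>a b. 0 \<le> a \<Longrightarrow> a \<le> b \<Longrightarrow> 1 < b \<Longrightarrow>
    profile_integral \<alpha> \<sigma> c a b + ennreal (exp (- d * b\<^sup>2))
      \<le> ennreal C * far_bound \<alpha> \<sigma> a b * ennreal (exp (- (min c (d / 2)) * (a * b)))"
proof -
  obtain C where C: "C > 0" "\<And>a b. 0 \<le> a \<Longrightarrow> 0 < b \<Longrightarrow> \<sigma> > 1/2 \<or> a > 0 \<Longrightarrow>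
    profile_integral \<alpha> \<sigma> c a b \<le> ennreal (C * far_size \<alpha> \<sigma> a b * exp (- c * (a * b)))"
    using far_size_upper[OF \<alpha> c] by blast
  obtain D where D: "D > 0" "\<And>a b. 0 \<le> a \<Longrightarrow> a \<le> b \<Longrightarrow> 1 \<le> b \<Longrightarrow> \<sigma> > 1/2 \<or> a > 0 \<Longrightarrow>
    exp (- d * b\<^sup>2) \<le> D * far_size \<alpha> \<sigma> a b * exp (- (d / 2) * (a * b))"
    using exp_square_le_far_size[OF \<alpha> d] by blast
  define m where "m = min c (d / 2)"
  show ?thesis
  proof (rule that[of "C + D"], fold m_def)
    fix a b :: real assume ab: "0 \<le> a" "a \<le> b" "1 < b"
    show "profile_integral \<alpha> \<sigma> c a b + ennreal (exp (- d * b\<^sup>2))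
      \<le> ennreal (C + D) * far_bound \<alpha> \<sigma> a b * ennreal (exp (- m * (a * b)))"
    proof (cases "\<sigma> > 1/2 \<or> a > 0")
      case True
      have F: "far_size \<alpha> \<sigma> a b \<ge> 0" unfolding far_size_def using far_diag_nonneg by simp
      have e: "exp (- l * (a * b)) \<le> exp (- m * (a * b))" if "m \<le> l" for l
        using mult_right_mono[OF that, of "a * b"] ab by simp
      have "profile_integral \<alpha> \<sigma> c a b \<le> ennreal (C * far_size \<alpha> \<sigma> a b * exp (- c * (a * b)))"
        using C(2) True ab by simp
      also have "\<dots> \<le> ennreal (C * far_size \<alpha> \<sigma> a b * exp (- m * (a * b)))"
        using C(1) F by (intro ennreal_leI mult_left_mono e) (auto simp: m_def)
      finally have 1: "profile_integral \<alpha> \<sigma> c a b \<le> \<dots>" .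
      have "exp (- d * b\<^sup>2) \<le> D * far_size \<alpha> \<sigma> a b * exp (- (d / 2) * (a * b))"
        using D(2)[of a b] True ab by simp
      also have "\<dots> \<le> D * far_size \<alpha> \<sigma> a b * exp (- m * (a * b))"
        using D(1) F by (intro mult_left_mono e) (auto simp: m_def)
      finally have 2: "ennreal (exp (- d * b\<^sup>2)) \<le> ennreal (D * far_size \<alpha> \<sigma> a b * exp (- m * (a * b)))"
        by (rule ennreal_leI)
      have "profile_integral \<alpha> \<sigma> c a b + ennreal (exp (- d * b\<^sup>2))
        \<le> ennreal (C * far_size \<alpha> \<sigma> a b * exp (- m * (a * b))) + ennreal (D * far_size \<alpha> \<sigma> a b * exp (- m * (a * b)))"
        by (intro add_mono 1 2)
      also have "\<dots> = ennreal ((C + D) * far_size \<alpha> \<sigma> a b * exp (- m * (a * b)))"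
        using C(1) D(1) F by (subst ennreal_plus [symmetric]) (auto simp: distrib_right)
      also have "\<dots> = ennreal (C + D) * far_bound \<alpha> \<sigma> a b * ennreal (exp (- m * (a * b)))"
        using far_bound_eq_far_size[of a b \<sigma> \<alpha>] True ab C(1) D(1) F
        by (simp add: ennreal_mult' ennreal_mult'')
      finally show ?thesis .
    next
      case False
      then show ?thesis using far_bound_infinite[of b \<sigma> a \<alpha>] ab C(1) D(1)
        by (simp add: ennreal_mult_top ennreal_top_mult)
    qed
  qed (use C D in auto)
qed

section \<open>Poisson integrals for the modified Bessel functions\<close>

lemma cosh_sums: "(\<lambda>k. (x::real) ^ (2 * k) / fact (2 * k)) sums cosh x"
proof -
  have "(\<lambda>k. (\<lambda>n. if even n then x ^ n /\<^sub>R fact n else 0) (2 * k)) sums cosh x"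
    by (subst sums_mono_reindex) (auto simp: strict_mono_def cosh_converges elim!: evenE)
  then show ?thesis by (simp add: divide_inverse mult.commute)
qed

lemma sinh_sums: "(\<lambda>k. (x::real) ^ (2 * k + 1) / fact (2 * k + 1)) sums sinh x"
proof -
  have "(\<lambda>k. (\<lambda>n. if even n then 0 else x ^ n /\<^sub>R fact n) (2 * k + 1)) sums sinh x"
    by (subst sums_mono_reindex) (auto simp: strict_mono_def sinh_converges elim!: oddE)
  then show ?thesis by (simp add: divide_inverse mult.commute)
qed

text \<open>
  Poisson's weight \<open>(1 - s\<^sup>2) powr (\<alpha> - 1/2)\<close> on \<open>0 < s < 1\<close>, doubled and in the variable
  \<open>q = 1 - s\<^sup>2\<close>: its moments are values of the Beta function, and the decisive endpoint \<open>s = 1\<close> becomes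
  \<open>q = 0\<close>.
\<close>

definition bessel_weight :: "real \<Rightarrow> real \<Rightarrow> real" where
  "bessel_weight \<alpha> q = q powr (\<alpha> - 1/2) * (1 - q) powr (-1/2)"

lemma bessel_weight_measurable [measurable]: "bessel_weight \<alpha> \<in> borel_measurable borel"
  unfolding bessel_weight_def by measurable

lemma bessel_weight_nonneg: "bessel_weight \<alpha> q \<ge> 0"
  by (simp add: bessel_weight_def)

lemma bessel_weight_moment:
  assumes "\<alpha> > -1/2"
  shows "((\<lambda>q. bessel_weight \<alpha> q * (1 - q) ^ m) has_integral Beta (\<alpha> + 1/2) (real m + 1/2)) {0..1}"
proof -
  have "((\<lambda>t. t powr (\<alpha> + 1/2 - 1) * (1 - t) powr (real m + 1/2 - 1)) has_integral
      Beta (\<alpha> + 1/2) (real m + 1/2)) {0..1}"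
    by (rule has_integral_Beta_real) (use assms in auto)
  then show ?thesis
  proof (rule has_integral_eq[rotated])
    fix q :: real assume q: "q \<in> {0..1}"
    show "q powr (\<alpha> + 1/2 - 1) * (1 - q) powr (real m + 1/2 - 1) = bessel_weight \<alpha> q * (1 - q) ^ m"
    proof (cases "q = 1")
      case False
      then have "(1 - q) powr (real m + 1/2 - 1) = (1 - q) powr (-1/2) * (1 - q) ^ m"
        using q by (simp add: powr_realpow [symmetric] powr_add [symmetric])
      then show ?thesis by (simp add: bessel_weight_def)
    qed (simp add: bessel_weight_def)
  qed
qed

text \<open>
  The coefficients are nonnegative, so monotone convergence applies; the Beta values decrease in \<open>k\<close>, so
  the integrated series converges along with the series at \<open>q = 0\<close>.
\<close>

lemma bessel_weight_series:
  assumes \<alpha>: "\<alpha> > -1/2" and c: "\<And>k. c k \<ge> 0"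
    and F: "\<And>q. q \<in> {0..1} \<Longrightarrow> (\<lambda>k. c k * (1 - q) ^ (k + j)) sums F q"
  obtains S where "(\<lambda>k. c k * Beta (\<alpha> + 1/2) (real (k + j) + 1/2)) sums S"
    and "((\<lambda>q. bessel_weight \<alpha> q * F q) has_integral S) {0..1}"
proof -
  let ?B = "\<lambda>m. Beta (\<alpha> + 1/2) (real m + 1/2)"
  have B_le: "?B m \<le> ?B 0" for m
    using \<alpha> by (intro Beta_real_mono) auto
  have B_ge: "?B m \<ge> 0" for m
    by (rule has_integral_nonneg[OF bessel_weight_moment[OF \<alpha>]]) (auto intro!: mult_nonneg_nonneg bessel_weight_nonneg)
  have "summable c" using F[of 0] by (auto simp: summable_def)
  then have "summable (\<lambda>k. c k * ?B 0)" by (rule summable_mult2)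
  then have "summable (\<lambda>k. c k * ?B (k + j))"
  proof (rule summable_comparison_test')
    show "norm (c k * ?B (k + j)) \<le> c k * ?B 0" for k
      using mult_left_mono[OF B_le[of "k + j"] c[of k]] c[of k] B_ge[of "k + j"] by (simp add: abs_mult)
  qed
  then obtain S where S: "(\<lambda>k. c k * ?B (k + j)) sums S" by (auto simp: summable_def)
  have "((\<lambda>q. bessel_weight \<alpha> q * F q) has_integral S) {0..1}"
  proof (rule has_integral_monotone_convergence_increasing)
    show "((\<lambda>q. \<Sum>k<n. c k * (bessel_weight \<alpha> q * (1 - q) ^ (k + j))) has_integral (\<Sum>k<n. c k * ?B (k + j))) {0..1}" for n
      by (intro has_integral_sum has_integral_mult_right bessel_weight_moment \<alpha>) auto
    show "(\<Sum>k<n. c k * (bessel_weight \<alpha> q * (1 - q) ^ (k + j)))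
        \<le> (\<Sum>k<Suc n. c k * (bessel_weight \<alpha> q * (1 - q) ^ (k + j)))" if "q \<in> {0..1}" for n q
      using that c bessel_weight_nonneg by simp
    show "(\<lambda>n. \<Sum>k<n. c k * (bessel_weight \<alpha> q * (1 - q) ^ (k + j))) \<longlonglongrightarrow> bessel_weight \<alpha> q * F q"
      if "q \<in> {0..1}" for q
      using sums_mult[OF F[OF that], of "bessel_weight \<alpha> q"] by (simp add: sums_def mult.left_commute)
    show "(\<lambda>n. \<Sum>k<n. c k * ?B (k + j)) \<longlonglongrightarrow> S" using S by (simp add: sums_def)
  qed
  then show ?thesis using S that by blast
qed

text \<open>
  Both sides are a quotient by the Pochhammer symbol \<open>(1/2)\<^sub>k\<close>. This is the duplication formula that
  turns the Taylor coefficients of \<open>cosh\<close> and \<open>sinh\<close> into those of the Bessel functions.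
\<close>

lemma Gamma_half_over_fact_double:
  "Gamma (real k + 1/2) / fact (2 * k) = sqrt pi / (4 ^ k * fact k)"
proof -
  have "Gamma (real k + 1/2) = pochhammer (1/2) k * sqrt pi"
  proof -
    have "(1/2 :: real) \<notin> nonpos_Ints" using nonpos_Ints_nonpos[of "1/2 :: real"] by auto
    then show ?thesis
      using pochhammer_Gamma[of "1/2 :: real" k] Gamma_one_half_real
      by (simp add: add.commute field_simps)
  qed
  moreover have "pochhammer (1/2 :: real) k \<noteq> 0"
    by (simp add: pochhammer_pos order_less_imp_not_eq2)
  ultimately show ?thesis
    by (simp add: fact_double power_mult)
qed

lemma Gamma_half_over_fact:
  assumes "j = 0 \<or> j = 1"
  shows "Gamma (real (k + j) + 1/2) / fact (2 * k + j) = sqrt pi / (4 ^ k * fact k) / 2 ^ j"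
proof (cases "j = 0")
  case True
  then show ?thesis using Gamma_half_over_fact_double[of k] by simp
next
  case False
  have "Gamma (real k + 1/2 + 1) = (real k + 1/2) * Gamma (real k + 1/2)"
    using Gamma_plus1[of "real k + 1/2"] nonpos_Ints_nonpos[of "real k + 1/2"] by auto
  moreover have "real (k + 1) + 1/2 = real k + 1/2 + 1" by simp
  moreover have "fact (2 * k + 1) = 2 * (real k + 1/2) * (fact (2 * k) :: real)"
    by (simp add: algebra_simps)
  moreover have "x * g / (2 * x * F) = g / F / 2" if "x \<noteq> 0" for x g F :: real
    using that by simp
  moreover have "real k + 1/2 \<noteq> 0" using of_nat_0_le_iff[of k] by linarith
  ultimately have "Gamma (real (k + 1) + 1/2) / fact (2 * k + 1) = Gamma (real k + 1/2) / fact (2 * k) / 2"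
    by (simp only: not_False_eq_True)
  then show ?thesis using False assms Gamma_half_over_fact_double[of k] by simp
qed

definition bessel_const :: "real \<Rightarrow> real" where
  "bessel_const \<alpha> = 2 powr (-\<alpha>) / (sqrt pi * Gamma (\<alpha> + 1/2))"

lemma bessel_const_pos: "\<alpha> > -1/2 \<Longrightarrow> bessel_const \<alpha> > 0"
  by (simp add: bessel_const_def)

text \<open>
  Poisson's integral: integrating the Taylor series of \<open>F\<close> against the weight reproduces the Bessel
  series term by term. An odd series (\<open>j = 1\<close>) together with an extra factor \<open>sqrt (1 - q)\<close> raises the
  Beta arguments by \<open>1\<close>, which gives the Bessel function of order \<open>\<alpha> + 1\<close> with the weight of order
  \<open>\<alpha>\<close>. So the two Bessel functions in \<open>\<Phi>\<close> can be added and subtracted under one integral.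
\<close>

lemma bessel_I_poisson:
  assumes \<alpha>: "\<alpha> > -1/2" and w: "w > 0" and j: "j = 0 \<or> j = 1"
    and F: "\<And>q. q \<in> {0..1} \<Longrightarrow> (\<lambda>k. w ^ (2 * k + j) / fact (2 * k + j) * (1 - q) ^ (k + j)) sums F q"
  shows "((\<lambda>q. bessel_weight \<alpha> q * F q) has_integral
            w powr (-\<alpha>) * bessel_I (\<alpha> + real j) w / bessel_const \<alpha>) {0..1}"
proof -
  obtain S where S: "(\<lambda>k. w ^ (2 * k + j) / fact (2 * k + j) * Beta (\<alpha> + 1/2) (real (k + j) + 1/2)) sums S"
    "((\<lambda>q. bessel_weight \<alpha> q * F q) has_integral S) {0..1}"
    using bessel_weight_series[OF \<alpha> _ F] w by auto
  have "(w / 2) powr (2 * real k + (\<alpha> + real j)) * rGamma (\<alpha> + real j + real k + 1) / fact k =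
      bessel_const \<alpha> * w powr \<alpha> * (w ^ (2 * k + j) / fact (2 * k + j) * Beta (\<alpha> + 1/2) (real (k + j) + 1/2))" for k
  proof -
    have cancel: "A / (P * G) * B * W * G * R * (P / (D * F) / N) = W / (N * D) * B * A * R / F"
      if "P \<noteq> 0" "G \<noteq> 0" for A P G B W R D F N :: real
      using that by (simp add: mult_ac)
    have G: "Gamma (\<alpha> + 1/2) > 0" using \<alpha> by simp
    have p: "(w / 2) powr (2 * real k + (\<alpha> + real j)) = w ^ (2 * k + j) / (2 ^ j * 4 ^ k) * w powr \<alpha> * 2 powr (-\<alpha>)"
    proof -
      have "(w / 2) powr real (2 * k + j) = (w / 2) ^ (2 * k + j)"
        using w by (intro powr_realpow) simp
      also have "\<dots> = w ^ (2 * k + j) / (2 ^ j * 4 ^ k)"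
      proof -
        have "(2::real) ^ (2 * k + j) = 4 ^ k * 2 ^ j" by (simp add: power_add power_mult)
        then show ?thesis unfolding power_divide by (simp only: mult.commute)
      qed
      finally have "(w / 2) powr real (2 * k + j) = w ^ (2 * k + j) / (2 ^ j * 4 ^ k)" .
      moreover have "(w / 2) powr \<alpha> = w powr \<alpha> * 2 powr (-\<alpha>)"
        using w by (simp add: powr_divide powr_minus_divide)
      moreover have "(w / 2) powr (2 * real k + (\<alpha> + real j)) = (w / 2) powr real (2 * k + j) * (w / 2) powr \<alpha>"
        unfolding powr_add [symmetric] by (simp add: add_ac)
      ultimately show ?thesis by (simp only: mult.assoc)
    qed
    have "bessel_const \<alpha> * w powr \<alpha> * (w ^ (2 * k + j) / fact (2 * k + j) * Beta (\<alpha> + 1/2) (real (k + j) + 1/2))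
       = bessel_const \<alpha> * w powr \<alpha> * w ^ (2 * k + j) * Gamma (\<alpha> + 1/2) * rGamma (\<alpha> + 1/2 + (real (k + j) + 1/2))
          * (Gamma (real (k + j) + 1/2) / fact (2 * k + j))"
      by (simp only: Beta_def rGamma_inverse_Gamma divide_inverse mult_ac)
    also have "\<alpha> + 1/2 + (real (k + j) + 1/2) = \<alpha> + real j + real k + 1" by simp
    also have "bessel_const \<alpha> * w powr \<alpha> * w ^ (2 * k + j) * Gamma (\<alpha> + 1/2) * rGamma (\<alpha> + real j + real k + 1)
          * (Gamma (real (k + j) + 1/2) / fact (2 * k + j))
       = (w / 2) powr (2 * real k + (\<alpha> + real j)) * rGamma (\<alpha> + real j + real k + 1) / fact k"
      unfolding Gamma_half_over_fact[OF j] p bessel_const_def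
      using G by (intro cancel) auto
    finally show ?thesis by simp
  qed
  then have "(\<lambda>k. (w / 2) powr (2 * real k + (\<alpha> + real j)) * rGamma (\<alpha> + real j + real k + 1) / fact k)
      sums (bessel_const \<alpha> * w powr \<alpha> * S)"
    using sums_mult[OF S(1), of "bessel_const \<alpha> * w powr \<alpha>"] by simp
  then have "bessel_I (\<alpha> + real j) w = bessel_const \<alpha> * w powr \<alpha> * S"
    unfolding bessel_I_def by (rule sums_unique [symmetric])
  then have "S = w powr (-\<alpha>) * bessel_I (\<alpha> + real j) w / bessel_const \<alpha>"
    using bessel_const_pos[OF \<alpha>] w by (simp add: powr_minus field_simps)
  then show ?thesis using S(2) by simp
qed

lemma bessel_I_integral:
  assumes \<alpha>: "\<alpha> > -1/2" and w: "w > 0"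
  shows "((\<lambda>q. bessel_weight \<alpha> q * cosh (w * sqrt (1 - q))) has_integral
            w powr (-\<alpha>) * bessel_I \<alpha> w / bessel_const \<alpha>) {0..1}"
proof -
  have "(\<lambda>k. w ^ (2 * k + 0) / fact (2 * k + 0) * (1 - q) ^ (k + 0)) sums cosh (w * sqrt (1 - q))"
    if "q \<in> {0..1}" for q
    using cosh_sums[of "w * sqrt (1 - q)"] that by (simp add: power_mult_distrib power_mult)
  from bessel_I_poisson[OF \<alpha> w _ this] show ?thesis by simp
qed

lemma bessel_I_Suc_integral:
  assumes \<alpha>: "\<alpha> > -1/2" and w: "w > 0"
  shows "((\<lambda>q. bessel_weight \<alpha> q * (sqrt (1 - q) * sinh (w * sqrt (1 - q)))) has_integral
            w powr (-\<alpha>) * bessel_I (\<alpha> + 1) w / bessel_const \<alpha>) {0..1}"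
proof -
  have "(\<lambda>k. w ^ (2 * k + 1) / fact (2 * k + 1) * (1 - q) ^ (k + 1)) sums (sqrt (1 - q) * sinh (w * sqrt (1 - q)))"
    if "q \<in> {0..1}" for q
  proof -
    have "s * (w * s) ^ (2 * k + 1) = w ^ (2 * k + 1) * (s\<^sup>2) ^ (k + 1)" for s k
      by (simp add: power_mult_distrib power2_eq_square power_mult mult_ac)
    from this[of "sqrt (1 - q)"]
    have "sqrt (1 - q) * ((w * sqrt (1 - q)) ^ (2 * k + 1) / fact (2 * k + 1))
        = w ^ (2 * k + 1) / fact (2 * k + 1) * (1 - q) ^ (k + 1)" for k
      using that by simp
    then show ?thesis using sums_mult[OF sinh_sums[of "w * sqrt (1 - q)"], of "sqrt (1 - q)"]
      by (simp only:)
  qed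
  from bessel_I_poisson[OF \<alpha> w _ this] show ?thesis by simp
qed

section \<open>Two-sided bounds for the kernel function\<close>

lemma Phi_integral:
  assumes \<alpha>: "\<alpha> > -1/2" and w: "w > 0" and \<epsilon>: "\<epsilon> = 1 \<or> \<epsilon> = -1"
  shows "((\<lambda>q. bessel_weight \<alpha> q * (cosh (w * sqrt (1 - q)) + \<epsilon> * (sqrt (1 - q) * sinh (w * sqrt (1 - q)))))
           has_integral Phi \<alpha> (\<epsilon> * w) / bessel_const \<alpha>) {0..1}"
proof -
  have "((\<lambda>q. bessel_weight \<alpha> q * cosh (w * sqrt (1 - q))
          + \<epsilon> * (bessel_weight \<alpha> q * (sqrt (1 - q) * sinh (w * sqrt (1 - q)))))
         has_integral (w powr (-\<alpha>) * bessel_I \<alpha> w / bessel_const \<alpha>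
          + \<epsilon> * (w powr (-\<alpha>) * bessel_I (\<alpha> + 1) w / bessel_const \<alpha>))) {0..1}"
    by (intro has_integral_add has_integral_mult_right bessel_I_integral bessel_I_Suc_integral \<alpha> w)
  moreover have "Phi \<alpha> (\<epsilon> * w) = w powr (-\<alpha>) * (bessel_I \<alpha> w + \<epsilon> * bessel_I (\<alpha> + 1) w)"
    using w \<epsilon> by (auto simp: Phi_def)
  ultimately show ?thesis by (simp add: algebra_simps add_divide_distrib)
qed

text \<open>
  With \<open>s = sqrt (1 - q)\<close> the integrand is \<open>((1 + \<epsilon> s) exp (w s) + (1 - \<epsilon> s) exp (- w s)) / 2\<close>. For
  \<open>\<epsilon> = -1\<close> the growing exponential carries the factor \<open>1 - s\<close>, which is of order \<open>q\<close>; this is the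
  cancellation between the two Bessel functions.
\<close>

lemma exp_profile_bounds:
  fixes w q \<epsilon> \<delta> :: real
  assumes q: "0 < q" "q \<le> 1" and w: "w > 0" and \<epsilon>: "\<epsilon> = 1 \<and> \<delta> = 0 \<or> \<epsilon> = -1 \<and> \<delta> = 1"
  defines "f \<equiv> cosh (w * sqrt (1 - q)) + \<epsilon> * (sqrt (1 - q) * sinh (w * sqrt (1 - q)))"
  shows "exp w * (q powr \<delta> * exp (- (w * q)) / 4) \<le> f"
    and "f \<le> exp w * (q powr \<delta> * exp (- (w * q / 2)) + exp (- w))"
    and "f \<ge> 0"
proof -
  define s where "s = sqrt (1 - q)"
  have s: "0 \<le> s" "s \<le> 1" and s2: "s\<^sup>2 = 1 - q" using q by (auto simp: s_def)
  have qs: "q = (1 - s) * (1 + s)" using s2 by (simp add: power2_eq_square algebra_simps)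
  have le1: "1 - s \<le> q" unfolding qs using s by (simp add: mult_left_le[of _ "1 - s"] mult_le_cancel_left1)
  have le2: "q / 2 \<le> 1 - s"
    using mult_left_mono[of "1 + s" 2 "1 - s"] s unfolding qs by simp
  have e1: "exp w * exp (- (w * q)) \<le> exp (w * s)"
    using mult_left_mono[OF le1, of w] w unfolding exp_add [symmetric] by (simp add: algebra_simps)
  have e2: "exp (w * s) \<le> exp w * exp (- (w * q / 2))"
    using mult_left_mono[OF le2, of w] w unfolding exp_add [symmetric] by (simp add: algebra_simps)
  have e3: "exp (- (w * s)) \<le> 1" "exp (- (w * s)) \<le> exp (w * s)" using w s by auto
  have cosh: "cosh (w * s) = (exp (w * s) + exp (- (w * s))) / 2"
    and sinh: "sinh (w * s) = (exp (w * s) - exp (- (w * s))) / 2"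
    by (simp_all add: cosh_field_def sinh_field_def)
  define E where "E = exp (w * s)"
  define e where "e = exp (- (w * s))"
  have E: "E > 0" "e > 0" "e \<le> 1" "e \<le> E" using e3 by (auto simp: E_def e_def)
  have f: "f = ((1 + \<epsilon> * s) * E + (1 - \<epsilon> * s) * e) / 2"
    unfolding f_def s_def [symmetric] cosh sinh E_def [symmetric] e_def [symmetric]
    by (simp add: field_simps)
  have "q powr \<delta> / 4 * E \<le> f \<and> f \<le> q powr \<delta> * E + 1"
    using \<epsilon>
  proof
    assume \<epsilon>: "\<epsilon> = 1 \<and> \<delta> = 0"
    have "0 \<le> s * (E - e)" "(1 - s) * e \<le> (1 - s) * E" "0 \<le> s * E" "0 \<le> (1 - s) * e"
      using s E by (auto intro!: mult_left_mono)
    then have "E / 4 \<le> f" "f \<le> E" unfolding f using E \<epsilon> by (auto simp: algebra_simps)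
    moreover have "q powr \<delta> = 1" using \<epsilon> q by simp
    ultimately show ?thesis by simp
  next
    assume \<epsilon>: "\<epsilon> = -1 \<and> \<delta> = 1"
    have "(1 + s) * e \<le> 2 * 1" using s E by (intro mult_mono) auto
    moreover have "0 \<le> (1 + s) * e" using s E by simp
    moreover have "q / 2 * E \<le> (1 - s) * E" "(1 - s) * E \<le> q * E" using le1 le2 E by (auto intro!: mult_right_mono)
    moreover have "0 \<le> q * E" using q E by simp
    moreover have "q powr \<delta> = q" using \<epsilon> q by simp
    moreover have "f = ((1 - s) * E + (1 + s) * e) / 2" unfolding f using \<epsilon> by simp
    ultimately have "q powr \<delta> / 4 * E \<le> f" "f \<le> q powr \<delta> * E + 1" by (auto simp: field_simps)
    then show ?thesis ..
  qed
  then have P: "q powr \<delta> / 4 * E \<le> f" "f \<le> q powr \<delta> * E + 1" by auto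
  have "exp w * (q powr \<delta> * exp (- (w * q)) / 4) = q powr \<delta> / 4 * (exp w * exp (- (w * q)))"
    by simp
  also have "\<dots> \<le> q powr \<delta> / 4 * E"
    unfolding E_def by (intro mult_left_mono e1) auto
  also note P(1)
  finally show *: "exp w * (q powr \<delta> * exp (- (w * q)) / 4) \<le> f" .
  then show "f \<ge> 0" by (rule order_trans[rotated]) auto
  note P(2)
  also have "q powr \<delta> * E + 1 \<le> q powr \<delta> * (exp w * exp (- (w * q / 2))) + exp w * exp (- w)"
    unfolding E_def by (intro add_mono mult_left_mono e2) (auto simp: exp_minus)
  also have "\<dots> = exp w * (q powr \<delta> * exp (- (w * q / 2)) + exp (- w))"
    by (simp add: algebra_simps)
  finally show "f \<le> exp w * (q powr \<delta> * exp (- (w * q / 2)) + exp (- w))" .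
qed

text \<open>
  The exponential lives on \<open>t < 1 / w\<close>; using \<open>1 / (1 + w)\<close> instead makes the bound uniform down to
  \<open>w = 0\<close>.
\<close>

lemma laplace_power_upper:
  fixes \<beta> :: real
  assumes \<beta>: "\<beta> > 0"
  obtains C where "C > 0" and "\<And>w. w > 0 \<Longrightarrow>
    integral_over {0<..1} (\<lambda>t. t powr (\<beta> - 1) * exp (- (w * t / 2))) \<le> ennreal (C * (1 + w) powr (-\<beta>))"
proof -
  have c: "1 / 2 > (0::real)" by simp
  obtain L where L: "L > 0" "\<And>h. h > 0 \<Longrightarrow> integral_over {h..}
      (\<lambda>t. t powr (\<beta> - 1) * exp (- (1 / 2) * (t / h))) \<le> ennreal (L * h powr (\<beta> - 1 + 1))"
    using integral_power_damped_near_infinity[OF c] by blast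
  let ?F = "\<lambda>w t. t powr (\<beta> - 1) * exp (- (w * t / 2))"
  show ?thesis
  proof (rule that[of "1 / \<beta> + exp 1 * L"])
    fix w :: real assume w: "w > 0"
    define h where "h = 1 / (1 + w)"
    have h: "h > 0" and hw: "h powr \<beta> = (1 + w) powr (-\<beta>)"
      using w by (auto simp: h_def powr_divide powr_minus_divide)
    have "integral_over {0<..h} (?F w) \<le> ennreal (1 * (h powr (\<beta> - 1 + 1) / (\<beta> - 1 + 1)))"
      by (rule integral_over_upper[OF subset_refl _ _ integral_power_near_0])
         (use \<beta> w h in \<open>auto intro!: mult_left_le\<close>)
    then have 1: "integral_over {0<..h} (?F w) \<le> ennreal (1 / \<beta> * (1 + w) powr (-\<beta>))"
      by (simp add: hw)
    have "integral_over {h..1} (?F w) \<le> ennreal (exp 1 * (L * h powr (\<beta> - 1 + 1)))"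
    proof (rule integral_over_upper[OF _ _ _ L(2)[OF h]])
      fix t assume t: "t \<in> {h..1}"
      have "- (w * t / 2) \<le> 1 + - (1 / 2) * (t / h)"
        using t by (simp add: h_def field_simps)
      then have "exp (- (w * t / 2)) \<le> exp 1 * exp (- (1 / 2) * (t / h))"
        unfolding exp_add [symmetric] by simp
      then have "t powr (\<beta> - 1) * exp (- (w * t / 2)) \<le> t powr (\<beta> - 1) * (exp 1 * exp (- (1 / 2) * (t / h)))"
        by (rule mult_left_mono) simp
      then show "?F w t \<le> exp 1 * (t powr (\<beta> - 1) * exp (- (1 / 2) * (t / h)))"
        by (simp only: mult.left_commute)
    qed auto
    then have 2: "integral_over {h..1} (?F w) \<le> ennreal (exp 1 * L * (1 + w) powr (-\<beta>))"
      by (simp add: hw mult.assoc)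
    have "integral_over {0<..1} (?F w) \<le> ennreal (1 / \<beta> * (1 + w) powr (-\<beta>) + exp 1 * L * (1 + w) powr (-\<beta>))"
      by (rule integral_over_union_upper[OF _ 1 2]) (use \<beta> L in auto)
    then show "integral_over {0<..1} (?F w) \<le> ennreal ((1 / \<beta> + exp 1 * L) * (1 + w) powr (-\<beta>))"
      by (simp add: distrib_right)
  qed (use \<beta> L in \<open>auto intro!: add_pos_pos\<close>)
qed

lemma bessel_weight_upper:
  assumes "0 < q" "q \<le> 1/2"
  shows "bessel_weight \<alpha> q \<le> 2 * q powr (\<alpha> - 1/2)"
proof -
  have "(1 - q) powr (-1/2) \<le> (1/2) powr (-1/2)"
    using assms by (intro powr_mono2') auto
  also have "(1/2 :: real) powr (-1/2) \<le> (1/2) powr (-1)"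
    by (rule powr_mono') auto
  also have "(1/2 :: real) powr (-1) = 2" by (simp add: powr_minus)
  finally have "q powr (\<alpha> - 1/2) * (1 - q) powr (-1/2) \<le> q powr (\<alpha> - 1/2) * 2"
    by (rule mult_left_mono) simp
  then show ?thesis by (simp add: bessel_weight_def mult.commute)
qed

lemma bessel_weight_lower:
  assumes "0 < q" "q < 1"
  shows "q powr (\<alpha> - 1/2) \<le> bessel_weight \<alpha> q"
proof -
  have "1 powr (-1/2) \<le> (1 - q) powr (-1/2)"
    using assms by (intro powr_mono2') auto
  then have "q powr (\<alpha> - 1/2) * 1 \<le> q powr (\<alpha> - 1/2) * (1 - q) powr (-1/2)"
    by (intro mult_left_mono) auto
  then show ?thesis by (simp add: bessel_weight_def)
qed

text \<open>
  Near \<open>q = 0\<close> the integrand is of order \<open>q powr (\<alpha> - 1/2 + \<delta>) * exp (w - c w q)\<close>, whose integral has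
  order \<open>exp w * (1 + w) powr (- (\<alpha> + 1/2 + \<delta>))\<close>; the endpoint \<open>q = 1\<close> only gives an exponentially
  smaller amount.
\<close>

lemma Phi_bounds_signed:
  fixes \<alpha> \<epsilon> \<delta> :: real
  assumes \<alpha>: "\<alpha> > -1/2" and \<epsilon>: "\<epsilon> = 1 \<and> \<delta> = 0 \<or> \<epsilon> = -1 \<and> \<delta> = 1"
  obtains c C where "c > 0" "C > 0"
    and "\<And>w. w > 0 \<Longrightarrow> c * (1 + w) powr (- (\<alpha> + 1/2 + \<delta>)) \<le> exp (- w) * Phi \<alpha> (\<epsilon> * w)"
    and "\<And>w. w > 0 \<Longrightarrow> exp (- w) * Phi \<alpha> (\<epsilon> * w) \<le> C * (1 + w) powr (- (\<alpha> + 1/2 + \<delta>))"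
proof -
  define \<beta> where "\<beta> = \<alpha> + 1/2 + \<delta>"
  have \<beta>: "\<beta> > 0" using \<alpha> \<epsilon> by (auto simp: \<beta>_def)
  define f where "f w q = cosh (w * sqrt (1 - q)) + \<epsilon> * (sqrt (1 - q) * sinh (w * sqrt (1 - q)))" for w q
  have f_meas [measurable]: "f w \<in> borel_measurable borel" for w
    unfolding f_def cosh_def sinh_def by measurable
  define c0 where "c0 = bessel_const \<alpha>"
  have c0: "c0 > 0" unfolding c0_def by (rule bessel_const_pos[OF \<alpha>])
  note bounds = exp_profile_bounds[OF _ _ _ \<epsilon>, folded f_def]
  have nonneg: "bessel_weight \<alpha> q * f w q \<ge> 0" if "q \<in> {0..1}" "w > 0" for q w
  proof (cases "q = 0")
    case False
    then show ?thesis using that bounds(3)[of q w] bessel_weight_nonneg[of \<alpha> q] by simp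
  qed (simp add: bessel_weight_def)
  have hi: "((\<lambda>q. bessel_weight \<alpha> q * f w q) has_integral Phi \<alpha> (\<epsilon> * w) / c0) {0..1}" if "w > 0" for w
    unfolding f_def c0_def by (rule Phi_integral) (use \<alpha> that \<epsilon> in auto)
  have Phi0: "Phi \<alpha> (\<epsilon> * w) / c0 \<ge> 0" if "w > 0" for w
    by (rule has_integral_nonneg[OF hi]) (use nonneg that in auto)
  have I: "integral_over {0..1} (\<lambda>q. bessel_weight \<alpha> q * f w q) = ennreal (Phi \<alpha> (\<epsilon> * w) / c0)" if "w > 0" for w
    by (rule nn_integral_has_integral_lebesgue'[OF _ hi]) (use nonneg that in auto)
  obtain k where k: "k > 0" "\<And>h. h > 0 \<Longrightarrow>
      ennreal (k * h powr (\<beta> - 1 + 1)) \<le> integral_over {h..2*h} (\<lambda>t. t powr (\<beta> - 1))"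
    using integral_power_dyadic_lower by blast
  have lower: "c0 * (exp (- 1) / 4 * k * 4 powr (-\<beta>)) * (1 + w) powr (-\<beta>) \<le> exp (- w) * Phi \<alpha> (\<epsilon> * w)" if w: "w > 0" for w
  proof -
    \<comment> \<open>small enough that \<open>exp (- w q)\<close> is bounded below on \<open>[g, 2 g]\<close> and that \<open>2 g < 1\<close>\<close>
    define g where "g = 1 / (4 * (1 + w))"
    have g: "g > 0" "2 * g < 1" "w * (2 * g) \<le> 1" using w by (auto simp: g_def field_simps)
    have gw: "g powr \<beta> = 4 powr (-\<beta>) * (1 + w) powr (-\<beta>)"
      unfolding g_def powr_divide powr_mult powr_minus_divide by simp
    have "ennreal (exp w * (exp (- 1) / 4) * (k * g powr (\<beta> - 1 + 1)))
        \<le> integral_over {0..1} (\<lambda>q. bessel_weight \<alpha> q * f w q)"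
    proof (rule integral_over_lower[OF _ _ _ k(2)[OF g(1)]])
      show "{g..2 * g} \<subseteq> {0..1}" using g by auto
      fix t assume t: "t \<in> {g..2 * g}"
      then have t01: "0 < t" "t < 1" using g by auto
      have "w * t \<le> w * (2 * g)" using t w by (intro mult_left_mono) auto
      then have wt: "exp (- 1) \<le> exp (- (w * t))" using g by simp
      have "t powr (\<beta> - 1) = t powr (\<alpha> - 1/2) * t powr \<delta>"
      proof -
        have "\<beta> - 1 = (\<alpha> - 1/2) + \<delta>" by (simp add: \<beta>_def)
        then show ?thesis by (simp only: powr_add)
      qed
      then have "exp w * (exp (- 1) / 4) * t powr (\<beta> - 1)
          = t powr (\<alpha> - 1/2) * (exp w * (t powr \<delta> * exp (- 1) / 4))" by simp
      also have "\<dots> \<le> t powr (\<alpha> - 1/2) * (exp w * (t powr \<delta> * exp (- (w * t)) / 4))"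
        using wt by (intro mult_left_mono divide_right_mono) auto
      also have "\<dots> \<le> bessel_weight \<alpha> t * f w t"
        using bessel_weight_lower[of t \<alpha>] bounds(1)[of t w] t01 w bessel_weight_nonneg
        by (intro mult_mono) auto
      finally show "exp w * (exp (- 1) / 4) * t powr (\<beta> - 1) \<le> bessel_weight \<alpha> t * f w t" .
    qed auto
    then have "exp w * (exp (- 1) / 4) * (k * g powr \<beta>) \<le> Phi \<alpha> (\<epsilon> * w) / c0"
      unfolding I[OF w] using Phi0[OF w] by (simp add: ennreal_le_iff)
    then have "exp (- w) * c0 * (exp w * (exp (- 1) / 4) * (k * g powr \<beta>)) \<le> exp (- w) * c0 * (Phi \<alpha> (\<epsilon> * w) / c0)"
      using c0 by (intro mult_left_mono) auto
    moreover have "exp (- w) * c0 * (exp w * (exp (- 1) / 4) * (k * g powr \<beta>))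
        = c0 * (exp (- 1) / 4 * k * 4 powr (-\<beta>)) * (1 + w) powr (-\<beta>)"
      unfolding gw by (simp add: exp_minus)
    moreover have "exp (- w) * c0 * (Phi \<alpha> (\<epsilon> * w) / c0) = exp (- w) * Phi \<alpha> (\<epsilon> * w)"
      using c0 by simp
    ultimately show ?thesis by (simp only:)
  qed
  obtain D where D: "D > 0" "\<And>w. w > 0 \<Longrightarrow>
    integral_over {0<..1} (\<lambda>t. t powr (\<beta> - 1) * exp (- (w * t / 2))) \<le> ennreal (D * (1 + w) powr (-\<beta>))"
    using laplace_power_upper[OF \<beta>] by blast
  have "1 / 4 > (0::real)" by simp
  then obtain K where K: "K > 0" "\<And>x. x > 0 \<Longrightarrow> exp (- (1/4) * x) \<le> K * x powr (-\<beta>)"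
    using exp_le_powr \<beta> by blast
  define B where "B = Beta (\<alpha> + 1/2) (1/2)"
  have B: "integral_over {0<..1} (bessel_weight \<alpha>) \<le> ennreal B" and B0: "B \<ge> 0"
  proof -
    have m: "(bessel_weight \<alpha> has_integral B) {0..1}"
      using bessel_weight_moment[OF \<alpha>, of 0] by (simp add: B_def)
    then show "B \<ge> 0" by (rule has_integral_nonneg) (rule bessel_weight_nonneg)
    have "integral_over {0<..1} (bessel_weight \<alpha>) \<le> integral_over {0..1} (bessel_weight \<alpha>)"
      by (rule integral_over_mono) auto
    also have "\<dots> = ennreal B"
      by (rule nn_integral_has_integral_lebesgue'[OF _ m]) (rule bessel_weight_nonneg)
    finally show "integral_over {0<..1} (bessel_weight \<alpha>) \<le> ennreal B" .
  qed
  define M where "M = 2 * D + 2 * exp (1/4) * K * B"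
  have M: "M > 0" using D K B0 by (simp add: M_def add_pos_nonneg)
  have upper: "exp (- w) * Phi \<alpha> (\<epsilon> * w) \<le> c0 * M * (1 + w) powr (-\<beta>)" if w: "w > 0" for w
  proof -
    let ?F = "\<lambda>t. t powr (\<beta> - 1) * exp (- (w * t / 2))"
    have "exp (- (w / 4)) = exp (1/4) * exp (- (1/4) * (1 + w))"
      unfolding exp_add [symmetric] by (simp add: field_simps)
    also have "\<dots> \<le> exp (1/4) * (K * (1 + w) powr (-\<beta>))"
      using K(2)[of "1 + w"] w by simp
    finally have e4: "exp (- (w / 4)) \<le> exp (1/4) * K * (1 + w) powr (-\<beta>)" by simp
    have 1: "integral_over {0<..1} (\<lambda>t. exp w * 2 * ?F t) \<le> ennreal (exp w * 2 * (D * (1 + w) powr (-\<beta>)))"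
      by (rule integral_over_upper[OF subset_refl _ _ D(2)[OF w]]) auto
    have 2: "integral_over {0<..1} (\<lambda>t. exp w * (2 * exp (- (w / 4))) * bessel_weight \<alpha> t)
        \<le> ennreal (exp w * (2 * exp (- (w / 4))) * B)"
      by (rule integral_over_upper[OF subset_refl _ _ B]) auto
    have pointwise: "bessel_weight \<alpha> t * f w t \<le> exp w * 2 * ?F t + exp w * (2 * exp (- (w / 4))) * bessel_weight \<alpha> t"
      if t: "t \<in> {0<..1}" for t
    proof -
      have b: "t powr \<delta> \<le> 1" using t \<epsilon> by (auto intro: powr_le_one_le)
      have ew: "exp (- w) \<le> exp (- (w / 4))" using w by simp
      have F: "?F t = t powr (\<alpha> - 1/2) * (t powr \<delta> * exp (- (w * t / 2)))"
      proof -
        have "\<beta> - 1 = (\<alpha> - 1/2) + \<delta>" by (simp add: \<beta>_def)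
        then show ?thesis by (simp only: powr_add mult.assoc)
      qed
      \<comment> \<open>for \<open>t > 1/2\<close> the singularity of the weight at \<open>1\<close> meets a factor \<open>exp (- w / 4)\<close>\<close>
      have main: "bessel_weight \<alpha> t * (t powr \<delta> * exp (- (w * t / 2)))
          \<le> 2 * ?F t + exp (- (w / 4)) * bessel_weight \<alpha> t"
      proof (cases "t \<le> 1/2")
        case True
        have "bessel_weight \<alpha> t * (t powr \<delta> * exp (- (w * t / 2))) \<le> 2 * ?F t"
          unfolding F mult.assoc [symmetric, of 2]
          by (intro mult_right_mono bessel_weight_upper) (use True t in auto)
        then show ?thesis using bessel_weight_nonneg[of \<alpha> t] by (simp add: add_increasing2)
      next
        case False
        have "w * (1/2) \<le> w * t" using False w by (intro mult_left_mono) auto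
        then have "t powr \<delta> * exp (- (w * t / 2)) \<le> 1 * exp (- (w / 4))"
          using b by (intro mult_mono) auto
        then have "bessel_weight \<alpha> t * (t powr \<delta> * exp (- (w * t / 2))) \<le> bessel_weight \<alpha> t * exp (- (w / 4))"
          by (intro mult_left_mono bessel_weight_nonneg) simp
        also have "\<dots> = exp (- (w / 4)) * bessel_weight \<alpha> t" by (rule mult.commute)
        also have "\<dots> \<le> 2 * ?F t + exp (- (w / 4)) * bessel_weight \<alpha> t" by simp
        finally show ?thesis .
      qed
      have "bessel_weight \<alpha> t * f w t \<le> bessel_weight \<alpha> t * (exp w * (t powr \<delta> * exp (- (w * t / 2)) + exp (- w)))"
        using bounds(2)[of t w] t w by (intro mult_left_mono bessel_weight_nonneg) auto
      also have "\<dots> = exp w * (bessel_weight \<alpha> t * (t powr \<delta> * exp (- (w * t / 2))) + exp (- w) * bessel_weight \<alpha> t)"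
        by (simp add: algebra_simps)
      also have "\<dots> \<le> exp w * ((2 * ?F t + exp (- (w / 4)) * bessel_weight \<alpha> t) + exp (- (w / 4)) * bessel_weight \<alpha> t)"
        by (intro mult_left_mono add_mono main mult_right_mono ew bessel_weight_nonneg) auto
      also have "\<dots> = exp w * 2 * ?F t + exp w * (2 * exp (- (w / 4))) * bessel_weight \<alpha> t"
        by (simp add: algebra_simps)
      finally show ?thesis .
    qed
    \<comment> \<open>the weight is \<open>0\<close> at \<open>q = 0\<close> by the convention \<open>0 powr r = 0\<close>\<close>
    have "integral_over {0..1} (\<lambda>q. bessel_weight \<alpha> q * f w q) \<le> integral_over {0<..1} (\<lambda>q. bessel_weight \<alpha> q * f w q)"
    proof (rule nn_integral_mono)
      fix q :: real
      show "ennreal (bessel_weight \<alpha> q * f w q) * indicator {0..1} q \<le> ennreal (bessel_weight \<alpha> q * f w q) * indicator {0<..1} q"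
        by (cases "q = 0") (auto simp: bessel_weight_def split: split_indicator)
    qed
    also have "\<dots> \<le> ennreal (exp w * 2 * (D * (1 + w) powr (-\<beta>)) + exp w * (2 * exp (- (w / 4))) * B)"
      by (rule integral_over_add_upper[OF 1 2]) (use D B0 pointwise bessel_weight_nonneg in auto)
    also have "\<dots> \<le> ennreal (exp w * (M * (1 + w) powr (-\<beta>)))"
    proof (rule ennreal_leI)
      have "exp w * (2 * exp (- (w / 4))) * B \<le> exp w * (2 * (exp (1/4) * K * (1 + w) powr (-\<beta>))) * B"
        using B0 e4 by (intro mult_right_mono mult_left_mono) auto
      then show "exp w * 2 * (D * (1 + w) powr (-\<beta>)) + exp w * (2 * exp (- (w / 4))) * B \<le> exp w * (M * (1 + w) powr (-\<beta>))"
        unfolding M_def by (simp add: algebra_simps)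
    qed
    finally have "Phi \<alpha> (\<epsilon> * w) / c0 \<le> exp w * (M * (1 + w) powr (-\<beta>))"
      unfolding I[OF w] using M by (simp add: ennreal_le_iff)
    then have "exp (- w) * c0 * (Phi \<alpha> (\<epsilon> * w) / c0) \<le> exp (- w) * c0 * (exp w * (M * (1 + w) powr (-\<beta>)))"
      using c0 by (intro mult_left_mono) auto
    moreover have "exp (- w) * c0 * (exp w * (M * (1 + w) powr (-\<beta>))) = c0 * M * (1 + w) powr (-\<beta>)"
      by (simp add: exp_minus)
    moreover have "exp (- w) * c0 * (Phi \<alpha> (\<epsilon> * w) / c0) = exp (- w) * Phi \<alpha> (\<epsilon> * w)"
      using c0 by simp
    ultimately show ?thesis by (simp only:)
  qed
  show ?thesis
    by (rule that[of "c0 * (exp (- 1) / 4 * k * 4 powr (-\<beta>))" "c0 * M"])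
       (use lower upper c0 k M in \<open>auto simp: \<beta>_def\<close>)
qed

definition decay_order :: "real \<Rightarrow> real \<Rightarrow> real" where
  "decay_order \<alpha> u = (if u < 0 then \<alpha> + 3/2 else \<alpha> + 1/2)"

lemma Phi_bounds:
  fixes \<alpha> :: real
  assumes \<alpha>: "\<alpha> > -1/2"
  obtains c C where "c > 0" "C > 0"
    and "\<And>u. c * (1 + \<bar>u\<bar>) powr (- decay_order \<alpha> u) \<le> exp (- \<bar>u\<bar>) * Phi \<alpha> u"
    and "\<And>u. exp (- \<bar>u\<bar>) * Phi \<alpha> u \<le> C * (1 + \<bar>u\<bar>) powr (- decay_order \<alpha> u)"
proof -
  obtain c1 C1 where 1: "c1 > 0" "C1 > 0"
    "\<And>w. w > 0 \<Longrightarrow> c1 * (1 + w) powr (- (\<alpha> + 1/2 + 0)) \<le> exp (- w) * Phi \<alpha> (1 * w)"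
    "\<And>w. w > 0 \<Longrightarrow> exp (- w) * Phi \<alpha> (1 * w) \<le> C1 * (1 + w) powr (- (\<alpha> + 1/2 + 0))"
    using Phi_bounds_signed[OF \<alpha>, of 1 0] by auto
  obtain c2 C2 where 2: "c2 > 0" "C2 > 0"
    "\<And>w. w > 0 \<Longrightarrow> c2 * (1 + w) powr (- (\<alpha> + 1/2 + 1)) \<le> exp (- w) * Phi \<alpha> (- 1 * w)"
    "\<And>w. w > 0 \<Longrightarrow> exp (- w) * Phi \<alpha> (- 1 * w) \<le> C2 * (1 + w) powr (- (\<alpha> + 1/2 + 1))"
    using Phi_bounds_signed[OF \<alpha>, of "-1" 1] by auto
  define p where "p = Phi \<alpha> 0"
  have p: "p > 0" using \<alpha> by (simp add: p_def Phi_def)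
  let ?c = "min p (min c1 c2)" and ?C = "max p (max C1 C2)"
  have lower: "?c * (1 + \<bar>u\<bar>) powr (- decay_order \<alpha> u) \<le> exp (- \<bar>u\<bar>) * Phi \<alpha> u" for u
  proof -
    consider "u = 0" | "u > 0" | "u < 0" by linarith
    then show ?thesis
    proof cases
      case 1
      then show ?thesis by (simp add: p_def)
    next
      case 2
      have "?c * (1 + u) powr (- (\<alpha> + 1/2)) \<le> c1 * (1 + u) powr (- (\<alpha> + 1/2))"
        by (intro mult_right_mono) auto
      also have "\<dots> \<le> exp (- u) * Phi \<alpha> u" using 1(3)[OF 2] by simp
      finally show ?thesis using 2 by (simp add: decay_order_def)
    next
      case 3
      have "?c * (1 + (- u)) powr (- (\<alpha> + 3/2)) \<le> c2 * (1 + (- u)) powr (- (\<alpha> + 3/2))"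
        by (intro mult_right_mono) auto
      also have "\<dots> \<le> exp u * Phi \<alpha> u" using 2(3)[of "- u"] 3 by (simp add: add.assoc)
      finally show ?thesis using 3 by (simp add: decay_order_def)
    qed
  qed
  have upper: "exp (- \<bar>u\<bar>) * Phi \<alpha> u \<le> ?C * (1 + \<bar>u\<bar>) powr (- decay_order \<alpha> u)" for u
  proof -
    consider "u = 0" | "u > 0" | "u < 0" by linarith
    then show ?thesis
    proof cases
      case 1
      then show ?thesis by (simp add: p_def)
    next
      case 2
      have "exp (- u) * Phi \<alpha> u \<le> C1 * (1 + u) powr (- (\<alpha> + 1/2))" using 1(4)[OF 2] by simp
      also have "\<dots> \<le> ?C * (1 + u) powr (- (\<alpha> + 1/2))"
        by (intro mult_right_mono) auto
      finally show ?thesis using 2 by (simp add: decay_order_def)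
    next
      case 3
      have "exp u * Phi \<alpha> u \<le> C2 * (1 + (- u)) powr (- (\<alpha> + 3/2))"
        using 2(4)[of "- u"] 3 by (simp add: add.assoc)
      also have "\<dots> \<le> ?C * (1 + (- u)) powr (- (\<alpha> + 3/2))"
        by (intro mult_right_mono) auto
      finally show ?thesis using 3 by (simp add: decay_order_def)
    qed
  qed
  show ?thesis by (rule that[OF _ _ lower upper]) (use p 1 2 in auto)
qed

section \<open>The heat kernel for small and for large times\<close>

text \<open>
  With \<open>extent x y\<close>, these are \<open>\<bar>x - y\<bar>\<close> and \<open>\<bar>x + y\<bar>\<close>, in this order if \<open>x y \<ge> 0\<close> and in the other if
  \<open>x y < 0\<close>.
\<close>

abbreviation (input) gap :: "real \<Rightarrow> real \<Rightarrow> real" where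
  "gap x y \<equiv> \<bar>\<bar>x\<bar> - \<bar>y\<bar>\<bar>"

abbreviation (input) extent :: "real \<Rightarrow> real \<Rightarrow> real" where
  "extent x y \<equiv> \<bar>x\<bar> + \<bar>y\<bar>"

text \<open>
  Expressed through \<open>tanh t\<close>, the quotients \<open>cosh (2 t) / sinh (2 t)\<close> and \<open>1 / sinh (2 t)\<close> are half the
  sum and half the difference of \<open>1 / tanh t\<close> and \<open>tanh t\<close>; and \<open>x\<^sup>2 + y\<^sup>2\<close> and \<open>2 \<bar>x y\<bar>\<close> are half the sum
  and half the difference of the squares of \<open>extent x y\<close> and \<open>gap x y\<close>.
\<close>

lemma gaussian_exponent:
  fixes x y t :: real
  assumes t: "t > 0"
  shows "- (1/2) * (cosh (2 * t) / sinh (2 * t)) * (x\<^sup>2 + y\<^sup>2) =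
    - (1/4) * (tanh t * (extent x y)\<^sup>2 + (gap x y)\<^sup>2 / tanh t) - \<bar>x * y / sinh (2 * t)\<bar>"
proof -
  define s where "s = sinh t"
  define c where "c = cosh t"
  have s: "s > 0" and c: "c > 0" using t by (auto simp: s_def c_def)
  have cs: "c\<^sup>2 = 1 + s\<^sup>2" unfolding c_def s_def using cosh_square_eq[of t] by simp
  have S: "sinh (2 * t) = 2 * s * c" unfolding s_def c_def by (rule sinh_double)
  have C: "cosh (2 * t) = c\<^sup>2 + s\<^sup>2" unfolding s_def c_def by (rule cosh_double)
  have T: "tanh t = s / c" by (simp add: tanh_def s_def c_def)
  define X where "X = \<bar>x\<bar>"
  define Y where "Y = \<bar>y\<bar>"
  have u: "\<bar>x * y / sinh (2 * t)\<bar> = X * Y / (2 * s * c)"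
    unfolding S X_def Y_def using s c by (simp add: abs_mult)
  have sq: "x\<^sup>2 = X\<^sup>2" "y\<^sup>2 = Y\<^sup>2" by (simp_all add: X_def Y_def)
  have id: "(c\<^sup>2 + s\<^sup>2) * (X\<^sup>2 + Y\<^sup>2) = s\<^sup>2 * (X + Y)\<^sup>2 + c\<^sup>2 * (X - Y)\<^sup>2 + 2 * (X * Y)"
    unfolding cs by (simp add: power2_eq_square algebra_simps)
  have split: "(s\<^sup>2 * A + c\<^sup>2 * B + 2 * P) / (2 * s * c) = (s / c * A + B / (s / c)) / 2 + 2 * (P / (2 * s * c))" for A B P
    using s c by (simp add: field_simps power2_eq_square)
  have "(c\<^sup>2 + s\<^sup>2) / (2 * s * c) * (X\<^sup>2 + Y\<^sup>2)
      = (s\<^sup>2 * (X + Y)\<^sup>2 + c\<^sup>2 * (X - Y)\<^sup>2 + 2 * (X * Y)) / (2 * s * c)"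
    unfolding id [symmetric] by simp
  also have "\<dots> = (s / c * (X + Y)\<^sup>2 + (X - Y)\<^sup>2 / (s / c)) / 2 + 2 * (X * Y / (2 * s * c))"
    by (rule split)
  finally have key: "(c\<^sup>2 + s\<^sup>2) / (2 * s * c) * (X\<^sup>2 + Y\<^sup>2)
      = (s / c * (X + Y)\<^sup>2 + (X - Y)\<^sup>2 / (s / c)) / 2 + 2 * (X * Y / (2 * s * c))" .
  have halve: "- (1/2) * A = - (1/4) * B - U" if "A = B / 2 + 2 * U" for A B U :: real
    using that by linarith
  from key have "- (1/2) * ((c\<^sup>2 + s\<^sup>2) / (2 * s * c) * (X\<^sup>2 + Y\<^sup>2))
      = - (1/4) * (s / c * (X + Y)\<^sup>2 + (X - Y)\<^sup>2 / (s / c)) - X * Y / (2 * s * c)"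
    by (rule halve)
  then show ?thesis
    unfolding u unfolding C T S sq X_def [symmetric] Y_def [symmetric] power2_abs mult.assoc .
qed

lemma dunkl_heat_kernel_factorization:
  assumes "t > 0"
  shows "dunkl_heat_kernel \<alpha> t x y = 1 / 2 * sinh (2 * t) powr (-\<alpha> - 1)
     * exp (- (1/4) * (tanh t * (extent x y)\<^sup>2 + (gap x y)\<^sup>2 / tanh t))
     * (exp (- \<bar>x * y / sinh (2 * t)\<bar>) * Phi \<alpha> (x * y / sinh (2 * t)))"
proof -
  have "exp (p - q) = exp p * exp (- q)" for p q :: real
    by (simp add: exp_diff exp_minus divide_inverse)
  then show ?thesis
    unfolding dunkl_heat_kernel_def gaussian_exponent[OF assms] by (simp only: mult.assoc)
qed

lemma decay_order_heat:
  assumes "t > 0" and "\<delta> = of_bool (x * y < 0)"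
  shows "decay_order \<alpha> (x * y / sinh (2 * t)) = \<alpha> + \<delta> + 1/2"
  using assms by (auto simp: decay_order_def divide_less_0_iff)

text \<open>
  Here \<open>S\<close> stands for \<open>sinh (2 t)\<close>. An opposite sign of \<open>x\<close> and \<open>y\<close> (\<open>\<delta> = 1\<close>) costs a power of
  \<open>S + p\<close> and gains one of \<open>S\<close>: in the profile this is the shift of both parameters by one.
\<close>

lemma weight_identity:
  fixes S p \<alpha> \<delta> :: real
  assumes "S > 0" "p \<ge> 0"
  shows "S powr (-\<alpha> - 1) * (1 + p / S) powr (- (\<alpha> + \<delta> + 1/2)) = S powr (\<delta> - 1/2) * (S + p) powr (- (\<alpha> + \<delta>) - 1/2)"
proof -
  have "1 + p / S = (S + p) / S" using assms by (simp add: field_simps)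
  then have "(1 + p / S) powr (- g) = (S + p) powr (- g) * S powr g" for g
    by (simp add: powr_divide powr_minus_divide)
  then have "S powr (-\<alpha> - 1) * (1 + p / S) powr (- (\<alpha> + \<delta> + 1/2))
      = (S powr (-\<alpha> - 1) * S powr (\<alpha> + \<delta> + 1/2)) * (S + p) powr (- (\<alpha> + \<delta> + 1/2))"
    by (simp only: mult_ac)
  also have "S powr (-\<alpha> - 1) * S powr (\<alpha> + \<delta> + 1/2) = S powr (\<delta> - 1/2)"
    unfolding powr_add [symmetric] by simp
  finally have "S powr (-\<alpha> - 1) * (1 + p / S) powr (- (\<alpha> + \<delta> + 1/2))
      = S powr (\<delta> - 1/2) * (S + p) powr (- (\<alpha> + \<delta> + 1/2))" .
  moreover have "- (\<alpha> + \<delta>) - 1/2 = - (\<alpha> + \<delta> + 1/2)" by simp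
  ultimately show ?thesis by (simp only:)
qed

text \<open>
  For bounded \<open>t\<close> both functions may be replaced by \<open>t\<close>.
\<close>

lemma sinh_tanh_comparison:
  fixes t :: real
  assumes "0 < t" "t \<le> 2"
  shows "2 * t \<le> sinh (2 * t)" "sinh (2 * t) \<le> 2 * cosh 4 * t" "t / cosh 2 \<le> tanh t" "tanh t \<le> t"
proof -
  have ge: "v \<le> sinh v" and le: "sinh v \<le> v * cosh v" if "v > 0" for v :: real
  proof -
    have "\<exists>z>0. z < v \<and> sinh v - sinh 0 = (v - 0) * cosh z"
      by (rule MVT2) (use that in \<open>auto intro!: derivative_eq_intros\<close>)
    then obtain z where z: "0 < z" "z < v" "sinh v = v * cosh z" by auto
    have "v * 1 \<le> v * cosh z" using that by (intro mult_left_mono cosh_real_ge_1) auto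
    then show "v \<le> sinh v" using z by simp
    have "cosh z \<le> cosh v" using z by (simp add: cosh_real_nonneg_le_iff)
    then show "sinh v \<le> v * cosh v" using z that by simp
  qed
  show "2 * t \<le> sinh (2 * t)" using assms by (intro ge) auto
  have "sinh (2 * t) \<le> (2 * t) * cosh (2 * t)" using assms by (intro le) auto
  also have "\<dots> \<le> (2 * t) * cosh 4" using assms by (intro mult_left_mono) (auto simp: cosh_real_nonneg_le_iff)
  finally show "sinh (2 * t) \<le> 2 * cosh 4 * t" by (simp only: mult_ac)
  have "t / cosh 2 \<le> t / cosh t"
    using assms by (intro divide_left_mono) (auto simp: cosh_real_nonneg_le_iff)
  also have "\<dots> \<le> sinh t / cosh t" using ge assms by (intro divide_right_mono) auto
  finally show "t / cosh 2 \<le> tanh t" by (simp add: tanh_def)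
  have "sinh t / cosh t \<le> t" using le[of t] assms by (simp add: divide_le_eq)
  then show "tanh t \<le> t" by (simp add: tanh_def)
qed

lemma powr_comparable:
  fixes s m M :: real
  assumes "0 < m" "m \<le> M"
  obtains k K where "k > 0" "K > 0"
    and "\<And>t S. 0 < t \<Longrightarrow> m * t \<le> S \<Longrightarrow> S \<le> M * t \<Longrightarrow> k * t powr s \<le> S powr s"
    and "\<And>t S. 0 < t \<Longrightarrow> m * t \<le> S \<Longrightarrow> S \<le> M * t \<Longrightarrow> S powr s \<le> K * t powr s"
proof (cases "s \<ge> 0")
  case True
  show ?thesis
  proof (rule that[of "m powr s" "M powr s"])
    fix t S :: real assume *: "0 < t" "m * t \<le> S" "S \<le> M * t"
    have "0 < m * t" using * assms by simp
    then show "m powr s * t powr s \<le> S powr s" "S powr s \<le> M powr s * t powr s"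
      unfolding powr_mult [symmetric] using * True by (auto intro!: powr_mono2)
  qed (use assms in auto)
next
  case False
  show ?thesis
  proof (rule that[of "M powr s" "m powr s"])
    fix t S :: real assume *: "0 < t" "m * t \<le> S" "S \<le> M * t"
    have "0 < m * t" using * assms by simp
    then show "M powr s * t powr s \<le> S powr s" "S powr s \<le> m powr s * t powr s"
      unfolding powr_mult [symmetric] using * False by (auto intro!: powr_mono2')
  qed (use assms in auto)
qed

text \<open>
  With \<open>a = gap x y\<close> and \<open>b = extent x y\<close>, the one delicate point is that \<open>\<bar>x y\<bar> = (b\<^sup>2 - a\<^sup>2) / 4\<close> may be
  replaced by \<open>b\<^sup>2\<close> inside the power. For the lower bound it suffices that it is at most \<open>b\<^sup>2\<close>. For the
  upper bound the loss is at most a power of \<open>1 + a\<^sup>2 / t\<close>, and a part of \<open>exp (- a\<^sup>2 / (4 t))\<close> pays for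
  it.
\<close>

lemma heat_kernel_small_time:
  fixes \<alpha> \<sigma> \<delta> :: real
  assumes \<alpha>: "\<alpha> > -1/2" and \<delta>: "\<delta> \<ge> 0"
  obtains c1 C1 c2 C2 where "c1 > 0" "C1 > 0" "c2 > 0" "C2 > 0"
    and "\<And>x y t. \<delta> = of_bool (x * y < 0) \<Longrightarrow> 0 < t \<Longrightarrow> t \<le> 2 \<Longrightarrow>
        C1 * heat_profile (\<alpha> + \<delta>) (\<sigma> + \<delta>) c1 (gap x y) (extent x y) t
          \<le> dunkl_heat_kernel \<alpha> t x y * t powr (\<sigma> - 1)"
    and "\<And>x y t. \<delta> = of_bool (x * y < 0) \<Longrightarrow> 0 < t \<Longrightarrow> t \<le> 2 \<Longrightarrow>
        dunkl_heat_kernel \<alpha> t x y * t powr (\<sigma> - 1)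
          \<le> C2 * heat_profile (\<alpha> + \<delta>) (\<sigma> + \<delta>) c2 (gap x y) (extent x y) t"
proof -
  define \<gamma> where "\<gamma> = \<alpha> + \<delta> + 1/2"
  have \<gamma>: "\<gamma> > 0" using \<alpha> \<delta> by (simp add: \<gamma>_def)
  define M :: real where "M = 2 * cosh 4"
  have M: "M \<ge> 2" using cosh_real_ge_1[of 4] by (simp add: M_def)
  obtain p P where P: "p > 0" "P > 0"
    "\<And>u. p * (1 + \<bar>u\<bar>) powr (- decay_order \<alpha> u) \<le> exp (- \<bar>u\<bar>) * Phi \<alpha> u"
    "\<And>u. exp (- \<bar>u\<bar>) * Phi \<alpha> u \<le> P * (1 + \<bar>u\<bar>) powr (- decay_order \<alpha> u)"
    using Phi_bounds[OF \<alpha>] by blast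
  obtain k K where K: "k > 0" "K > 0"
    "\<And>t S. 0 < t \<Longrightarrow> 2 * t \<le> S \<Longrightarrow> S \<le> M * t \<Longrightarrow> k * t powr (\<delta> - 1/2) \<le> S powr (\<delta> - 1/2)"
    "\<And>t S. 0 < t \<Longrightarrow> 2 * t \<le> S \<Longrightarrow> S \<le> M * t \<Longrightarrow> S powr (\<delta> - 1/2) \<le> K * t powr (\<delta> - 1/2)"
    using powr_comparable[of 2 M "\<delta> - 1/2"] M by auto
  have "1 / 8 > (0::real)" by simp
  then obtain L where L: "L > 0" "\<And>x. x > 0 \<Longrightarrow> exp (- (1/8) * x) \<le> L * x powr (- \<gamma>)"
    using exp_le_powr \<gamma> by blast
  define c1 :: real where "c1 = cosh 2 / 4"
  \<comment> \<open>\<open>1/8\<close> is half of the \<open>1/4\<close> in front of \<open>a\<^sup>2 / tanh t\<close>; the other half pays for \<open>(1 + a\<^sup>2 / t) powr \<gamma>\<close>\<close>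
  define c2 :: real where "c2 = min (1 / (4 * cosh 2)) (1/8)"
  have c: "c1 > 0" "c2 > 0" "c1 \<ge> 1/4" using cosh_real_ge_1[of 2] by (auto simp: c1_def c2_def)
  define C1 where "C1 = p / 2 * k * M powr (-\<gamma>)"
  define C2 where "C2 = P / 2 * K * (4 powr \<gamma> * (L * exp (1/8)))"
  define W where "W b t = t powr (\<delta> - 1/2) * (t + b\<^sup>2) powr (- \<gamma>)" for b t :: real
  have profile: "heat_profile (\<alpha> + \<delta>) (\<sigma> + \<delta>) c a b t = W b t * exp (- c * (t * b\<^sup>2 + a\<^sup>2 / t)) * t powr (\<sigma> - 1)" for c a b t
  proof -
    have "\<sigma> + \<delta> - 3/2 = (\<sigma> - 1) + (\<delta> - 1/2)" by simp
    then have "t powr (\<sigma> + \<delta> - 3/2) = t powr (\<sigma> - 1) * t powr (\<delta> - 1/2)" by (simp only: powr_add)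
    moreover have "- (\<alpha> + \<delta>) - 1/2 = - \<gamma>" by (simp add: \<gamma>_def)
    ultimately show ?thesis unfolding heat_profile_def W_def by (simp only: mult_ac)
  qed
  have main: "C1 * (W b t * exp (- c1 * (t * b\<^sup>2 + a\<^sup>2 / t))) \<le> dunkl_heat_kernel \<alpha> t x y"
    "dunkl_heat_kernel \<alpha> t x y \<le> C2 * (W b t * exp (- c2 * (t * b\<^sup>2 + a\<^sup>2 / t)))"
    if xy: "\<delta> = of_bool (x * y < 0)" and t: "0 < t" "t \<le> 2"
      and a: "a = (gap x y)" and b: "b = \<bar>x\<bar> + \<bar>y\<bar>" for x y t a b
  proof -
    define S where "S = sinh (2 * t)"
    define T where "T = tanh t"
    define u where "u = x * y / S"
    define r where "r = \<bar>x * y\<bar>"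
    have S: "2 * t \<le> S" "S \<le> M * t" "S > 0"
      using sinh_tanh_comparison[OF t] t by (auto simp: S_def M_def)
    have T: "t / cosh 2 \<le> T" "T \<le> t" "T > 0"
      using sinh_tanh_comparison[OF t] t by (auto simp: T_def)
    have r: "r \<ge> 0" "4 * r = b\<^sup>2 - a\<^sup>2"
      unfolding a b r_def by (auto simp: power2_eq_square abs_mult algebra_simps)
    have u: "\<bar>u\<bar> = r / S" using S by (simp add: u_def r_def)
    have G: "dunkl_heat_kernel \<alpha> t x y = 1 / 2 * S powr (-\<alpha> - 1) * exp (- (1/4) * (T * b\<^sup>2 + a\<^sup>2 / T))
        * (exp (- \<bar>u\<bar>) * Phi \<alpha> u)"
      unfolding dunkl_heat_kernel_factorization[OF t(1)] a b u_def S_def T_def ..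
    have order: "decay_order \<alpha> u = \<gamma>"
      unfolding u_def S_def \<gamma>_def by (rule decay_order_heat[OF t(1) xy])
    have weight: "S powr (-\<alpha> - 1) * (1 + \<bar>u\<bar>) powr (- \<gamma>) = S powr (\<delta> - 1/2) * (S + r) powr (- \<gamma>)"
      using weight_identity[OF S(3) r(1), of \<alpha> \<delta>] unfolding u \<gamma>_def by (simp add: algebra_simps)
    have tT: "a\<^sup>2 / t \<le> a\<^sup>2 / T" "a\<^sup>2 / T \<le> cosh 2 * (a\<^sup>2 / t)"
    proof -
      show "a\<^sup>2 / t \<le> a\<^sup>2 / T" using T t by (intro divide_left_mono) auto
      have "a\<^sup>2 / T \<le> a\<^sup>2 / (t / cosh 2)" using T t by (intro divide_left_mono) auto
      then show "a\<^sup>2 / T \<le> cosh 2 * (a\<^sup>2 / t)" by (simp add: mult.commute)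
    qed
    have Tb: "t / cosh 2 * b\<^sup>2 \<le> T * b\<^sup>2" "T * b\<^sup>2 \<le> t * b\<^sup>2"
      by (rule mult_right_mono[OF T(1)], simp, rule mult_right_mono[OF T(2)], simp)
    have tb0: "t * b\<^sup>2 \<ge> 0" "a\<^sup>2 / t \<ge> 0" using t by auto

    show "C1 * (W b t * exp (- c1 * (t * b\<^sup>2 + a\<^sup>2 / t))) \<le> dunkl_heat_kernel \<alpha> t x y"
    proof -
      have "S + r \<le> M * (t + b\<^sup>2)"
      proof -
        have "r \<le> b\<^sup>2" using r(2) zero_le_power2[of a] zero_le_power2[of b] by linarith
        also have "\<dots> \<le> M * b\<^sup>2" using mult_right_mono[of 1 M "b\<^sup>2"] M by simp
        finally show ?thesis using S(2) by (simp add: distrib_left)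
      qed
      then have "(M * (t + b\<^sup>2)) powr (- \<gamma>) \<le> (S + r) powr (- \<gamma>)"
        using S r \<gamma> by (intro powr_mono2') auto
      then have 1: "M powr (- \<gamma>) * (t + b\<^sup>2) powr (- \<gamma>) \<le> (S + r) powr (- \<gamma>)"
        by (simp only: powr_mult)
      have "T * b\<^sup>2 + a\<^sup>2 / T \<le> cosh 2 * (t * b\<^sup>2) + cosh 2 * (a\<^sup>2 / t)"
        using Tb tT mult_right_mono[OF cosh_real_ge_1[of 2] tb0(1)] by linarith
      then have 2: "exp (- c1 * (t * b\<^sup>2 + a\<^sup>2 / t)) \<le> exp (- (1/4) * (T * b\<^sup>2 + a\<^sup>2 / T))"
        by (simp add: c1_def distrib_left)
      have "C1 * (W b t * exp (- c1 * (t * b\<^sup>2 + a\<^sup>2 / t)))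
          = 1 / 2 * p * (k * t powr (\<delta> - 1/2)) * (M powr (- \<gamma>) * (t + b\<^sup>2) powr (- \<gamma>)) * exp (- c1 * (t * b\<^sup>2 + a\<^sup>2 / t))"
        unfolding C1_def W_def by simp
      also have "\<dots> \<le> 1 / 2 * p * S powr (\<delta> - 1/2) * (S + r) powr (- \<gamma>) * exp (- (1/4) * (T * b\<^sup>2 + a\<^sup>2 / T))"
        using K(3)[OF t(1) S(1,2)] 1 2 P(1) K(1) by (intro mult_mono mult_left_mono) auto
      also have "\<dots> = 1 / 2 * p * (S powr (\<delta> - 1/2) * (S + r) powr (- \<gamma>)) * exp (- (1/4) * (T * b\<^sup>2 + a\<^sup>2 / T))"
        by simp
      also have "\<dots> = 1 / 2 * S powr (-\<alpha> - 1) * exp (- (1/4) * (T * b\<^sup>2 + a\<^sup>2 / T)) * (p * (1 + \<bar>u\<bar>) powr (- \<gamma>))"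
        unfolding weight [symmetric] by simp
      also have "\<dots> \<le> dunkl_heat_kernel \<alpha> t x y"
        unfolding G using P(3)[of u] unfolding order by (intro mult_left_mono) auto
      finally show ?thesis .
    qed

    show "dunkl_heat_kernel \<alpha> t x y \<le> C2 * (W b t * exp (- c2 * (t * b\<^sup>2 + a\<^sup>2 / t)))"
    proof -
      define z where "z = a\<^sup>2 / t"
      have z: "z \<ge> 0" using t by (simp add: z_def)
      \<comment> \<open>from \<open>4 r = b\<^sup>2 - a\<^sup>2\<close> and \<open>a\<^sup>2 = t z \<le> (S + r) z\<close>\<close>
      have "t + b\<^sup>2 \<le> (S + r) * (4 * (1 + z))"
      proof -
        have "4 * a\<^sup>2 = 4 * t * z" using t by (simp add: z_def)
        also have "\<dots> \<le> 4 * (S + r) * z" using S r t z by (intro mult_right_mono) auto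
        finally have "4 * a\<^sup>2 \<le> 4 * (S + r) * z" .
        moreover have "(S + r) * (4 * (1 + z)) = 4 * S + 4 * r + 4 * (S + r) * z"
          by (simp add: algebra_simps)
        ultimately show ?thesis using r(2) S t zero_le_power2[of a] by linarith
      qed
      then have "((S + r) * (4 * (1 + z))) powr (- \<gamma>) \<le> (t + b\<^sup>2) powr (- \<gamma>)"
        using t \<gamma> by (intro powr_mono2') (auto intro: add_pos_nonneg)
      then have "(S + r) powr (- \<gamma>) * (4 * (1 + z)) powr (- \<gamma>) \<le> (t + b\<^sup>2) powr (- \<gamma>)"
        by (simp only: powr_mult)
      then have "(4 * (1 + z)) powr \<gamma> * ((S + r) powr (- \<gamma>) * (4 * (1 + z)) powr (- \<gamma>))
          \<le> (4 * (1 + z)) powr \<gamma> * (t + b\<^sup>2) powr (- \<gamma>)"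
        by (rule mult_left_mono) simp
      moreover have "(4 * (1 + z)) powr \<gamma> * (4 * (1 + z)) powr (- \<gamma>) = 1"
        using z unfolding powr_add [symmetric] by simp
      ultimately have "(S + r) powr (- \<gamma>) \<le> (4 * (1 + z)) powr \<gamma> * (t + b\<^sup>2) powr (- \<gamma>)"
        by (simp only: mult.left_commute mult_1_right)
      also have "(4 * (1 + z)) powr \<gamma> \<le> 4 powr \<gamma> * (L * exp (1/8) * exp (z / 8))"
      proof -
        have "exp (- (1/8) * (1 + z)) \<le> L * (1 + z) powr (- \<gamma>)" using z by (intro L(2)) simp
        then have "(1 + z) powr \<gamma> \<le> L * exp ((1 + z) / 8)"
          using z by (simp add: powr_minus exp_minus field_simps)
        also have "exp ((1 + z) / 8) = exp (1/8) * exp (z / 8)"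
          unfolding exp_add [symmetric] by (simp add: add_divide_distrib)
        finally have "(1 + z) powr \<gamma> \<le> L * exp (1/8) * exp (z / 8)" by simp
        then have "4 powr \<gamma> * (1 + z) powr \<gamma> \<le> 4 powr \<gamma> * (L * exp (1/8) * exp (z / 8))"
          by (rule mult_left_mono) simp
        then show ?thesis by (simp only: powr_mult)
      qed
      finally have 1: "(S + r) powr (- \<gamma>) \<le> 4 powr \<gamma> * (L * exp (1/8) * exp (z / 8)) * (t + b\<^sup>2) powr (- \<gamma>)"
        by (simp add: mult_right_mono)
      have 2: "exp (z / 8) * exp (- (1/4) * (T * b\<^sup>2 + a\<^sup>2 / T)) \<le> exp (- c2 * (t * b\<^sup>2 + a\<^sup>2 / t))"
      proof -
        have c2_le: "c2 \<le> 1 / (4 * cosh 2)" "c2 \<le> 1/8" by (auto simp: c2_def)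
        have cz: "c2 * z \<le> 1/8 * z" by (rule mult_right_mono[OF c2_le(2) z])
        have "c2 * (t * b\<^sup>2) \<le> 1 / (4 * cosh 2) * (t * b\<^sup>2)"
          by (rule mult_right_mono[OF c2_le(1) tb0(1)])
        moreover have "1 / (4 * cosh 2) * (t * b\<^sup>2) = 1/4 * (t / cosh 2 * b\<^sup>2)" by simp
        ultimately have cQ: "c2 * (t * b\<^sup>2) \<le> 1/4 * (t / cosh 2 * b\<^sup>2)" by simp
        have "z / 8 + - (1/4) * (A + A') \<le> - c2 * (B + z)"
          if "c2 * B \<le> 1/4 * Q" "c2 * z \<le> 1/8 * z" "Q \<le> A" "z \<le> A'" for A A' B Q :: real
          using that by (simp add: algebra_simps)
        from this[OF cQ cz Tb(1) tT(1)[folded z_def]] show ?thesis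
          unfolding exp_add [symmetric] z_def exp_le_cancel_iff .
      qed
      have "dunkl_heat_kernel \<alpha> t x y
          \<le> 1 / 2 * S powr (-\<alpha> - 1) * exp (- (1/4) * (T * b\<^sup>2 + a\<^sup>2 / T)) * (P * (1 + \<bar>u\<bar>) powr (- \<gamma>))"
        unfolding G using P(4)[of u] unfolding order by (intro mult_left_mono) auto
      also have "\<dots> = 1 / 2 * P * (S powr (-\<alpha> - 1) * (1 + \<bar>u\<bar>) powr (- \<gamma>)) * exp (- (1/4) * (T * b\<^sup>2 + a\<^sup>2 / T))"
        by simp
      also have "\<dots> = 1 / 2 * P * S powr (\<delta> - 1/2) * (S + r) powr (- \<gamma>) * exp (- (1/4) * (T * b\<^sup>2 + a\<^sup>2 / T))"
        unfolding weight by simp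
      also have "\<dots> \<le> 1 / 2 * P * (K * t powr (\<delta> - 1/2))
          * (4 powr \<gamma> * (L * exp (1/8) * exp (z / 8)) * (t + b\<^sup>2) powr (- \<gamma>)) * exp (- (1/4) * (T * b\<^sup>2 + a\<^sup>2 / T))"
        using K(4)[OF t(1) S(1,2)] 1 P(2) K(2) L(1) by (intro mult_mono mult_left_mono) auto
      also have "\<dots> = C2 * W b t * (exp (z / 8) * exp (- (1/4) * (T * b\<^sup>2 + a\<^sup>2 / T)))"
        unfolding C2_def W_def by simp
      also have "\<dots> \<le> C2 * W b t * exp (- c2 * (t * b\<^sup>2 + a\<^sup>2 / t))"
        using P(2) K(2) L(1) by (intro mult_left_mono 2) (auto simp: C2_def W_def)
      finally show ?thesis by simp
    qed
  qed
  show ?thesis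
  proof (rule that[of c1 C1 c2 C2])
    fix x y t :: real assume *: "\<delta> = of_bool (x * y < 0)" "0 < t" "t \<le> 2"
    show "C1 * heat_profile (\<alpha> + \<delta>) (\<sigma> + \<delta>) c1 (gap x y) (extent x y) t
          \<le> dunkl_heat_kernel \<alpha> t x y * t powr (\<sigma> - 1)"
      unfolding profile mult.assoc [symmetric]
      by (intro mult_right_mono main(1)[OF * refl refl, unfolded mult.assoc [symmetric]]) simp
    show "dunkl_heat_kernel \<alpha> t x y * t powr (\<sigma> - 1)
          \<le> C2 * heat_profile (\<alpha> + \<delta>) (\<sigma> + \<delta>) c2 (gap x y) (extent x y) t"
      unfolding profile mult.assoc [symmetric]
      by (intro mult_right_mono main(2)[OF * refl refl, unfolded mult.assoc [symmetric]]) simp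
  qed (use c P K L M in \<open>auto simp: C1_def C2_def\<close>)
qed

text \<open>
  For \<open>t \<ge> 2\<close> one has \<open>tanh t \<ge> tanh 2\<close>, and \<open>sinh (2 t) powr (- \<alpha> - 1)\<close> decays at least like \<open>exp (- t)\<close>
  because \<open>2 (\<alpha> + 1) \<ge> 1\<close>.
\<close>

lemma heat_kernel_large_time:
  fixes \<alpha> :: real
  assumes \<alpha>: "\<alpha> > -1/2"
  obtains C where "C > 0"
    and "\<And>x y t. 2 \<le> t \<Longrightarrow>
        dunkl_heat_kernel \<alpha> t x y \<le> C * exp (- t) * exp (- (tanh 2 / 4) * (extent x y)\<^sup>2)"
proof -
  obtain p P where P: "p > 0" "P > 0"
    "\<And>u. p * (1 + \<bar>u\<bar>) powr (- decay_order \<alpha> u) \<le> exp (- \<bar>u\<bar>) * Phi \<alpha> u"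
    "\<And>u. exp (- \<bar>u\<bar>) * Phi \<alpha> u \<le> P * (1 + \<bar>u\<bar>) powr (- decay_order \<alpha> u)"
    using Phi_bounds[OF \<alpha>] by blast
  show ?thesis
  proof (rule that[of "1 / 2 * 4 powr (\<alpha> + 1) * P"])
    fix x y t :: real assume t: "2 \<le> t"
    define S where "S = sinh (2 * t)"
    define T where "T = tanh t"
    define u where "u = x * y / S"
    define b where "b = \<bar>x\<bar> + \<bar>y\<bar>"
    have T: "tanh 2 \<le> T" unfolding T_def using t by simp
    have "exp (- (2 * t)) \<le> exp (2 * t) / 2"
    proof -
      have "exp (- (2 * t)) \<le> 1" using t by simp
      moreover have "1 + 2 * t \<le> exp (2 * t)" by (rule exp_ge_add_one_self)
      ultimately show ?thesis using t by linarith
    qed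
    then have S: "exp (2 * t) / 4 \<le> S" unfolding S_def sinh_field_def by simp
    have "S powr (-\<alpha> - 1) \<le> (exp (2 * t) / 4) powr (-\<alpha> - 1)"
      using S \<alpha> by (intro powr_mono2') auto
    also have "\<dots> = 4 powr (\<alpha> + 1) * exp (2 * t * (-\<alpha> - 1))"
    proof -
      have "-\<alpha> - 1 = - (\<alpha> + 1)" by simp
      then show ?thesis by (simp only: powr_divide exp_powr_real powr_minus_divide[of 4]) simp
    qed
    also have "\<dots> \<le> 4 powr (\<alpha> + 1) * exp (- t)"
    proof -
      have "t * 1 \<le> t * (2 * (\<alpha> + 1))" using t \<alpha> by (intro mult_left_mono) auto
      then show ?thesis by (simp add: algebra_simps)
    qed
    finally have 1: "S powr (-\<alpha> - 1) \<le> 4 powr (\<alpha> + 1) * exp (- t)" .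
    have "tanh 2 * b\<^sup>2 \<le> T * b\<^sup>2 + (gap x y)\<^sup>2 / T"
      using mult_right_mono[OF T zero_le_power2[of b]] t by (simp add: T_def add_increasing2)
    then have 2: "exp (- (1/4) * (T * b\<^sup>2 + (gap x y)\<^sup>2 / T)) \<le> exp (- (tanh 2 / 4) * b\<^sup>2)"
      by simp
    have "decay_order \<alpha> u \<ge> 0" using \<alpha> by (simp add: decay_order_def)
    then have "(1 + \<bar>u\<bar>) powr (- decay_order \<alpha> u) \<le> 1"
      using powr_mono2'[of "- decay_order \<alpha> u" 1 "1 + \<bar>u\<bar>"] by simp
    then have "P * (1 + \<bar>u\<bar>) powr (- decay_order \<alpha> u) \<le> P * 1"
      using P by (intro mult_left_mono) auto
    then have 3: "exp (- \<bar>u\<bar>) * Phi \<alpha> u \<le> P" using P(4)[of u] by linarith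
    have 4: "0 \<le> exp (- \<bar>u\<bar>) * Phi \<alpha> u" by (rule order_trans[OF _ P(3)]) (use P(1) in auto)
    have "dunkl_heat_kernel \<alpha> t x y = 1 / 2 * S powr (-\<alpha> - 1)
        * exp (- (1/4) * (T * b\<^sup>2 + (gap x y)\<^sup>2 / T)) * (exp (- \<bar>u\<bar>) * Phi \<alpha> u)"
      unfolding S_def T_def b_def u_def by (rule dunkl_heat_kernel_factorization) (use t in simp)
    also have "\<dots> \<le> 1 / 2 * (4 powr (\<alpha> + 1) * exp (- t)) * exp (- (tanh 2 / 4) * b\<^sup>2) * P"
      using 1 2 3 4 by (intro mult_mono mult_left_mono) auto
    finally show "dunkl_heat_kernel \<alpha> t x y
        \<le> 1 / 2 * 4 powr (\<alpha> + 1) * P * exp (- t) * exp (- (tanh 2 / 4) * (extent x y)\<^sup>2)"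
      unfolding b_def by (simp add: mult_ac)
  qed (use P in auto)
qed

section \<open>The potential kernel\<close>

text \<open>
  Times \<open>t > 2\<close> are dropped for the lower bound; for the upper one they contribute the last summand.
\<close>

lemma potential_kernel_bounds:
  fixes \<alpha> \<sigma> \<delta> :: real
  assumes \<alpha>: "\<alpha> > -1/2" and \<sigma>: "\<sigma> > 0" and \<delta>: "\<delta> \<ge> 0"
  obtains c1 C1 c2 C2 d where "c1 > 0" "C1 > 0" "c2 > 0" "C2 > 0" "d > 0"
    and "\<And>x y. \<delta> = of_bool (x * y < 0) \<Longrightarrow>
        ennreal C1 * profile_integral (\<alpha> + \<delta>) (\<sigma> + \<delta>) c1 (gap x y) (extent x y)
          \<le> dunkl_potential_kernel \<alpha> \<sigma> x y"
    and "\<And>x y. \<delta> = of_bool (x * y < 0) \<Longrightarrow>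
        dunkl_potential_kernel \<alpha> \<sigma> x y
          \<le> ennreal C2 * (profile_integral (\<alpha> + \<delta>) (\<sigma> + \<delta>) c2 (gap x y) (extent x y)
              + ennreal (exp (- d * (extent x y)\<^sup>2)))"
proof -
  obtain c1 C1 c2 C2 where small: "c1 > 0" "C1 > 0" "c2 > 0" "C2 > 0"
    "\<And>x y t. \<delta> = of_bool (x * y < 0) \<Longrightarrow> 0 < t \<Longrightarrow> t \<le> 2 \<Longrightarrow>
        C1 * heat_profile (\<alpha> + \<delta>) (\<sigma> + \<delta>) c1 (gap x y) (extent x y) t
          \<le> dunkl_heat_kernel \<alpha> t x y * t powr (\<sigma> - 1)"
    "\<And>x y t. \<delta> = of_bool (x * y < 0) \<Longrightarrow> 0 < t \<Longrightarrow> t \<le> 2 \<Longrightarrow>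
        dunkl_heat_kernel \<alpha> t x y * t powr (\<sigma> - 1)
          \<le> C2 * heat_profile (\<alpha> + \<delta>) (\<sigma> + \<delta>) c2 (gap x y) (extent x y) t"
    using heat_kernel_small_time[OF \<alpha> \<delta>, of \<sigma>] by blast
  obtain C3 where large: "C3 > 0" "\<And>x y t. 2 \<le> t \<Longrightarrow>
        dunkl_heat_kernel \<alpha> t x y \<le> C3 * exp (- t) * exp (- (tanh 2 / 4) * (extent x y)\<^sup>2)"
    using heat_kernel_large_time[OF \<alpha>] by blast
  have two: "2 > (0::real)" by simp
  obtain L where L: "L > 0" "\<And>h. h > 0 \<Longrightarrow> integral_over {h..}
      (\<lambda>t. t powr (\<sigma> - 1) * exp (- 2 * (t / h))) \<le> ennreal (L * h powr (\<sigma> - 1 + 1))"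
    using integral_power_damped_near_infinity[OF two] by blast
  define g where "g = 1 / Gamma \<sigma>"
  have g: "g > 0" using \<sigma> by (simp add: g_def)
  define d :: real where "d = tanh 2 / 4"
  define D where "D = C3 * (L * 2 powr \<sigma>)"
  have D: "D > 0" using large L by (simp add: D_def)
  show ?thesis
  proof (rule that[of c1 "g * C1" c2 "g * (C2 + D)" d])
    fix x y :: real assume xy: "\<delta> = of_bool (x * y < 0)"
    define a where "a = (gap x y)"
    define b where "b = \<bar>x\<bar> + \<bar>y\<bar>"
    define H where "H t = dunkl_heat_kernel \<alpha> t x y * t powr (\<sigma> - 1)" for t
    let ?P = "\<lambda>c. heat_profile (\<alpha> + \<delta>) (\<sigma> + \<delta>) c a b"
    have K: "dunkl_potential_kernel \<alpha> \<sigma> x y = ennreal g * integral_over {0<..} H"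
      unfolding dunkl_potential_kernel_def g_def H_def ..
    note small = small(1-4) small(5,6)[OF xy, folded H_def a_def b_def]
    have "ennreal C1 * integral_over {0<..2} (?P c1) = integral_over {0<..2} (\<lambda>t. C1 * ?P c1 t)"
      using small(2) by (intro integral_over_cmult [symmetric]) auto
    also have "\<dots> \<le> integral_over {0<..} H"
      by (rule integral_over_mono) (use small(5) in auto)
    finally have "ennreal g * (ennreal C1 * integral_over {0<..2} (?P c1)) \<le> dunkl_potential_kernel \<alpha> \<sigma> x y"
      unfolding K by (rule mult_left_mono) simp
    then show "ennreal (g * C1) * profile_integral (\<alpha> + \<delta>) (\<sigma> + \<delta>) c1 (gap x y) (extent x y)
          \<le> dunkl_potential_kernel \<alpha> \<sigma> x y"
      using g small(2) unfolding a_def [symmetric] b_def [symmetric] by (simp add: ennreal_mult mult.assoc)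
    let ?E = "exp (- d * b\<^sup>2)"
    let ?R = "\<lambda>t. t powr (\<sigma> - 1) * exp (- 2 * (t / 2))"
    have "integral_over {0<..} H \<le> (\<integral>\<^sup>+ t. ennreal (C2 * ?P c2 t) * indicator {0<..2} t
        + ennreal (C3 * ?E * ?R t) * indicator {2..} t \<partial>lborel)"
    proof (rule nn_integral_mono)
      fix t :: real
      have "H t \<le> C3 * ?E * ?R t" if "t \<ge> 2"
        using mult_right_mono[OF large(2)[OF that, of x y], of "t powr (\<sigma> - 1)"]
        unfolding H_def d_def b_def by (simp add: mult_ac)
      then show "ennreal (H t) * indicator {0<..} t \<le> ennreal (C2 * ?P c2 t) * indicator {0<..2} t
        + ennreal (C3 * ?E * ?R t) * indicator {2..} t"
        using small(6)[of t] by (cases "t \<le> 2") (auto split: split_indicator intro!: ennreal_leI add_increasing2)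
    qed
    also have "\<dots> = integral_over {0<..2} (\<lambda>t. C2 * ?P c2 t) + integral_over {2..} (\<lambda>t. C3 * ?E * ?R t)"
      by (rule nn_integral_add) auto
    also have "integral_over {0<..2} (\<lambda>t. C2 * ?P c2 t) = ennreal C2 * integral_over {0<..2} (?P c2)"
      using small(4) by (intro integral_over_cmult) auto
    also have "integral_over {2..} (\<lambda>t. C3 * ?E * ?R t) \<le> ennreal (C3 * ?E * (L * 2 powr (\<sigma> - 1 + 1)))"
      by (rule integral_over_upper[OF subset_refl _ _ L(2)]) (use large(1) in auto)
    also have "C3 * ?E * (L * 2 powr (\<sigma> - 1 + 1)) = D * ?E" by (simp add: D_def)
    finally have "integral_over {0<..} H \<le> ennreal C2 * integral_over {0<..2} (?P c2) + ennreal D * ennreal ?E"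
      using D by (simp add: add_left_mono ennreal_mult')
    also have "\<dots> \<le> ennreal (C2 + D) * integral_over {0<..2} (?P c2) + ennreal (C2 + D) * ennreal ?E"
      using small(4) D by (intro add_mono mult_right_mono ennreal_leI) auto
    also have "\<dots> = ennreal (C2 + D) * (integral_over {0<..2} (?P c2) + ennreal ?E)"
      by (simp only: distrib_left)
    finally have "ennreal g * integral_over {0<..} H
        \<le> ennreal g * (ennreal (C2 + D) * (integral_over {0<..2} (?P c2) + ennreal ?E))"
      by (rule mult_left_mono) simp
    then show "dunkl_potential_kernel \<alpha> \<sigma> x y
          \<le> ennreal (g * (C2 + D)) * (profile_integral (\<alpha> + \<delta>) (\<sigma> + \<delta>) c2 (gap x y) (extent x y)
              + ennreal (exp (- d * (extent x y)\<^sup>2)))"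
      unfolding K a_def [symmetric] b_def [symmetric]
      using g small(4) D by (simp only: ennreal_mult mult.assoc add_nonneg_nonneg less_imp_le)
  qed (use small large D g in \<open>auto simp: d_def\<close>)
qed

lemma two_sided_boundI:
  assumes k: "k > 0" and K: "K > 0"
    and lower: "\<And>x y. (x, y) \<in> S \<Longrightarrow> ennreal k * Y x y \<le> X x y"
    and upper: "\<And>x y. (x, y) \<in> S \<Longrightarrow> X x y \<le> ennreal K * Y x y"
  shows "two_sided_bound S X Y"
proof -
  define C where "C = max (1 / k) K"
  have C0: "1 / k \<le> C" "C > 0" "K \<le> C"
    using K by (auto simp: C_def less_max_iff_disj)
  then have C: "C > 0" "1 / C \<le> k" "K \<le> C"
    using k by (auto simp: field_simps)
  have "ennreal (1 / C) * Y x y \<le> X x y \<and> X x y \<le> ennreal C * Y x y" if "(x, y) \<in> S" for x y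
    using order_trans[OF mult_right_mono[OF ennreal_leI[OF C(2)]] lower[OF that]]
      order_trans[OF upper[OF that] mult_right_mono[OF ennreal_leI[OF C(3)]]] by simp
  then have "\<forall>(x, y)\<in>S. ennreal (1 / C) * Y x y \<le> X x y \<and> X x y \<le> ennreal C * Y x y" by auto
  with C(1) show ?thesis unfolding two_sided_bound_def by blast
qed

lemma two_sided_exp_boundI:
  assumes k: "k > 0" and K: "K > 0" and c: "c1 > 0" "c2 > 0"
    and lower: "\<And>x y. (x, y) \<in> S \<Longrightarrow> ennreal k * Y x y * ennreal (exp (- c1 * Z x y)) \<le> X x y"
    and upper: "\<And>x y. (x, y) \<in> S \<Longrightarrow> X x y \<le> ennreal K * Y x y * ennreal (exp (- c2 * Z x y))"
  shows "two_sided_exp_bound S X Y Z"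
proof -
  define C where "C = max (1 / k) K"
  have C0: "1 / k \<le> C" "C > 0" "K \<le> C"
    using K by (auto simp: C_def less_max_iff_disj)
  then have C: "C > 0" "1 / C \<le> k" "K \<le> C"
    using k by (auto simp: field_simps)
  have "ennreal (1 / C) * Y x y * ennreal (exp (- c1 * Z x y)) \<le> X x y \<and>
      X x y \<le> ennreal C * Y x y * ennreal (exp (- c2 * Z x y))" if "(x, y) \<in> S" for x y
    using order_trans[OF mult_right_mono[OF mult_right_mono[OF ennreal_leI[OF C(2)]]] lower[OF that]]
      order_trans[OF upper[OF that] mult_right_mono[OF mult_right_mono[OF ennreal_leI[OF C(3)]]]] by simp
  then have "\<forall>(x, y)\<in>S. ennreal (1 / C) * Y x y * ennreal (exp (- c1 * Z x y)) \<le> X x y \<and>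
      X x y \<le> ennreal C * Y x y * ennreal (exp (- c2 * Z x y))" by auto
  with C(1) c show ?thesis unfolding two_sided_exp_bound_def by blast
qed

lemma kernel_near_bound:
  fixes \<alpha> \<sigma> \<delta> :: real
  assumes \<alpha>: "\<alpha> > -1/2" and \<sigma>: "\<sigma> > 0" and \<delta>: "\<delta> \<ge> 0"
    and S: "\<And>x y. (x, y) \<in> S \<Longrightarrow> \<delta> = of_bool (x * y < 0) \<and> extent x y \<le> 1"
    and Y: "\<And>x y. (x, y) \<in> S \<Longrightarrow> Y x y = near_bound (\<alpha> + \<delta>) (\<sigma> + \<delta>) (gap x y) (extent x y)"
  shows "two_sided_bound S (dunkl_potential_kernel \<alpha> \<sigma>) Y"
proof -
  have \<alpha>': "\<alpha> + \<delta> > -1/2" using \<alpha> \<delta> by simp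
  obtain c1 C1 c2 C2 d where K: "c1 > 0" "C1 > 0" "c2 > 0" "C2 > 0" "d > 0"
    "\<And>x y. \<delta> = of_bool (x * y < 0) \<Longrightarrow>
        ennreal C1 * profile_integral (\<alpha> + \<delta>) (\<sigma> + \<delta>) c1 (gap x y) (extent x y)
          \<le> dunkl_potential_kernel \<alpha> \<sigma> x y"
    "\<And>x y. \<delta> = of_bool (x * y < 0) \<Longrightarrow>
        dunkl_potential_kernel \<alpha> \<sigma> x y
          \<le> ennreal C2 * (profile_integral (\<alpha> + \<delta>) (\<sigma> + \<delta>) c2 (gap x y) (extent x y)
              + ennreal (exp (- d * (extent x y)\<^sup>2)))"
    by (rule potential_kernel_bounds[OF \<alpha> \<sigma> \<delta>]) (rule that)
  obtain k where k: "k > 0" "\<And>a b. 0 \<le> a \<Longrightarrow> a \<le> b \<Longrightarrow> b \<le> 1 \<Longrightarrow>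
    ennreal k * near_bound (\<alpha> + \<delta>) (\<sigma> + \<delta>) a b \<le> profile_integral (\<alpha> + \<delta>) (\<sigma> + \<delta>) c1 a b"
    using near_bound_lower[OF \<alpha>' K(1)] by blast
  obtain k' where k': "k' > 0" "\<And>a b. 0 \<le> a \<Longrightarrow> a \<le> b \<Longrightarrow> b \<le> 1 \<Longrightarrow>
    profile_integral (\<alpha> + \<delta>) (\<sigma> + \<delta>) c2 a b + 1 \<le> ennreal k' * near_bound (\<alpha> + \<delta>) (\<sigma> + \<delta>) a b"
    using near_bound_upper[OF \<alpha>' K(3)] by blast
  show ?thesis
  proof (rule two_sided_boundI[of "C1 * k" "C2 * k'"])
    fix x y assume xyS: "(x, y) \<in> S"
    then have xy: "\<delta> = of_bool (x * y < 0)" and b: "extent x y \<le> 1" using S by blast+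
    define a where "a = (gap x y)"
    define b where "b = \<bar>x\<bar> + \<bar>y\<bar>"
    have ab: "0 \<le> a" "a \<le> b" "b \<le> 1" using b by (auto simp: a_def b_def)
    have "ennreal (C1 * k) * near_bound (\<alpha> + \<delta>) (\<sigma> + \<delta>) a b = ennreal C1 * (ennreal k * near_bound (\<alpha> + \<delta>) (\<sigma> + \<delta>) a b)"
      using K(2) k(1) by (simp add: ennreal_mult mult.assoc)
    also have "\<dots> \<le> ennreal C1 * profile_integral (\<alpha> + \<delta>) (\<sigma> + \<delta>) c1 a b"
      by (intro mult_left_mono k(2) ab) auto
    also have "\<dots> \<le> dunkl_potential_kernel \<alpha> \<sigma> x y"
      unfolding a_def b_def by (rule K(6)[OF xy])
    finally show "ennreal (C1 * k) * Y x y
        \<le> dunkl_potential_kernel \<alpha> \<sigma> x y"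
      unfolding a_def b_def Y[OF xyS] .
    have "dunkl_potential_kernel \<alpha> \<sigma> x y
        \<le> ennreal C2 * (profile_integral (\<alpha> + \<delta>) (\<sigma> + \<delta>) c2 a b + ennreal (exp (- d * b\<^sup>2)))"
      unfolding a_def b_def by (rule K(7)[OF xy])
    also have "\<dots> \<le> ennreal C2 * (profile_integral (\<alpha> + \<delta>) (\<sigma> + \<delta>) c2 a b + 1)"
      using K(5) by (intro mult_left_mono add_left_mono) (auto simp: ennreal_le_1)
    also have "\<dots> \<le> ennreal C2 * (ennreal k' * near_bound (\<alpha> + \<delta>) (\<sigma> + \<delta>) a b)"
      by (intro mult_left_mono k'(2) ab) auto
    also have "\<dots> = ennreal (C2 * k') * near_bound (\<alpha> + \<delta>) (\<sigma> + \<delta>) a b"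
      using K(4) k'(1) by (simp add: ennreal_mult mult.assoc)
    finally show "dunkl_potential_kernel \<alpha> \<sigma> x y
        \<le> ennreal (C2 * k') * Y x y"
      unfolding a_def b_def Y[OF xyS] .
  qed (use K(1-5) k(1) k'(1) in auto)
qed

lemma kernel_far_bound:
  fixes \<alpha> \<sigma> \<delta> :: real
  assumes \<alpha>: "\<alpha> > -1/2" and \<sigma>: "\<sigma> > 0" and \<delta>: "\<delta> \<ge> 0"
    and S: "\<And>x y. (x, y) \<in> S \<Longrightarrow> \<delta> = of_bool (x * y < 0) \<and> extent x y > 1"
    and Y: "\<And>x y. (x, y) \<in> S \<Longrightarrow> Y x y = far_bound (\<alpha> + \<delta>) (\<sigma> + \<delta>) (gap x y) (extent x y)"
    and Z: "\<And>x y. (x, y) \<in> S \<Longrightarrow> Z x y = gap x y * extent x y"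
  shows "two_sided_exp_bound S (dunkl_potential_kernel \<alpha> \<sigma>) Y Z"
proof -
  have \<alpha>': "\<alpha> + \<delta> > -1/2" using \<alpha> \<delta> by simp
  obtain c1 C1 c2 C2 d where K: "c1 > 0" "C1 > 0" "c2 > 0" "C2 > 0" "d > 0"
    "\<And>x y. \<delta> = of_bool (x * y < 0) \<Longrightarrow>
        ennreal C1 * profile_integral (\<alpha> + \<delta>) (\<sigma> + \<delta>) c1 (gap x y) (extent x y)
          \<le> dunkl_potential_kernel \<alpha> \<sigma> x y"
    "\<And>x y. \<delta> = of_bool (x * y < 0) \<Longrightarrow>
        dunkl_potential_kernel \<alpha> \<sigma> x y
          \<le> ennreal C2 * (profile_integral (\<alpha> + \<delta>) (\<sigma> + \<delta>) c2 (gap x y) (extent x y)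
              + ennreal (exp (- d * (extent x y)\<^sup>2)))"
    by (rule potential_kernel_bounds[OF \<alpha> \<sigma> \<delta>]) (rule that)
  obtain k where k: "k > 0" "\<And>a b. 0 \<le> a \<Longrightarrow> a \<le> b \<Longrightarrow> 1 < b \<Longrightarrow>
    ennreal k * far_bound (\<alpha> + \<delta>) (\<sigma> + \<delta>) a b * ennreal (exp (- (3 * c1) * (a * b)))
      \<le> profile_integral (\<alpha> + \<delta>) (\<sigma> + \<delta>) c1 a b"
    using far_bound_lower[OF \<alpha>' K(1)] by blast
  obtain k' where k': "k' > 0" "\<And>a b. 0 \<le> a \<Longrightarrow> a \<le> b \<Longrightarrow> 1 < b \<Longrightarrow>
    profile_integral (\<alpha> + \<delta>) (\<sigma> + \<delta>) c2 a b + ennreal (exp (- d * b\<^sup>2))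
      \<le> ennreal k' * far_bound (\<alpha> + \<delta>) (\<sigma> + \<delta>) a b * ennreal (exp (- (min c2 (d / 2)) * (a * b)))"
    using far_bound_upper[OF \<alpha>' K(3,5)] by blast
  show ?thesis
  proof (rule two_sided_exp_boundI[of "C1 * k" "C2 * k'" "3 * c1" "min c2 (d / 2)"])
    fix x y assume xyS: "(x, y) \<in> S"
    then have xy: "\<delta> = of_bool (x * y < 0)" and b: "extent x y > 1" using S by blast+
    define a where "a = (gap x y)"
    define b where "b = \<bar>x\<bar> + \<bar>y\<bar>"
    have ab: "0 \<le> a" "a \<le> b" "1 < b" using b by (auto simp: a_def b_def)
    have "ennreal (C1 * k) * far_bound (\<alpha> + \<delta>) (\<sigma> + \<delta>) a b * ennreal (exp (- (3 * c1) * (a * b)))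
        = ennreal C1 * (ennreal k * far_bound (\<alpha> + \<delta>) (\<sigma> + \<delta>) a b * ennreal (exp (- (3 * c1) * (a * b))))"
      using K(2) k(1) by (simp add: ennreal_mult mult.assoc)
    also have "\<dots> \<le> ennreal C1 * profile_integral (\<alpha> + \<delta>) (\<sigma> + \<delta>) c1 a b"
      by (intro mult_left_mono k(2) ab) auto
    also have "\<dots> \<le> dunkl_potential_kernel \<alpha> \<sigma> x y"
      unfolding a_def b_def by (rule K(6)[OF xy])
    finally show "ennreal (C1 * k) * Y x y
        * ennreal (exp (- (3 * c1) * Z x y)) \<le> dunkl_potential_kernel \<alpha> \<sigma> x y"
      unfolding a_def b_def Y[OF xyS] Z[OF xyS] .
    have "dunkl_potential_kernel \<alpha> \<sigma> x y
        \<le> ennreal C2 * (profile_integral (\<alpha> + \<delta>) (\<sigma> + \<delta>) c2 a b + ennreal (exp (- d * b\<^sup>2)))"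
      unfolding a_def b_def by (rule K(7)[OF xy])
    also have "\<dots> \<le> ennreal C2 * (ennreal k' * far_bound (\<alpha> + \<delta>) (\<sigma> + \<delta>) a b
        * ennreal (exp (- (min c2 (d / 2)) * (a * b))))"
      by (intro mult_left_mono k'(2) ab) auto
    also have "\<dots> = ennreal (C2 * k') * far_bound (\<alpha> + \<delta>) (\<sigma> + \<delta>) a b
        * ennreal (exp (- (min c2 (d / 2)) * (a * b)))"
      using K(4) k'(1) by (simp add: ennreal_mult mult.assoc)
    finally show "dunkl_potential_kernel \<alpha> \<sigma> x y
        \<le> ennreal (C2 * k') * Y x y
          * ennreal (exp (- (min c2 (d / 2)) * Z x y))"
      unfolding a_def b_def Y[OF xyS] Z[OF xyS] .
  qed (use K(1-5) k(1) k'(1) in auto)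
qed

lemma abs_diff_sum_same_sign:
  fixes x y :: real
  assumes "x * y \<ge> 0"
  shows "\<bar>x - y\<bar> = gap x y" "\<bar>x + y\<bar> = extent x y"
  using assms by (auto simp: zero_le_mult_iff)

lemma abs_diff_sum_opposite_sign:
  fixes x y :: real
  assumes "x * y < 0"
  shows "\<bar>x - y\<bar> = extent x y" "\<bar>x + y\<bar> = gap x y"
  using assms by (auto simp: mult_less_0_iff)

lemma abs_diff_mult_abs_sum: "\<bar>x - y\<bar> * \<bar>x + y\<bar> = gap x y * extent x y"
  by (cases "x * y < 0")
     (simp_all only: abs_diff_sum_opposite_sign abs_diff_sum_same_sign not_less mult.commute)

lemma bound_A1_eq: "x * y \<ge> 0 \<Longrightarrow> bound_A1 \<alpha> \<sigma> x y = near_bound \<alpha> \<sigma> (gap x y) (extent x y)"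
  unfolding bound_A1_def near_bound_def by (simp only: abs_diff_sum_same_sign)

lemma bound_A2_eq: "x * y \<ge> 0 \<Longrightarrow> bound_A2 \<alpha> \<sigma> x y = far_bound \<alpha> \<sigma> (gap x y) (extent x y)"
  unfolding bound_A2_def far_bound_def by (simp only: abs_diff_sum_same_sign)

text \<open>
  Since \<open>\<sigma> + 1 > 1/2\<close>, the last case of the bound applies, which does not depend on \<open>a\<close>.
\<close>

lemma bound_B1_eq:
  assumes "\<sigma> > 0"
  shows "bound_B1 \<alpha> \<sigma> x y = near_bound (\<alpha> + 1) (\<sigma> + 1) a (extent x y)"
proof -
  have "(-2 * (\<alpha> + 1) - 1) + (2 * (\<sigma> + 1) - 1) = (-2 * \<alpha> - 1) + (2 * \<sigma> - 1)" by simp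
  then show ?thesis
    using assms unfolding bound_B1_def near_bound_def by simp
qed

lemma bound_B2_eq:
  assumes "\<sigma> > 0" and "\<bar>x\<bar> + \<bar>y\<bar> > 0"
  shows "bound_B2 \<alpha> \<sigma> x y = far_bound (\<alpha> + 1) (\<sigma> + 1) a (extent x y)"
proof -
  define b where "b = \<bar>x\<bar> + \<bar>y\<bar>"
  have b: "b > 0" using assms(2) by (simp add: b_def)
  have "b powr (-2 * \<alpha> - 1) * b powr (1 - 2 * \<sigma>) * b powr (-4)
      = b powr (-2 * (\<alpha> + 1) - 1) * b powr (1 - 2 * (\<sigma> + 1))"
    unfolding powr_add [symmetric] by (simp add: algebra_simps)
  then show ?thesis
    using assms(1) b unfolding bound_B2_def far_bound_def b_def [symmetric]
    by (simp add: epow_pos flip: ennreal_mult)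
qed

theorem theorem2p4:
  fixes \<alpha> \<sigma> :: real
  assumes "\<alpha> > -1/2" and "\<sigma> > 0"
  shows
    "two_sided_bound {(x, y). x * y \<ge> 0 \<and> \<bar>x\<bar> + \<bar>y\<bar> \<le> 1}
       (dunkl_potential_kernel \<alpha> \<sigma>) (bound_A1 \<alpha> \<sigma>)
     \<and> two_sided_exp_bound {(x, y). x * y \<ge> 0 \<and> \<bar>x\<bar> + \<bar>y\<bar> > 1}
       (dunkl_potential_kernel \<alpha> \<sigma>) (bound_A2 \<alpha> \<sigma>) (\<lambda>x y. \<bar>x - y\<bar> * \<bar>x + y\<bar>)
     \<and> two_sided_bound {(x, y). x * y < 0 \<and> \<bar>x\<bar> + \<bar>y\<bar> \<le> 1}
       (dunkl_potential_kernel \<alpha> \<sigma>) (bound_B1 \<alpha> \<sigma>)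
     \<and> two_sided_exp_bound {(x, y). x * y < 0 \<and> \<bar>x\<bar> + \<bar>y\<bar> > 1}
       (dunkl_potential_kernel \<alpha> \<sigma>) (bound_B2 \<alpha> \<sigma>) (\<lambda>x y. \<bar>x - y\<bar> * \<bar>x + y\<bar>)"
proof (intro conjI)
  show "two_sided_bound {(x, y). x * y \<ge> 0 \<and> \<bar>x\<bar> + \<bar>y\<bar> \<le> 1}
      (dunkl_potential_kernel \<alpha> \<sigma>) (bound_A1 \<alpha> \<sigma>)"
    by (rule kernel_near_bound[OF assms, of 0]) (auto simp: bound_A1_eq)
  show "two_sided_exp_bound {(x, y). x * y \<ge> 0 \<and> \<bar>x\<bar> + \<bar>y\<bar> > 1}
      (dunkl_potential_kernel \<alpha> \<sigma>) (bound_A2 \<alpha> \<sigma>) (\<lambda>x y. \<bar>x - y\<bar> * \<bar>x + y\<bar>)"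
    by (rule kernel_far_bound[OF assms, of 0, OF _ _ _ abs_diff_mult_abs_sum]) (auto simp: bound_A2_eq)
  show "two_sided_bound {(x, y). x * y < 0 \<and> \<bar>x\<bar> + \<bar>y\<bar> \<le> 1}
      (dunkl_potential_kernel \<alpha> \<sigma>) (bound_B1 \<alpha> \<sigma>)"
    by (rule kernel_near_bound[OF assms, of 1, OF _ _ bound_B1_eq[OF assms(2)]]) auto
  show "two_sided_exp_bound {(x, y). x * y < 0 \<and> \<bar>x\<bar> + \<bar>y\<bar> > 1}
      (dunkl_potential_kernel \<alpha> \<sigma>) (bound_B2 \<alpha> \<sigma>) (\<lambda>x y. \<bar>x - y\<bar> * \<bar>x + y\<bar>)"
    by (rule kernel_far_bound[OF assms, of 1, OF _ _ bound_B2_eq[OF assms(2)] abs_diff_mult_abs_sum]) auto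
qed

end
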